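(* Fix $\beta>0$. Let $t\in\mathbb{R}$ and let $g:\mathbb{R}\to\mathbb{R}$ be measurable, $2\pi$-periodic, bounded, and $C^{2,q}$ in neighborhoods of $\frac{\pi}{2}$ and $-\frac{\pi}{2}$, with $0<q\le1$. Let $(\theta_1,\ldots,\theta_n)$ be distributed according to the mirror-type point process with parameters $n$ and $\beta$. For any fixed $0<\zeta<\min\{\frac14,\frac q2\}$, as $n\to\infty$, $$\mathbb{E}\Big[e^{it\sum_{j=1}^n g(\theta_j)}\Big]=\frac{I(itg)}{I(0)}=\frac{e^{nitg(\frac{\pi}{2})}}{2}\exp\bigg(-\frac{g'(\frac{\pi}{2})^2}{\beta}t^2+\frac{2g''(\frac{\pi}{2})}{\beta}it+\mathcal{O}(n^{-\zeta})\bigg)+\frac{e^{nitg(-\frac{\pi}{2})}}{2}\exp\bigg(-\frac{g'(-\frac{\pi}{2})^2}{\beta}t^2+\frac{2g''(-\frac{\pi}{2})}{\beta}it+\mathcal{O}(n^{-\zeta})\bigg).$$ Furthermore, these asymptotics hold uniformly for $t$ in compact subsets of $\mathbb{R}$ (i.e. for each compact $\mathcal{K}\subset\mathbb{R}$ the two $\mathcal{O}(n^{-\zeta})$ terms are bounded by $Cn^{-\zeta}$ for all $t\in\mathcal{K}$ and all large $n$, with $C$ independent of $t\in\mathcal{K}$).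
   Context: For $n\in\mathbb{N}_{>0}$ and $\beta>0$, the mirror-type point process is the probability measure on $(-\pi,\pi]^n$ given by $$\frac{1}{Z_n}\prod_{1\le j<k\le n}|e^{i\theta_j}-e^{-i\theta_k}|^{\beta}\prod_{j=1}^n d\theta_j,\qquad \theta_1,\ldots,\theta_n\in(-\pi,\pi],$$ where $Z_n$ is the normalization constant; $\mathbb{E}$ is expectation with respect to it. For a $2\pi$-periodic $f:\mathbb{R}\to\mathbb{C}$, $$I(f)=\int_{-\pi}^{\pi}\cdots\int_{-\pi}^{\pi}\prod_{1\le j<k\le n}|e^{i\theta_j}-e^{-i\theta_k}|^{\beta}\prod_{j=1}^n e^{f(\theta_j)}\,d\theta_j,$$ so that $I(0)=Z_n$. A function is $C^{2,q}$ in a neighborhood of a point if it is twice continuously differentiable there with $q$-Hölder continuous second derivative. The two $\mathcal{O}(n^{-\zeta})$ terms denote two (possibly different, complex-valued) quantities, each bounded in modulus by a constant times $n^{-\zeta}$ for all large $n$. *)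

theory Defs
  imports "HOL-Probability.Probability"
begin

definition mirror_weight :: "nat \<Rightarrow> real \<Rightarrow> (nat \<Rightarrow> real) \<Rightarrow> real" where
  "mirror_weight n \<beta> \<theta> =
     (\<Prod>j=1..n. \<Prod>k=j+1..n.
        norm (exp (\<i> * of_real (\<theta> j)) - exp (- (\<i> * of_real (\<theta> k)))) powr \<beta>)"

text \<open>Points are functions on \<open>{1..n}\<close>. Completed Lebesgue measure is used in each coordinate
  so that Lebesgue measurable (not only Borel measurable) test functions are covered.\<close>

definition torus_measure :: "nat \<Rightarrow> (nat \<Rightarrow> real) measure" where
  "torus_measure n = (\<Pi>\<^sub>M j\<in>{1..n}. lebesgue_on {- pi<..pi})"

definition mirror_Z :: "nat \<Rightarrow> real \<Rightarrow> real" where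
  "mirror_Z n \<beta> = (\<integral>\<theta>. mirror_weight n \<beta> \<theta> \<partial>torus_measure n)"

definition mirror_process :: "nat \<Rightarrow> real \<Rightarrow> (nat \<Rightarrow> real) measure" where
  "mirror_process n \<beta> =
     density (torus_measure n) (\<lambda>\<theta>. ennreal (mirror_weight n \<beta> \<theta> / mirror_Z n \<beta>))"

definition mirror_I :: "nat \<Rightarrow> real \<Rightarrow> (real \<Rightarrow> complex) \<Rightarrow> complex" where
  "mirror_I n \<beta> f =
     (\<integral>\<theta>. of_real (mirror_weight n \<beta> \<theta>) * (\<Prod>j=1..n. exp (f (\<theta> j))) \<partial>torus_measure n)"

definition C2_Hoelder_near :: "real \<Rightarrow> (real \<Rightarrow> real) \<Rightarrow> real \<Rightarrow> bool" where
  "C2_Hoelder_near q g x \<longleftrightarrow>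
     (\<exists>U. open U \<and> x \<in> U \<and>
        (\<forall>y\<in>U. g differentiable (at y) \<and> deriv g differentiable (at y)) \<and>
        continuous_on U (deriv (deriv g)) \<and>
        (\<exists>C. \<forall>y\<in>U. \<forall>z\<in>U. \<bar>deriv (deriv g) y - deriv (deriv g) z\<bar> \<le> C * \<bar>y - z\<bar> powr q))"

lemma mirror_I_zero: "mirror_I n \<beta> (\<lambda>_. 0) = of_real (mirror_Z n \<beta>)"
  by (simp add: mirror_I_def mirror_Z_def)

lemma mirror_weight_nonneg: "0 \<le> mirror_weight n \<beta> \<theta>"
  by (auto simp: mirror_weight_def intro!: prod_nonneg)

lemma mirror_weight_le:
  assumes "\<beta> > 0"
  shows "mirror_weight n \<beta> \<theta> \<le> (\<Prod>j=1..n. \<Prod>k=j+1..n. 2 powr \<beta>)"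
proof -
  have "norm (exp (\<i> * of_real a) - exp (- (\<i> * of_real b))) \<le> 2" for a b :: real
    using norm_triangle_ineq4[of "exp (\<i> * of_real a)" "exp (\<i> * of_real (- b))"]
    by (simp only: norm_exp_i_times) simp
  then show ?thesis
    unfolding mirror_weight_def using assms
    by (intro prod_mono conjI prod_nonneg powr_mono2) auto
qed

lemma space_torus_measure: "space (torus_measure n) = (\<Pi>\<^sub>E j\<in>{1..n}. {- pi<..pi})"
  by (simp add: torus_measure_def space_PiM)

lemma measurable_torus_component [measurable]:
  "j \<in> {1..n} \<Longrightarrow> (\<lambda>\<theta>. \<theta> j) \<in> borel_measurable (torus_measure n)"
proof -
  assume "j \<in> {1..n}"
  then have "(\<lambda>\<theta>. \<theta> j) \<in> torus_measure n \<rightarrow>\<^sub>M lebesgue_on {- pi<..pi}"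
    unfolding torus_measure_def by (rule measurable_component_singleton)
  moreover have "(\<lambda>x. x) \<in> borel_measurable (lebesgue_on {- pi<..pi :: real})"
    by (intro measurable_restrict_space1 measurable_completion) simp
  ultimately show ?thesis
    by (rule measurable_compose)
qed

lemma measurable_mirror_weight [measurable]:
  "mirror_weight n \<beta> \<in> borel_measurable (torus_measure n)"
  unfolding mirror_weight_def
proof (intro borel_measurable_prod)
  fix j k assume "j \<in> {1..n}" "k \<in> {j+1..n}"
  then have [measurable]: "(\<lambda>\<theta>. \<theta> j) \<in> borel_measurable (torus_measure n)"
      "(\<lambda>\<theta>. \<theta> k) \<in> borel_measurable (torus_measure n)"
    by auto
  show "(\<lambda>\<theta>. norm (exp (\<i> * of_real (\<theta> j)) - exp (- (\<i> * of_real (\<theta> k)))) powr \<beta>)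
     \<in> borel_measurable (torus_measure n)"
    by measurable
qed

lemma emeasure_torus_box:
  assumes "A \<in> sets lebesgue" "A \<subseteq> {- pi<..pi}"
  shows "emeasure (torus_measure n) (\<Pi>\<^sub>E j\<in>{1..n}. A) = emeasure lebesgue A ^ n"
proof -
  interpret L: finite_measure "lebesgue_on {- pi<..pi}"
    by (rule finite_measureI) (simp add: emeasure_restrict_space)
  interpret product_sigma_finite "\<lambda>_::nat. lebesgue_on {- pi<..pi}" ..
  have "A \<in> sets (lebesgue_on {- pi<..pi})"
    using assms by (simp add: sets_restrict_space_iff)
  then show ?thesis
    using assms unfolding torus_measure_def
    by (subst emeasure_PiM) (auto simp: emeasure_restrict_space)
qed

lemma finite_torus_measure: "finite_measure (torus_measure n)"
proof (rule finite_measureI)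
  have "emeasure (torus_measure n) (space (torus_measure n)) = ennreal (2 * pi) ^ n"
    unfolding space_torus_measure by (subst emeasure_torus_box) auto
  then show "emeasure (torus_measure n) (space (torus_measure n)) \<noteq> \<infinity>"
    by (simp add: ennreal_power)
qed

lemma integrable_mirror_weight:
  assumes "\<beta> > 0"
  shows "integrable (torus_measure n) (mirror_weight n \<beta>)"
  using mirror_weight_le[OF assms, of n] mirror_weight_nonneg[of n \<beta>]
  by (intro finite_measure.integrable_const_bound[OF finite_torus_measure,
        where B = "\<Prod>j=1..n. \<Prod>k=j+1..n. 2 powr \<beta>"]) auto

lemma mirror_Z_pos:
  assumes "\<beta> > 0"
  shows "mirror_Z n \<beta> > 0"
proof -
  let ?A = "\<Pi>\<^sub>E j\<in>{1..n}. {pi/4<..<3*pi/4}"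
  have pos: "mirror_weight n \<beta> \<theta> > 0" if \<theta>: "\<theta> \<in> ?A" for \<theta>
    unfolding mirror_weight_def
  proof (intro prod_pos ballI)
    fix j k assume "j \<in> {1..n}" "k \<in> {j+1..n}"
    then have "\<theta> j \<in> {pi/4<..<3*pi/4}" "\<theta> k \<in> {pi/4<..<3*pi/4}"
      using \<theta> by (auto simp: PiE_iff)
    then have "sin (\<theta> j) > 0" "sin (\<theta> k) > 0"
      using pi_gt_zero by (auto intro!: sin_gt_zero simp del: pi_gt_zero)
    then have "Im (exp (\<i> * of_real (\<theta> j))) \<noteq> Im (exp (- (\<i> * of_real (\<theta> k))))"
      by (simp add: Im_exp)
    then show "0 < norm (exp (\<i> * of_real (\<theta> j)) - exp (- (\<i> * of_real (\<theta> k)))) powr \<beta>"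
      by auto
  qed
  have A: "emeasure (torus_measure n) ?A > 0"
  proof (subst emeasure_torus_box)
    show "{pi/4<..<3*pi/4} \<subseteq> {- pi<..pi}"
      using pi_gt_zero by (auto simp del: pi_gt_zero)
  qed (auto simp: ennreal_power)
  have "mirror_Z n \<beta> \<noteq> 0"
  proof
    assume "mirror_Z n \<beta> = 0"
    then have "AE \<theta> in torus_measure n. mirror_weight n \<beta> \<theta> = 0"
      unfolding mirror_Z_def
      by (subst (asm) integral_nonneg_eq_0_iff_AE[OF integrable_mirror_weight[OF assms]])
         (auto simp: mirror_weight_nonneg)
    then have "AE \<theta> in torus_measure n. \<theta> \<notin> ?A"
      by eventually_elim (use pos in force)
    moreover have "?A \<in> sets (torus_measure n)"
      using A emeasure_notin_sets by fastforce
    ultimately have "emeasure (torus_measure n) ?A = 0"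
      by (subst (asm) AE_iff_null_sets[symmetric]) auto
    with A show False
      by simp
  qed
  moreover have "mirror_Z n \<beta> \<ge> 0"
    unfolding mirror_Z_def by (intro Bochner_Integration.integral_nonneg) (simp add: mirror_weight_nonneg)
  ultimately show ?thesis
    by simp
qed

lemma prob_space_mirror_process:
  assumes "\<beta> > 0"
  shows "prob_space (mirror_process n \<beta>)"
proof
  have "emeasure (mirror_process n \<beta>) (space (mirror_process n \<beta>)) =
      (\<integral>\<^sup>+\<theta>. ennreal (mirror_weight n \<beta> \<theta> / mirror_Z n \<beta>) \<partial>torus_measure n)"
    unfolding mirror_process_def
    by (simp add: emeasure_density cong: nn_integral_cong)
  also have "\<dots> = ennreal (\<integral>\<theta>. mirror_weight n \<beta> \<theta> / mirror_Z n \<beta> \<partial>torus_measure n)"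
    using mirror_Z_pos[OF assms, of n]
    by (intro nn_integral_eq_integral integrable_divide integrable_mirror_weight assms)
       (auto simp: mirror_weight_nonneg)
  also have "\<dots> = 1"
    using mirror_Z_pos[OF assms, of n] by (simp flip: mirror_Z_def)
  finally show "emeasure (mirror_process n \<beta>) (space (mirror_process n \<beta>)) = 1" .
qed

end

theory Submission
  imports Defs "HOL-Real_Asymp.Real_Asymp"
begin

text \<open>Writing \<open>\<theta>\<^sub>j = s + x\<^sub>j\<close> with \<open>s = \<plusminus>\<pi>/2\<close>, each factor of the weight becomes
  \<open>2 \<bar>cos ((x\<^sub>j + x\<^sub>k) / 2)\<bar>\<close>, so the weight has two wells, in which all angles are near the same \<open>s\<close>.
  Since \<open>\<Sum>\<^sub>j\<^sub><\<^sub>k (x\<^sub>j + x\<^sub>k)\<^sup>2 = (n - 2) \<Sum> x\<^sub>j\<^sup>2 + (\<Sum> x\<^sub>j)\<^sup>2\<close>, the weight in a well is, relative to independent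
  centred Gaussians of variance \<open>\<sigma>\<^sup>2 = 4 / (\<beta> (n - 2))\<close>, the factor \<open>exp (- \<beta> S\<^sup>2 / 8 - \<beta> Q)\<close>
  with \<open>S = \<Sum> x\<^sub>j\<close> exactly Gaussian and \<open>Q \<ge> 0\<close> a sum over pairs of quartic terms. A covariance count shows that \<open>Q\<close> and
  \<open>\<Sum> x\<^sub>j\<^sup>2\<close> concentrate at rate \<open>n\<^sup>-\<^sup>1\<^sup>/\<^sup>2\<close>, and Taylor expansion of \<open>g\<close> at \<open>s\<close> costs \<open>n \<sigma>\<^bsup>2+q\<^esup>\<close>, so each well
  contributes an explicit Gaussian integral in \<open>S\<close> up to \<open>O(n\<^bsup>-q/2\<^esup>)\<close>, with the same amplitude for both wells. If \<open>k \<le> n/2\<close> angles sit in the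
  minority well, the cross factors cost \<open>exp (- c k n)\<close>, which beats both the number of such
  configurations and the loss of Gaussian decay, so mixed configurations are negligible. The total
  error is put into \<open>R\<^sub>1\<close>, with \<open>R\<^sub>2 = 0\<close>.\<close>

section \<open>Pair interactions and the weight near the wells\<close>

text \<open>The two limiting terms oscillate in \<open>n\<close> and may cancel, so a relative error
  for the expectation is out of reach. All errors are therefore additive, measured against the
  Gaussian mass of one well. No asymptotics of \<open>I(0)\<close> are computed: it is the same
  integral at \<open>t = 0\<close>, and mass and amplitude cancel in the quotient, so the amplitude
  only has to stay away from 0. Two corrections are of order one and cannot be dropped.
  \<open>S\<close> has variance \<open>n \<sigma>^2\<close>, close to 4/\<beta>, so
  \<open>exp (- \<beta> S^2 / 8)\<close> asymptotically halves it to 2/\<beta>, which is the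
  variance behind the factor \<open>exp (- g'^2 t^2 / \<beta>)\<close>. \<open>Q\<close> has mean of
  order \<open>n^2 \<sigma>^4\<close>, which is bounded but need not vanish; only its fluctuations
  are small. In the expansion of \<open>g\<close> the linear term stays inside the exact Gaussian
  integral, while the quadratic one is replaced by its limit \<open>g''/2 * 4/\<beta>\<close>. An
  additive error can finally be moved into an exponent because the modulus of each limiting term
  does not depend on \<open>n\<close> and is bounded below for \<open>t\<close> in a compact
  set.\<close>

lemma cos_le_exp_neg_square:
  assumes "\<bar>u\<bar> \<le> pi / 2"
  shows "cos u \<le> exp (- (u\<^sup>2 / 2))"
proof -
  have *: "cos x \<le> exp (- (x\<^sup>2 / 2))" if x: "0 \<le> x" "x \<le> pi / 2" for x :: real
  proof -
    \<comment> \<open>This is \<open>u <= tan u\<close> without the division, so that the endpoint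
      pi/2 is included.\<close>
    have tan: "u * cos u \<le> sin u" if "0 \<le> u" "u \<le> pi / 2" for u :: real
    proof -
      have "sin 0 - 0 * cos 0 \<le> sin u - u * cos u"
      proof (rule DERIV_nonneg_imp_nondecreasing[OF that(1)])
        fix y assume y: "0 \<le> y" "y \<le> u"
        have "((\<lambda>u. sin u - u * cos u) has_real_derivative y * sin y) (at y)"
          by (auto intro!: derivative_eq_intros)
        moreover have "0 \<le> y * sin y"
          using y that by (intro mult_nonneg_nonneg sin_ge_zero) auto
        ultimately show "\<exists>d. ((\<lambda>u. sin u - u * cos u) has_real_derivative d) (at y) \<and> 0 \<le> d"
          by blast
      qed
      then show ?thesis by simp
    qed
    have "cos x * exp (x\<^sup>2 / 2) \<le> cos 0 * exp (0\<^sup>2 / 2)"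
    proof (rule DERIV_nonpos_imp_nonincreasing[OF x(1)])
      fix y assume y: "0 \<le> y" "y \<le> x"
      have "((\<lambda>u. cos u * exp (u\<^sup>2 / 2)) has_real_derivative exp (y\<^sup>2 / 2) * (y * cos y - sin y)) (at y)"
        by (auto intro!: derivative_eq_intros simp: algebra_simps)
      moreover have "exp (y\<^sup>2 / 2) * (y * cos y - sin y) \<le> 0"
        using tan[of y] y x by (intro mult_nonneg_nonpos) auto
      ultimately show "\<exists>d. ((\<lambda>u. cos u * exp (u\<^sup>2 / 2)) has_real_derivative d) (at y) \<and> d \<le> 0"
        by blast
    qed
    then show ?thesis by (simp add: exp_minus field_simps)
  qed
  show ?thesis
    using *[of "\<bar>u\<bar>"] assms by simp
qed

text \<open>Agrees with the upper bound up to a quartic factor, so the weight deviates from a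
  Gaussian by quartic terms only. The constant comes from \<open>ln (1 - v) >= - v - 2 v^2\<close>
  at \<open>v = u^2 / 2\<close>, since \<open>2 v^2 = u^4 / 2\<close>.\<close>

lemma cos_ge_exp_neg_square:
  fixes u :: real
  assumes "\<bar>u\<bar> \<le> 1 / 2"
  shows "exp (- (u\<^sup>2 / 2) - u ^ 4 / 2) \<le> cos u"
proof -
  have u2: "u\<^sup>2 \<le> 1/4"
    using power_mono[of "\<bar>u\<bar>" "1/2" 2] assms by (simp add: power2_eq_square)
  have "1 - cos u = 2 * (sin (u/2))\<^sup>2"
    using cos_double_sin[of "u/2"] by simp
  also have "\<dots> \<le> 2 * (u/2)\<^sup>2"
    using abs_sin_x_le_abs_x[of "u/2"] by (simp only: abs_le_square_iff)
  finally have c: "1 - u\<^sup>2 / 2 \<le> cos u"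
    by (simp add: power2_eq_square)
  have "- (u\<^sup>2 / 2) - 2 * (u\<^sup>2 / 2)\<^sup>2 \<le> ln (1 - u\<^sup>2 / 2)"
    using u2 by (intro ln_one_minus_pos_lower_bound) auto
  then have "exp (- (u\<^sup>2 / 2) - 2 * (u\<^sup>2 / 2)\<^sup>2) \<le> 1 - u\<^sup>2 / 2"
    using u2 by (subst (asm) ln_ge_iff) auto
  moreover have "2 * (u\<^sup>2 / 2)\<^sup>2 = u ^ 4 / 2"
    by (simp add: power_divide)
  ultimately show ?thesis using c by simp
qed

text \<open>The interaction of two angles in opposite wells. The constants come from
  \<open>\<bar>y\<bar> \<le> 3/8 y\<^sup>2 + 2/3\<close>, where any coefficient below \<open>1/2\<close> would do: the loss \<open>3/32 y\<^sup>2\<close> must leave a positive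
  multiple of the Gaussian exponent \<open>1/8 (n - k) y\<^sup>2\<close> after being incurred \<open>k \<le> n/2\<close> times.\<close>

lemma abs_sin_half_sum_le:
  fixes x y :: real
  assumes "\<bar>x\<bar> \<le> pi / 2" "\<bar>y\<bar> \<le> pi / 2"
  shows "\<bar>sin ((x + y) / 2)\<bar> \<le> exp (- (1 / 12) + 3 / 32 * y\<^sup>2)"
proof -
  have "0 \<le> cos x * cos y"
    using assms by (intro mult_nonneg_nonneg cos_ge_zero) auto
  \<comment> \<open>Only \<open>y\<close> pays for the interaction. In the application
    \<open>x\<close> is the minority angle, whose Gaussian decay is given up, and \<open>y\<close>
    the majority angle, which has decay to spare.\<close>
  moreover have "sin x * sin y \<le> \<bar>y\<bar>"
  proof -
    have "sin x * sin y \<le> \<bar>sin x\<bar> * \<bar>sin y\<bar>"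
      by (metis abs_ge_self abs_mult)
    also have "\<dots> \<le> 1 * \<bar>y\<bar>"
      by (intro mult_mono abs_sin_x_le_abs_x abs_sin_le_one) auto
    finally show ?thesis by simp
  qed
  ultimately have "- \<bar>y\<bar> \<le> cos (x + y)"
    by (simp add: cos_add)
  moreover have "cos (x + y) = 2 * (cos ((x + y) / 2))\<^sup>2 - 1"
    using cos_double_cos[of "(x+y)/2"] by (simp only: mult_2 field_sum_of_halves)
  ultimately have c: "1 - \<bar>y\<bar> \<le> 2 * (cos ((x + y) / 2))\<^sup>2"
    by simp
  have "\<bar>sin ((x + y) / 2)\<bar>\<^sup>2 = 1 + - (cos ((x + y) / 2))\<^sup>2"
    by (simp add: sin_squared_eq)
  also have "\<dots> \<le> exp (- (cos ((x + y) / 2))\<^sup>2)"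
    by (rule exp_ge_add_one_self)
  also have "\<dots> \<le> exp (2 * (- (1 / 12) + 3 / 32 * y\<^sup>2))"
  proof -
    have "0 \<le> (\<bar>y\<bar> - 4/3)\<^sup>2" by simp
    then have "\<bar>y\<bar> \<le> 3 / 8 * \<bar>y\<bar>\<^sup>2 + 2 / 3"
      by (simp add: power2_eq_square algebra_simps)
    then show ?thesis using c by simp
  qed
  also have "\<dots> = (exp (- (1 / 12) + 3 / 32 * y\<^sup>2))\<^sup>2"
    by (simp add: exp_double[symmetric])
  finally show ?thesis
    by (rule power2_le_imp_le) simp
qed

lemma pair_sum_symmetric:
  fixes F :: "nat \<Rightarrow> nat \<Rightarrow> real"
  assumes "\<And>j k. F j k = F k j"
  shows "(\<Sum>j=1..n. \<Sum>k=j+1..n. F j k) = ((\<Sum>j=1..n. \<Sum>k=1..n. F j k) - (\<Sum>j=1..n. F j j)) / 2"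
proof (induction n)
  case (Suc n)
  have "(\<Sum>j=1..Suc n. \<Sum>k=j+1..Suc n. F j k) = (\<Sum>j=1..n. (\<Sum>k=j+1..n. F j k) + F j (Suc n))"
    by (simp add: sum.distrib)
  moreover have "(\<Sum>j=1..Suc n. \<Sum>k=1..Suc n. F j k)
      = (\<Sum>j=1..n. (\<Sum>k=1..n. F j k) + F j (Suc n)) + (\<Sum>k=1..n. F (Suc n) k) + F (Suc n) (Suc n)"
    by simp
  moreover have "(\<Sum>k=1..n. F (Suc n) k) = (\<Sum>k=1..n. F k (Suc n))"
    using assms by simp
  ultimately show ?case
    using Suc by (simp add: sum.distrib field_simps)
qed simp

text \<open>Here \<open>e\<close> is the indicator of the majority: pairs inside it interact
  quadratically, a mixed pair costs \<open>b + c x^2\<close> in its majority angle, and minority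
  pairs contribute nothing. The \<open>- 2\<close> comes from removing the diagonal terms
  \<open>4 x^2\<close> from the full double sum; it is the origin of \<open>n - 2\<close> in the
  Gaussian variance.\<close>

lemma pair_sum_square_weighted:
  fixes e x :: "nat \<Rightarrow> real" and n :: nat
  assumes e: "\<And>j. e j = 0 \<or> e j = 1"
  defines "R \<equiv> \<Sum>j=1..n. e j" and "X \<equiv> \<Sum>j=1..n. e j * x j" and "M \<equiv> \<Sum>j=1..n. e j * (x j)\<^sup>2"
  shows "(\<Sum>j=1..n. \<Sum>k=j+1..n. a * (e j * e k * (x j + x k)\<^sup>2)
            + (e j * (1 - e k) * (b + c * (x j)\<^sup>2) + e k * (1 - e j) * (b + c * (x k)\<^sup>2)))
         = a * ((R - 2) * M + X\<^sup>2) + (real n - R) * (b * R + c * M)"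
proof -
  define F where "F j k = a * (e j * e k * (x j + x k)\<^sup>2)
            + (e j * (1 - e k) * (b + c * (x j)\<^sup>2) + e k * (1 - e j) * (b + c * (x k)\<^sup>2))" for j k
  have ee: "e j * e j = e j" "e j * (1 - e j) = 0" for j
    using e[of j] by auto
  have "F j k = a * ((e j * (x j)\<^sup>2) * e k + 2 * ((e j * x j) * (e k * x k)) + e j * (e k * (x k)\<^sup>2))
      + (b * (e j * (1 - e k)) + c * ((e j * (x j)\<^sup>2) * (1 - e k))
      + b * ((1 - e j) * e k) + c * ((1 - e j) * (e k * (x k)\<^sup>2)))" for j k
    unfolding F_def by (simp add: power2_eq_square algebra_simps)
  then have "(\<Sum>j=1..n. \<Sum>k=1..n. F j k)
      = a * (M * R + 2 * (X * X) + R * M) + (b * (R * (real n - R)) + c * (M * (real n - R))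
          + b * ((real n - R) * R) + c * ((real n - R) * M))"
    unfolding R_def X_def M_def
    by (simp add: sum.distrib sum_product[symmetric] sum_distrib_left[symmetric] sum_subtractf
        flip: sum_distrib_right)
  moreover have "F j j = 4 * a * (e j * (x j)\<^sup>2)" for j
    unfolding F_def using e[of j] by (auto simp: power2_eq_square)
  then have "(\<Sum>j=1..n. F j j) = 4 * a * M"
    unfolding M_def by (simp add: sum_distrib_left[symmetric])
  moreover have "F j k = F k j" for j k
    unfolding F_def by (simp add: algebra_simps)
  then have "(\<Sum>j=1..n. \<Sum>k=j+1..n. F j k) = ((\<Sum>j=1..n. \<Sum>k=1..n. F j k) - (\<Sum>j=1..n. F j j)) / 2"
    by (rule pair_sum_symmetric)
  ultimately show ?thesis
    unfolding F_def[symmetric] by (simp add: power2_eq_square field_simps)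
qed

section \<open>The weight as a constant times the exponential of a pair sum\<close>

lemma mirror_factor: 
  "norm (exp (\<i> * of_real a) - exp (- (\<i> * of_real b))) = 2 * \<bar>sin ((a + b) / 2)\<bar>"
proof -
  have "(norm (exp (\<i> * of_real a) - exp (- (\<i> * of_real b))))\<^sup>2 = (cos a - cos b)\<^sup>2 + (sin a + sin b)\<^sup>2"
    by (simp add: cmod_power2 Re_exp Im_exp)
  also have "\<dots> = 2 - 2 * cos (a + b)"
    using sin_cos_squared_add[of a] sin_cos_squared_add[of b]
    unfolding cos_add power2_diff power2_sum by algebra
  also have "\<dots> = (2 * \<bar>sin ((a + b) / 2)\<bar>)\<^sup>2"
  proof -
    have "cos (a + b) = 1 - 2 * (sin ((a + b) / 2))\<^sup>2"
      using cos_double_sin[of "(a + b) / 2"] by (simp only: mult_2 field_sum_of_halves)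
    then show ?thesis by (simp add: power_mult_distrib)
  qed
  finally show ?thesis
    by (rule power2_eq_imp_eq) auto
qed

text \<open>For positive \<beta> this is the maximum of the weight, attained when all angles sit at
  the centre of one well.\<close>

definition pair_const :: "nat \<Rightarrow> real \<Rightarrow> real" where
  "pair_const n \<beta> = (\<Prod>j=1..n. \<Prod>k=j+1..n. 2 powr \<beta>)"

lemma pair_const_pos: "0 < pair_const n \<beta>"
  unfolding pair_const_def by (intro prod_pos) auto

lemma pair_const_exp:
  "(\<Prod>j=1..n. \<Prod>k=j+1..n. (2 * exp (B j k)) powr \<beta>) = pair_const n \<beta> * exp (\<beta> * (\<Sum>j=1..n. \<Sum>k=j+1..n. B j k))"
  unfolding pair_const_def
  by (simp add: powr_mult prod.distrib exp_sum sum_distrib_left powr_def[of "exp _"])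

lemma mirror_weight_le_exp:
  assumes "\<beta> > 0"
    and "\<And>j k. 1 \<le> j \<Longrightarrow> j < k \<Longrightarrow> k \<le> n \<Longrightarrow> \<bar>sin ((\<theta> j + \<theta> k) / 2)\<bar> \<le> exp (B j k)"
  shows "mirror_weight n \<beta> \<theta> \<le> pair_const n \<beta> * exp (\<beta> * (\<Sum>j=1..n. \<Sum>k=j+1..n. B j k))"
  unfolding pair_const_exp[symmetric] mirror_weight_def mirror_factor
  using assms by (intro prod_mono conjI prod_nonneg powr_mono2 mult_left_mono) auto

lemma mirror_weight_eq_exp:
  assumes "\<And>j k. 1 \<le> j \<Longrightarrow> j < k \<Longrightarrow> k \<le> n \<Longrightarrow> \<bar>sin ((\<theta> j + \<theta> k) / 2)\<bar> = exp (B j k)"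
  shows "mirror_weight n \<beta> \<theta> = pair_const n \<beta> * exp (\<beta> * (\<Sum>j=1..n. \<Sum>k=j+1..n. B j k))"
  unfolding pair_const_exp[symmetric] mirror_weight_def mirror_factor
  using assms by (intro prod.cong) auto

lemma abs_sin_same_well:
  assumes s: "s = pi / 2 \<or> s = - (pi / 2)"
  shows "\<bar>sin ((a + b) / 2)\<bar> = \<bar>cos (((a - s) + (b - s)) / 2)\<bar>"
proof -
  have "sin ((a + b) / 2) = sin (((a - s) + (b - s)) / 2 + s)"
    by (rule arg_cong[of _ _ sin]) (simp add: field_simps)
  also have "\<bar>\<dots>\<bar> = \<bar>cos (((a - s) + (b - s)) / 2)\<bar>"
    unfolding sin_add using s by (elim disjE; hypsubst) simp_all
  finally show ?thesis .
qed

text \<open>The angles indexed by \<open>T\<close> lie in the well of \<open>- s\<close>, the others in the well of \<open>s\<close>. No decay is kept for the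
  interactions within \<open>T\<close>.\<close>

lemma mirror_weight_wells_le:
  fixes n :: nat
  assumes \<beta>: "\<beta> > 0" and s: "s = pi / 2 \<or> s = - (pi / 2)" and T: "T \<subseteq> {1..n}"
    and maj: "\<And>j. j \<in> {1..n} - T \<Longrightarrow> \<bar>\<theta> j - s\<bar> \<le> pi / 2"
    and mino: "\<And>j. j \<in> T \<Longrightarrow> \<bar>\<theta> j + s\<bar> \<le> pi / 2"
  defines "R \<equiv> real (card ({1..n} - T))" and "X \<equiv> \<Sum>j\<in>{1..n} - T. \<theta> j - s"
    and "M \<equiv> \<Sum>j\<in>{1..n} - T. (\<theta> j - s)\<^sup>2"
  shows "mirror_weight n \<beta> \<theta> \<le> pair_const n \<beta>
     * exp (\<beta> * (- (1/8) * ((R - 2) * M + X\<^sup>2) + real (card T) * (- (1/12) * R + 3/32 * M)))"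
proof -
  define e :: "nat \<Rightarrow> real" where "e j = (if j \<in> T then 0 else 1)" for j
  \<comment> \<open>Each angle is recentred at its own well. For two angles in the same well this
    turns the sine of the half sum into a cosine up to sign; for opposite wells the shifts cancel
    and the sine remains.\<close>
  define x where "x j = (if j \<in> T then \<theta> j + s else \<theta> j - s)" for j
  define B where "B j k = - (1/8) * (e j * e k * (x j + x k)\<^sup>2)
      + (e j * (1 - e k) * (- (1/12) + 3/32 * (x j)\<^sup>2) + e k * (1 - e j) * (- (1/12) + 3/32 * (x k)\<^sup>2))" for j k
  have x: "\<bar>x j\<bar> \<le> pi / 2" if "j \<in> {1..n}" for j
    using that maj mino unfolding x_def by auto
  have "\<bar>sin ((\<theta> j + \<theta> k) / 2)\<bar> \<le> exp (B j k)" if jk: "1 \<le> j" "j < k" "k \<le> n" for j k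
  proof -
    have xj: "\<bar>x j\<bar> \<le> pi / 2" and xk: "\<bar>x k\<bar> \<le> pi / 2" using x jk by auto
    consider "j \<notin> T" "k \<notin> T" | "j \<in> T" "k \<notin> T" | "j \<notin> T" "k \<in> T" | "j \<in> T" "k \<in> T" by blast
    then show ?thesis
    proof cases
      case 1
      have "\<bar>sin ((\<theta> j + \<theta> k) / 2)\<bar> = \<bar>cos ((x j + x k) / 2)\<bar>"
        unfolding abs_sin_same_well[OF s] x_def using 1 by simp
      also have "\<dots> = cos ((x j + x k) / 2)"
        using xj xk by (intro abs_of_nonneg cos_ge_zero) auto
      also have "\<dots> \<le> exp (- (((x j + x k) / 2)\<^sup>2 / 2))"
        using xj xk by (intro cos_le_exp_neg_square) auto
      finally show ?thesis using 1 by (simp add: B_def e_def power_divide)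
    next
      case 2
      then have "\<theta> j + \<theta> k = x j + x k" by (simp add: x_def)
      then show ?thesis using abs_sin_half_sum_le[OF xj xk] 2 by (simp add: B_def e_def)
    next
      case 3
      then have "\<theta> j + \<theta> k = x k + x j" by (simp add: x_def)
      then show ?thesis using abs_sin_half_sum_le[OF xk xj] 3 by (simp add: B_def e_def)
    next
      case 4
      then show ?thesis by (simp add: B_def e_def)
    qed
  qed
  then have "mirror_weight n \<beta> \<theta> \<le> pair_const n \<beta> * exp (\<beta> * (\<Sum>j=1..n. \<Sum>k=j+1..n. B j k))"
    by (intro mirror_weight_le_exp \<beta>)
  moreover have sums: "(\<Sum>j=1..n. e j * f j) = (\<Sum>j\<in>{1..n} - T. f j)" for f
    using T by (intro sum.mono_neutral_cong_right) (auto simp: e_def)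
  have "(\<Sum>j=1..n. e j) = R"
    using sums[of "\<lambda>_. 1"] unfolding R_def by (simp only: mult_1_right sum_constant)
  moreover have "(\<Sum>j=1..n. e j * x j) = X" "(\<Sum>j=1..n. e j * (x j)\<^sup>2) = M"
    unfolding sums X_def M_def by (auto simp: x_def)
  moreover have "real n - R = card T"
    unfolding R_def using T card_mono[OF _ T] by (subst card_Diff_subset) (auto simp: finite_subset of_nat_diff)
  ultimately show ?thesis
    using pair_sum_square_weighted[where e = e and n = n and a = "- (1/8)" and x = x and b = "- (1/12)" and c = "3/32"]
    unfolding B_def e_def by (simp add: mult.commute)
qed

lemma mirror_weight_one_well_le:
  assumes \<beta>: "\<beta> > 0" and s: "s = pi / 2 \<or> s = - (pi / 2)"
    and "\<And>j. j \<in> {1..n} \<Longrightarrow> \<bar>\<theta> j - s\<bar> \<le> pi / 2"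
  shows "mirror_weight n \<beta> \<theta> \<le> pair_const n \<beta>
     * exp (- (\<beta>/8) * ((real n - 2) * (\<Sum>j=1..n. (\<theta> j - s)\<^sup>2) + (\<Sum>j=1..n. \<theta> j - s)\<^sup>2))"
  using mirror_weight_wells_le[of \<beta> s "{}" n \<theta>] assms by simp

text \<open>Cut off to \<open>0\<close> away from the origin, so that its bounds hold globally and no logarithm of \<open>0\<close> is taken.\<close>

definition quartic_part :: "real \<Rightarrow> real" where
  "quartic_part u = (if \<bar>u\<bar> \<le> 1 / 2 then - ln (cos u) - u\<^sup>2 / 2 else 0)"

lemma quartic_part_bounds: "0 \<le> quartic_part u" "quartic_part u \<le> u ^ 4 / 2"
proof -
  have "0 \<le> - ln (cos u) - u\<^sup>2 / 2 \<and> - ln (cos u) - u\<^sup>2 / 2 \<le> u ^ 4 / 2" if u: "\<bar>u\<bar> \<le> 1/2"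
  proof -
    have c: "0 < cos u" using cos_ge_exp_neg_square[OF u] exp_gt_zero less_le_trans by blast
    have "ln (cos u) \<le> - (u\<^sup>2 / 2)"
      using cos_le_exp_neg_square[of u] u pi_gt3 c by (subst ln_exp[symmetric], subst ln_le_cancel_iff) auto
    moreover have "- (u\<^sup>2 / 2) - u ^ 4 / 2 \<le> ln (cos u)"
      using cos_ge_exp_neg_square[OF u] c by (simp add: ln_ge_iff)
    ultimately show ?thesis by simp
  qed
  then show "0 \<le> quartic_part u" "quartic_part u \<le> u ^ 4 / 2"
    by (auto simp: quartic_part_def)
qed

lemma measurable_quartic_part [measurable]: "quartic_part \<in> borel_measurable borel"
  unfolding quartic_part_def[abs_def] by measurable

text \<open>There is no error term: at distance at most 1/2 from \<open>s\<close> all half sums stay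
  in the range where \<open>quartic_part\<close> is not cut off, and there
  \<open>exp (- u^2 / 2 - quartic_part u)\<close> equals \<open>cos u\<close>.\<close>

lemma mirror_weight_one_well_eq:
  assumes s: "s = pi / 2 \<or> s = - (pi / 2)"
    and x: "\<And>j. j \<in> {1..n} \<Longrightarrow> \<bar>\<theta> j - s\<bar> \<le> 1 / 2"
  shows "mirror_weight n \<beta> \<theta> = pair_const n \<beta>
     * exp (- (\<beta>/8) * ((real n - 2) * (\<Sum>j=1..n. (\<theta> j - s)\<^sup>2) + (\<Sum>j=1..n. \<theta> j - s)\<^sup>2)
        - \<beta> * (\<Sum>j=1..n. \<Sum>k=j+1..n. quartic_part (((\<theta> j - s) + (\<theta> k - s)) / 2)))"
proof -
  define u where "u j k = ((\<theta> j - s) + (\<theta> k - s)) / 2" for j k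
  have "\<bar>sin ((\<theta> j + \<theta> k) / 2)\<bar> = exp (- (u j k)\<^sup>2 / 2 - quartic_part (u j k))"
    if jk: "1 \<le> j" "j < k" "k \<le> n" for j k
  proof -
    have u: "\<bar>u j k\<bar> \<le> 1 / 2" 
    proof -
      have "\<bar>\<theta> j - s\<bar> \<le> 1/2" "\<bar>\<theta> k - s\<bar> \<le> 1/2"
        using x jk by auto
      then show ?thesis 
        using abs_triangle_ineq[of "\<theta> j - s" "\<theta> k - s"] unfolding u_def by simp
    qed
    have c: "0 < cos (u j k)" using cos_ge_exp_neg_square[OF u] exp_gt_zero less_le_trans by blast
    show ?thesis
      using u c unfolding abs_sin_same_well[OF s] u_def[symmetric] by (simp add: quartic_part_def)
  qed
  then have "mirror_weight n \<beta> \<theta> = pair_const n \<beta>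
      * exp (\<beta> * (\<Sum>j=1..n. \<Sum>k=j+1..n. - (u j k)\<^sup>2 / 2 - quartic_part (u j k)))"
    by (rule mirror_weight_eq_exp)
  also have "(\<Sum>j=1..n. \<Sum>k=j+1..n. - (u j k)\<^sup>2 / 2 - quartic_part (u j k))
      = (\<Sum>j=1..n. \<Sum>k=j+1..n. (-1/8) * (((\<theta> j - s) + (\<theta> k - s))\<^sup>2)) - (\<Sum>j=1..n. \<Sum>k=j+1..n. quartic_part (u j k))"
    by (simp add: sum_subtractf u_def power_divide)
  also have "(\<Sum>j=1..n. \<Sum>k=j+1..n. (-1/8) * (((\<theta> j - s) + (\<theta> k - s))\<^sup>2))
      = (-1/8) * ((real n - 2) * (\<Sum>j=1..n. (\<theta> j - s)\<^sup>2) + (\<Sum>j=1..n. \<theta> j - s)\<^sup>2)"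
    using pair_sum_square_weighted[where e = "\<lambda>_. 1" and n = n and a = "-1/8" and x = "\<lambda>j. \<theta> j - s" and b = 0 and c = 0] by simp
  finally show ?thesis by (simp add: u_def algebra_simps)
qed

section \<open>Concentration for Gaussian samples\<close>

lemma integral_normal_density_iexp:
  assumes "0 < \<tau>"
  shows "(\<integral>y. normal_density 0 \<tau> y *\<^sub>R iexp (b * y) \<partial>lborel) = of_real (exp (- (b\<^sup>2 * \<tau>\<^sup>2 / 2)))"
proof -
  have "(\<integral>y. normal_density 0 \<tau> y *\<^sub>R iexp (b * y) \<partial>lborel)
      = \<bar>\<tau>\<bar> *\<^sub>R (\<integral>y. normal_density 0 \<tau> (0 + \<tau> * y) *\<^sub>R iexp (b * (0 + \<tau> * y)) \<partial>lborel)"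
    using assms by (intro lborel_integral_real_affine) simp
  also have "\<dots> = (\<integral>y. \<tau> *\<^sub>R (normal_density 0 \<tau> (\<tau> * y) *\<^sub>R iexp (b * (\<tau> * y))) \<partial>lborel)"
    using assms by (simp only: integral_scaleR_right abs_of_pos add_0)
  also have "\<dots> = (\<integral>y. std_normal_density y *\<^sub>R iexp ((b * \<tau>) * y) \<partial>lborel)"
  proof (intro Bochner_Integration.integral_cong refl)
    fix y :: real
    have "\<tau> * normal_density 0 \<tau> (\<tau> * y) = std_normal_density y"
      using assms by (simp add: normal_density_def real_sqrt_mult power_mult_distrib)
    then show "\<tau> *\<^sub>R (normal_density 0 \<tau> (\<tau> * y) *\<^sub>R iexp (b * (\<tau> * y))) = std_normal_density y *\<^sub>R iexp ((b * \<tau>) * y)"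
      by (simp add: mult.assoc del: of_real_mult)
  qed
  also have "\<dots> = char std_normal_distribution (b * \<tau>)"
    unfolding char_def by (subst integral_density) auto
  also have "\<dots> = of_real (exp (- (b\<^sup>2 * \<tau>\<^sup>2 / 2)))"
    unfolding char_std_normal_distribution by (simp add: power_mult_distrib)
  finally show ?thesis .
qed

text \<open>Put \<open>d = 1 + 2 c \<tau>^2\<close>. Damping the density of variance
  \<open>\<tau>^2\<close> by \<open>exp (- c y^2)\<close> gives \<open>1 / sqrt d\<close> times the
  density of variance \<open>\<tau>^2 / d\<close>. It serves with \<open>Y = S\<close> and
  \<open>c = \<beta> / 8\<close>.\<close>

lemma (in prob_space) expectation_gaussian_iexp:
  assumes Y: "distributed M lborel Y (normal_density 0 \<tau>)" and \<tau>: "0 < \<tau>" and c: "0 \<le> c"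
  shows "expectation (\<lambda>\<omega>. of_real (exp (- c * (Y \<omega>)\<^sup>2)) * iexp (b * Y \<omega>))
    = of_real (1 / sqrt (1 + 2 * c * \<tau>\<^sup>2) * exp (- (b\<^sup>2 * \<tau>\<^sup>2 / (2 * (1 + 2 * c * \<tau>\<^sup>2)))))"
proof -
  define d where "d = 1 + 2 * c * \<tau>\<^sup>2"
  have d: "d > 0" unfolding d_def using c by (simp add: add_pos_nonneg)
  have mY: "Y \<in> M \<rightarrow>\<^sub>M lborel" using Y by (rule distributed_measurable)
  have "expectation (\<lambda>\<omega>. of_real (exp (- c * (Y \<omega>)\<^sup>2)) * iexp (b * Y \<omega>))
      = (\<integral>y. of_real (exp (- c * y\<^sup>2)) * iexp (b * y) \<partial>distr M lborel Y)"
    by (subst integral_distr[OF mY]) auto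
  also have "\<dots> = (\<integral>y. normal_density 0 \<tau> y *\<^sub>R (of_real (exp (- c * y\<^sup>2)) * iexp (b * y)) \<partial>lborel)"
    unfolding distributed_distr_eq_density[OF Y] by (subst integral_density) auto
  also have "\<dots> = (\<integral>y. (1 / sqrt d) *\<^sub>R (normal_density 0 (\<tau> / sqrt d) y *\<^sub>R iexp (b * y)) \<partial>lborel)"
  proof (intro Bochner_Integration.integral_cong refl)
    fix y :: real
    have "y\<^sup>2 / (2 * \<tau>\<^sup>2) + c * y\<^sup>2 = y\<^sup>2 * d / (2 * \<tau>\<^sup>2)"
      unfolding d_def using \<tau> by (simp add: field_simps)
    then have "exp (- y\<^sup>2 / (2 * \<tau>\<^sup>2)) * exp (- c * y\<^sup>2) = exp (- y\<^sup>2 / (2 * (\<tau> / sqrt d)\<^sup>2))"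
      using d by (simp add: exp_add[symmetric] power_divide)
    then have "normal_density 0 \<tau> y * exp (- c * y\<^sup>2) = 1 / sqrt d * normal_density 0 (\<tau> / sqrt d) y"
      using d \<tau> by (simp add: normal_density_def real_sqrt_mult real_sqrt_divide power_divide)
    then show "normal_density 0 \<tau> y *\<^sub>R (of_real (exp (- c * y\<^sup>2)) * iexp (b * y))
        = (1 / sqrt d) *\<^sub>R (normal_density 0 (\<tau> / sqrt d) y *\<^sub>R iexp (b * y))"
      by (simp add: scaleR_conv_of_real mult.assoc[symmetric] del: of_real_mult flip: of_real_mult)
  qed
  also have "\<dots> = (1 / sqrt d) *\<^sub>R of_real (exp (- (b\<^sup>2 * (\<tau> / sqrt d)\<^sup>2 / 2)))"
    using \<tau> d by (subst integral_scaleR_right, subst integral_normal_density_iexp) auto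
  also have "\<dots> = of_real (1 / sqrt d * exp (- (b\<^sup>2 * \<tau>\<^sup>2 / (2 * d))))"
    using d by (simp add: scaleR_conv_of_real power_divide mult.commute)
  finally show ?thesis by (simp add: d_def)
qed

text \<open>Read off from the nonnegativity of the variance of the absolute value.\<close>

lemma (in prob_space) expectation_abs_le_sqrt:
  fixes Z :: "'a \<Rightarrow> real"
  assumes [measurable]: "Z \<in> borel_measurable M" and "integrable M (\<lambda>\<omega>. (Z \<omega>)\<^sup>2)"
  shows "expectation (\<lambda>\<omega>. \<bar>Z \<omega>\<bar>) \<le> sqrt (expectation (\<lambda>\<omega>. (Z \<omega>)\<^sup>2))"
proof -
  have int: "integrable M Z"
    using assms by (rule square_integrable_imp_integrable)
  have "0 \<le> variance (\<lambda>\<omega>. \<bar>Z \<omega>\<bar>)"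
    by (rule variance_positive)
  also have "\<dots> = expectation (\<lambda>\<omega>. (Z \<omega>)\<^sup>2) - (expectation (\<lambda>\<omega>. \<bar>Z \<omega>\<bar>))\<^sup>2"
    using int assms(2) by (subst variance_eq) auto
  finally show ?thesis
    by (intro real_le_rsqrt) simp
qed

text \<open>Two pairs can share an index in four ways, and each way leaves three free
  indices.\<close>

lemma card_overlapping_pairs:
  fixes n :: nat
  shows "card {(p, r). p \<in> {1..n} \<times> {1..n} \<and> r \<in> {1..n} \<times> {1..n} \<and> {fst p, snd p} \<inter> {fst r, snd r} \<noteq> {}} \<le> 4 * n ^ 3"
    (is "card ?S \<le> _")
proof -
  let ?C = "{1..n} \<times> {1..n} \<times> {1..n}"
  let ?f = "\<lambda>(a, b, c). ((a, b), (a, c))" and ?g = "\<lambda>(a, b, c). ((a, b), (c, a))"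
    and ?h = "\<lambda>(a, b, c). ((b, a), (a, c))" and ?k = "\<lambda>(a, b, c). ((b, a), (c, a))"
  have "?S \<subseteq> (?f ` ?C \<union> ?g ` ?C) \<union> (?h ` ?C \<union> ?k ` ?C)"
  proof
    fix x assume "x \<in> ?S"
    moreover obtain a b c d where x: "x = ((a, b), (c, d))"
      by (metis surj_pair)
    ultimately have in_n: "a \<in> {1..n}" "b \<in> {1..n}" "c \<in> {1..n}" "d \<in> {1..n}"
      and "a = c \<or> a = d \<or> b = c \<or> b = d"
      by auto
    with x have "x = ?f (a, b, d) \<or> x = ?g (a, b, c) \<or> x = ?h (b, a, d) \<or> x = ?k (b, a, c)"
      by auto
    moreover have "(a, b, d) \<in> ?C" "(a, b, c) \<in> ?C" "(b, a, d) \<in> ?C" "(b, a, c) \<in> ?C"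
      using in_n by auto
    ultimately show "x \<in> (?f ` ?C \<union> ?g ` ?C) \<union> (?h ` ?C \<union> ?k ` ?C)"
      by (elim disjE) (blast intro: image_eqI)+
  qed
  then have "card ?S \<le> card ((?f ` ?C \<union> ?g ` ?C) \<union> (?h ` ?C \<union> ?k ` ?C))"
    by (intro card_mono) auto
  also have "\<dots> \<le> (card (?f ` ?C) + card (?g ` ?C)) + (card (?h ` ?C) + card (?k ` ?C))"
    by (intro order_trans[OF card_Un_le] add_mono card_Un_le)
  also have "\<dots> \<le> (card ?C + card ?C) + (card ?C + card ?C)"
    by (intro add_mono card_image_le) auto
  also have "\<dots> = 4 * n ^ 3"
    by (simp add: card_cartesian_product power3_eq_cube)
  finally show ?thesis .
qed

section \<open>Moments and pair covariances of a Gaussian sample\<close>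

locale gaussian_sample = prob_space +
  fixes X :: "nat \<Rightarrow> 'a \<Rightarrow> real" and n :: nat and \<sigma> :: real
  assumes n_pos: "0 < n" and \<sigma>_pos: "0 < \<sigma>"
    and indep: "indep_vars (\<lambda>_. borel) X {1..n}"
    and normal: "\<And>i. i \<in> {1..n} \<Longrightarrow> distributed M lborel (X i) (normal_density 0 \<sigma>)"
begin

lemma measurable_X [measurable]: "i \<in> {1..n} \<Longrightarrow> X i \<in> borel_measurable M"
  using normal[THEN distributed_measurable] by simp

lemma integrable_X_power:
  assumes "i \<in> {1..n}"
  shows "integrable M (\<lambda>\<omega>. (X i \<omega>) ^ k)"
  using distributed_integrable[OF normal[OF assms], of "\<lambda>x. x ^ k"] integrable_normal_moment[of \<sigma> 0 k] \<sigma>_pos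
  by simp

lemma expectation_X_even_power:
  assumes "i \<in> {1..n}"
  shows "expectation (\<lambda>\<omega>. (X i \<omega>) ^ (2 * k)) = fact (2 * k) / (2 ^ k * fact k) * \<sigma> ^ (2 * k)"
  using distributed_integral[OF normal[OF assms], of "\<lambda>x. x ^ (2 * k)"] integral_normal_moment_even[of \<sigma> 0 k] \<sigma>_pos
  by (simp add: power_divide power_mult)

lemma expectation_X_2: "i \<in> {1..n} \<Longrightarrow> expectation (\<lambda>\<omega>. (X i \<omega>)\<^sup>2) = \<sigma>\<^sup>2"
  using expectation_X_even_power[of i 1] by simp

lemma expectation_X_4: "i \<in> {1..n} \<Longrightarrow> expectation (\<lambda>\<omega>. (X i \<omega>) ^ 4) = 3 * \<sigma> ^ 4"
  using expectation_X_even_power[of i 2] by (simp add: fact_numeral)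

lemma expectation_X_8: "i \<in> {1..n} \<Longrightarrow> expectation (\<lambda>\<omega>. (X i \<omega>) ^ 8) = 105 * \<sigma> ^ 8"
  using expectation_X_even_power[of i 4] by (simp add: fact_numeral)

lemma distributed_sum:
  assumes "J \<subseteq> {1..n}" "J \<noteq> {}"
  shows "distributed M lborel (\<lambda>\<omega>. \<Sum>i\<in>J. X i \<omega>) (normal_density 0 (sqrt (real (card J)) * \<sigma>))"
proof -
  have "distributed M lborel (\<lambda>\<omega>. \<Sum>i\<in>J. X i \<omega>) (normal_density (\<Sum>i\<in>J. 0) (sqrt (\<Sum>i\<in>J. \<sigma>\<^sup>2)))"
    using assms \<sigma>_pos normal
    by (intro sum_indep_normal indep_vars_subset[OF indep]) (auto intro: finite_subset)
  then show ?thesis using \<sigma>_pos by (simp add: real_sqrt_mult)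
qed

text \<open>Disjoint pairs are independent, so only \<open>O(n\<^sup>3)\<close> of the covariances can be nonzero.\<close>

lemma pair_variance:
  fixes \<phi> :: "real \<Rightarrow> real \<Rightarrow> real" and B :: real
  defines "Y \<equiv> \<lambda>p \<omega>. \<phi> (X (fst p) \<omega>) (X (snd p) \<omega>)"
  assumes \<phi>[measurable]: "case_prod \<phi> \<in> borel_measurable (borel \<Otimes>\<^sub>M borel)"
    and int: "\<And>p. p \<in> {1..n} \<times> {1..n} \<Longrightarrow> integrable M (\<lambda>\<omega>. (Y p \<omega>)\<^sup>2)"
    and B: "\<And>p. p \<in> {1..n} \<times> {1..n} \<Longrightarrow> expectation (\<lambda>\<omega>. (Y p \<omega>)\<^sup>2) \<le> B"
    and P: "P \<subseteq> {1..n} \<times> {1..n}"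
  shows "expectation (\<lambda>\<omega>. \<bar>(\<Sum>p\<in>P. Y p \<omega>) - (\<Sum>p\<in>P. expectation (Y p))\<bar>) \<le> sqrt (4 * n ^ 3 * B)"
proof -
  have mY: "Y p \<in> borel_measurable M" if "p \<in> {1..n} \<times> {1..n}" for p
  proof -
    have [measurable]: "X (fst p) \<in> borel_measurable M" "X (snd p) \<in> borel_measurable M"
      using that by auto
    have "(\<lambda>\<omega>. case_prod \<phi> (X (fst p) \<omega>, X (snd p) \<omega>)) \<in> borel_measurable M"
      by measurable
    then show ?thesis by (simp add: Y_def)
  qed
  have intY: "integrable M (Y p)" if "p \<in> {1..n} \<times> {1..n}" for p
    using mY[OF that] int[OF that] by (rule square_integrable_imp_integrable)
  define Z where "Z p \<omega> = Y p \<omega> - expectation (Y p)" for p \<omega>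
  have mZ: "Z p \<in> borel_measurable M" if "p \<in> {1..n} \<times> {1..n}" for p
    unfolding Z_def[abs_def] using mY[OF that] by simp
  have intZ: "integrable M (Z p)" if "p \<in> {1..n} \<times> {1..n}" for p
    unfolding Z_def[abs_def] using intY[OF that] by simp
  have EZ: "expectation (Z p) = 0" if "p \<in> {1..n} \<times> {1..n}" for p
    unfolding Z_def[abs_def] using intY[OF that] by (simp add: prob_space)
  have intZ2: "integrable M (\<lambda>\<omega>. (Z p \<omega>)\<^sup>2)" if "p \<in> {1..n} \<times> {1..n}" for p
    unfolding Z_def[abs_def] power2_diff using intY[OF that] int[OF that] by simp
  have EZ2: "expectation (\<lambda>\<omega>. (Z p \<omega>)\<^sup>2) \<le> B" if "p \<in> {1..n} \<times> {1..n}" for p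
  proof -
    have "expectation (\<lambda>\<omega>. (Z p \<omega>)\<^sup>2) = expectation (\<lambda>\<omega>. (Y p \<omega>)\<^sup>2) - (expectation (Y p))\<^sup>2"
      unfolding Z_def using intY[OF that] int[OF that] by (rule variance_eq)
    also have "\<dots> \<le> B" using B[OF that] by (smt (verit) zero_le_power2)
    finally show ?thesis .
  qed
  have intZZ: "integrable M (\<lambda>\<omega>. Z p \<omega> * Z r \<omega>)"
    if "p \<in> {1..n} \<times> {1..n}" "r \<in> {1..n} \<times> {1..n}" for p r
  proof (rule Bochner_Integration.integrable_bound)
    show "integrable M (\<lambda>\<omega>. (Z p \<omega>)\<^sup>2 + (Z r \<omega>)\<^sup>2)"
      using intZ2 that by simp
    show "(\<lambda>\<omega>. Z p \<omega> * Z r \<omega>) \<in> borel_measurable M"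
      using mZ that by simp
    have "\<bar>a * b\<bar> \<le> a\<^sup>2 + b\<^sup>2" for a b :: real
      using sum_squares_bound[of "\<bar>a\<bar>" "\<bar>b\<bar>"] zero_le_power2[of a] zero_le_power2[of b] abs_mult[of a b]
        abs_ge_zero[of "a * b"] by simp
    then show "AE \<omega> in M. norm (Z p \<omega> * Z r \<omega>) \<le> norm ((Z p \<omega>)\<^sup>2 + (Z r \<omega>)\<^sup>2)"
      by simp
  qed
  have disj: "expectation (\<lambda>\<omega>. Z p \<omega> * Z r \<omega>) = 0"
    if pr: "p \<in> {1..n} \<times> {1..n}" "r \<in> {1..n} \<times> {1..n}" and d: "{fst p, snd p} \<inter> {fst r, snd r} = {}" for p r
  proof -
    \<comment> \<open>The centred pair term as a function of the coordinates of its pair alone, so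
      that independence of the families restricted to disjoint index sets carries over to
      it.\<close>
    define h where "h q (f :: nat \<Rightarrow> real) = \<phi> (f (fst q)) (f (snd q)) - expectation (Y q)" for q f
    have mh: "h q \<in> PiM {fst q, snd q} (\<lambda>_. borel) \<rightarrow>\<^sub>M borel" for q
    proof -
      have [measurable]: "(\<lambda>f. f (fst q)) \<in> PiM {fst q, snd q} (\<lambda>_. borel) \<rightarrow>\<^sub>M (borel :: real measure)"
        "(\<lambda>f. f (snd q)) \<in> PiM {fst q, snd q} (\<lambda>_. borel) \<rightarrow>\<^sub>M (borel :: real measure)"
        by (auto intro!: measurable_component_singleton)
      have "(\<lambda>f. case_prod \<phi> (f (fst q), f (snd q)) - expectation (Y q)) \<in> PiM {fst q, snd q} (\<lambda>_. borel) \<rightarrow>\<^sub>M borel"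
        by measurable
      then show ?thesis by (simp add: h_def[abs_def])
    qed
    have "indep_var borel (h p \<circ> (\<lambda>\<omega>. restrict (\<lambda>i. X i \<omega>) {fst p, snd p}))
        borel (h r \<circ> (\<lambda>\<omega>. restrict (\<lambda>i. X i \<omega>) {fst r, snd r}))"
      using pr d by (intro indep_var_compose[OF indep_var_restrict[OF indep]] mh) auto
    moreover have "h q \<circ> (\<lambda>\<omega>. restrict (\<lambda>i. X i \<omega>) {fst q, snd q}) = Z q" for q
      by (auto simp: h_def Z_def Y_def fun_eq_iff)
    ultimately have "indep_var borel (Z p) borel (Z r)" by simp
    then have "expectation (\<lambda>\<omega>. Z p \<omega> * Z r \<omega>) = expectation (Z p) * expectation (Z r)"
      using intZ pr by (intro indep_var_lebesgue_integral) auto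
    then show ?thesis using EZ pr by simp
  qed
  \<comment> \<open>Used for overlapping pairs. Centring does not increase second moments, so the
    bound on \<open>Y\<close> suffices.\<close>
  have le: "expectation (\<lambda>\<omega>. Z p \<omega> * Z r \<omega>) \<le> B"
    if pr: "p \<in> {1..n} \<times> {1..n}" "r \<in> {1..n} \<times> {1..n}" for p r
  proof -
    have "expectation (\<lambda>\<omega>. Z p \<omega> * Z r \<omega>) \<le> expectation (\<lambda>\<omega>. ((Z p \<omega>)\<^sup>2 + (Z r \<omega>)\<^sup>2) / 2)"
    proof (rule integral_mono)
      show "integrable M (\<lambda>\<omega>. ((Z p \<omega>)\<^sup>2 + (Z r \<omega>)\<^sup>2) / 2)" using intZ2 pr by simp
      show "Z p \<omega> * Z r \<omega> \<le> ((Z p \<omega>)\<^sup>2 + (Z r \<omega>)\<^sup>2) / 2" for \<omega>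
        using sum_squares_bound[of "Z p \<omega>" "Z r \<omega>"] by simp
    qed (use intZZ pr in auto)
    also have "\<dots> = (expectation (\<lambda>\<omega>. (Z p \<omega>)\<^sup>2) + expectation (\<lambda>\<omega>. (Z r \<omega>)\<^sup>2)) / 2"
      using intZ2 pr by simp
    also have "\<dots> \<le> B" using EZ2[OF pr(1)] EZ2[OF pr(2)] by simp
    finally show ?thesis .
  qed
  have B0: "0 \<le> B"
  proof -
    have "0 \<le> expectation (\<lambda>\<omega>. (Y (1, 1) \<omega>)\<^sup>2)" by simp
    also have "\<dots> \<le> B" using n_pos by (intro B) auto
    finally show ?thesis .
  qed
  have finP: "finite P" using P finite_subset by blast
  define V where "V \<omega> = (\<Sum>p\<in>P. Z p \<omega>)" for \<omega>
  have V2: "(V \<omega>)\<^sup>2 = (\<Sum>p\<in>P. \<Sum>r\<in>P. Z p \<omega> * Z r \<omega>)" for \<omega>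
    unfolding V_def power2_eq_square sum_product ..
  have intZZ': "integrable M (\<lambda>\<omega>. Z p \<omega> * Z r \<omega>)" if "p \<in> P" "r \<in> P" for p r
    using that P by (intro intZZ) auto
  have intV2: "integrable M (\<lambda>\<omega>. (V \<omega>)\<^sup>2)"
    unfolding V2 using intZZ' by (intro Bochner_Integration.integrable_sum) auto
  define S where "S = {(p, r). p \<in> {1..n} \<times> {1..n} \<and> r \<in> {1..n} \<times> {1..n} \<and> {fst p, snd p} \<inter> {fst r, snd r} \<noteq> {}}"
  have finS: "finite S"
    by (rule finite_subset[of _ "({1..n} \<times> {1..n}) \<times> ({1..n} \<times> {1..n})"]) (auto simp: S_def)
  have "expectation (\<lambda>\<omega>. (V \<omega>)\<^sup>2) = (\<Sum>p\<in>P. \<Sum>r\<in>P. expectation (\<lambda>\<omega>. Z p \<omega> * Z r \<omega>))"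
    unfolding V2 using intZZ' by (simp add: Bochner_Integration.integral_sum)
  also have "\<dots> = (\<Sum>x\<in>P \<times> P. expectation (\<lambda>\<omega>. Z (fst x) \<omega> * Z (snd x) \<omega>))"
    by (simp add: sum.cartesian_product case_prod_beta)
  also have "\<dots> \<le> (\<Sum>x\<in>P \<times> P. if x \<in> S then B else 0)"
  proof (rule sum_mono)
    fix x assume "x \<in> P \<times> P"
    then have x: "fst x \<in> {1..n} \<times> {1..n}" "snd x \<in> {1..n} \<times> {1..n}" using P by auto
    show "expectation (\<lambda>\<omega>. Z (fst x) \<omega> * Z (snd x) \<omega>) \<le> (if x \<in> S then B else 0)"
    proof (cases "x \<in> S")
      case True
      then show ?thesis using le[OF x] by simp
    next
      case False
      then have "{fst (fst x), snd (fst x)} \<inter> {fst (snd x), snd (snd x)} = {}"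
        using x unfolding S_def by (metis (mono_tags, lifting) case_prodI mem_Collect_eq prod.collapse)
      then show ?thesis using disj[OF x] False by simp
    qed
  qed
  also have "\<dots> = (\<Sum>x\<in>P \<times> P \<inter> S. B)"
    using finP by (intro sum.inter_restrict[symmetric]) simp
  also have "\<dots> = card (P \<times> P \<inter> S) * B" by simp
  also have "\<dots> \<le> (4 * n ^ 3) * B"
  proof (intro mult_right_mono B0)
    have "card (P \<times> P \<inter> S) \<le> card S" by (intro card_mono finS) auto
    also have "\<dots> \<le> 4 * n ^ 3" unfolding S_def by (rule card_overlapping_pairs)
    finally show "real (card (P \<times> P \<inter> S)) \<le> 4 * n ^ 3"
      by (metis of_nat_le_iff of_nat_mult of_nat_numeral of_nat_power)
  qed
  finally have EV: "expectation (\<lambda>\<omega>. (V \<omega>)\<^sup>2) \<le> 4 * n ^ 3 * B" by simp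
  have "expectation (\<lambda>\<omega>. \<bar>V \<omega>\<bar>) \<le> sqrt (expectation (\<lambda>\<omega>. (V \<omega>)\<^sup>2))"
    using P mZ intV2 unfolding V_def[abs_def] by (intro expectation_abs_le_sqrt borel_measurable_sum) auto
  also have "\<dots> \<le> sqrt (4 * n ^ 3 * B)" using EV by simp
  finally show ?thesis
    by (simp add: V_def Z_def sum_subtractf)
qed

end

section \<open>Concentration of quartic and square sums, and the comparison with a Gaussian
  integral\<close>

lemma pair_sum_eq_sum:
  fixes n :: nat and f :: "nat \<Rightarrow> nat \<Rightarrow> real"
  defines "P \<equiv> {p \<in> {1..n} \<times> {1..n}. fst p < snd p}"
  shows "(\<Sum>j=1..n. \<Sum>k=j+1..n. f j k) = (\<Sum>p\<in>P. f (fst p) (snd p))"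
proof -
  have P: "P = Sigma {1..n} (\<lambda>j. {j+1..n})" unfolding P_def by auto
  show ?thesis unfolding P by (subst sum.Sigma) (auto simp: case_prod_beta)
qed

text \<open>The chord formula for a factor of the weight, read with \<open>- b\<close> in place of
  \<open>b\<close>.\<close>

lemma norm_iexp_diff_le: "norm (iexp a - iexp b) \<le> \<bar>a - b\<bar>"
  using mirror_factor[of a "- b"] abs_sin_x_le_abs_x[of "(a - b) / 2"] by simp

text \<open>Both \<open>exp (- x)\<close> for nonnegative \<open>x\<close> and \<open>iexp\<close>
  are 1-Lipschitz with modulus at most 1. Deviations inside an exponent thus cost no more than their
  first absolute moments.\<close>

lemma norm_exp_iexp_diff_le:
  fixes x y a b :: real
  assumes "0 \<le> x" "0 \<le> y"
  shows "norm (of_real (exp (- x)) * iexp a - of_real (exp (- y)) * iexp b) \<le> \<bar>x - y\<bar> + \<bar>a - b\<bar>"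
proof -
  have *: "\<bar>exp (- x) - exp (- y)\<bar> \<le> \<bar>x - y\<bar>"
  proof -
    have le: "exp (- u) - exp (- v) \<le> v - u" if "0 \<le> u" "u \<le> v" for u v :: real
    proof -
      have "exp (- u) - exp (- v) = exp (- u) * (1 - exp (- (v - u)))"
        by (simp add: algebra_simps exp_add[symmetric])
      also have "\<dots> \<le> 1 * (v - u)"
      proof (rule mult_mono)
        show "1 - exp (- (v - u)) \<le> v - u"
          using exp_ge_add_one_self[of "- (v - u)"] by linarith
      qed (use that in auto)
      finally show ?thesis by simp
    qed
    show ?thesis
    proof (cases "x \<le> y")
      case True
      then have "exp (- y) \<le> exp (- x)" by simp
      then show ?thesis using le[of x y] assms True by simp
    next
      case False
      then have "exp (- x) \<le> exp (- y)" by simp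
      then show ?thesis using le[of y x] assms False by simp
    qed
  qed
  have "of_real (exp (- x)) * iexp a - of_real (exp (- y)) * iexp b
      = of_real (exp (- x) - exp (- y)) * iexp a + of_real (exp (- y)) * (iexp a - iexp b)"
    by (simp add: algebra_simps)
  also have "norm \<dots> \<le> \<bar>exp (- x) - exp (- y)\<bar> + exp (- y) * norm (iexp a - iexp b)"
    by (rule order_trans[OF norm_triangle_ineq]) (simp add: norm_mult del: of_real_diff)
  also have "\<dots> \<le> \<bar>x - y\<bar> + 1 * \<bar>a - b\<bar>"
    using assms * norm_iexp_diff_le by (intro add_mono mult_mono) auto
  finally show ?thesis by simp
qed

text \<open>The mean of one pair term of \<open>Q\<close>; it does not depend on the well because \<open>x\<^sub>j + x\<^sub>k\<close> has variance \<open>2 \<sigma>\<^sup>2\<close>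
  in both.\<close>

definition quartic_mean :: "real \<Rightarrow> real" where
  "quartic_mean \<sigma> = (\<integral>y. normal_density 0 (sqrt 2 * \<sigma>) y * quartic_part (y / 2) \<partial>lborel)"

text \<open>Convexity of the fourth power, obtained from two uses of the inequality for squares. It
  separates the two angles, so that single-angle moments suffice.\<close>

lemma quartic_part_half_le: "quartic_part ((a + b) / 2) \<le> (a ^ 4 + b ^ 4) / 4"
proof -
  have sq: "((x + y) / 2)\<^sup>2 \<le> (x\<^sup>2 + y\<^sup>2) / 2" for x y :: real
    using sum_squares_bound[of x y] by (simp add: power2_eq_square field_simps)
  have "((a + b) / 2) ^ 4 = (((a + b) / 2)\<^sup>2)\<^sup>2" by (simp flip: power_mult)
  also have "\<dots> \<le> ((a\<^sup>2 + b\<^sup>2) / 2)\<^sup>2" using sq by (intro power_mono) auto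
  also have "\<dots> \<le> ((a\<^sup>2)\<^sup>2 + (b\<^sup>2)\<^sup>2) / 2" by (rule sq)
  finally show ?thesis using quartic_part_bounds(2)[of "(a + b) / 2"] by (simp flip: power_mult)
qed

context gaussian_sample
begin

text \<open>By the eighth moment \<open>105 \<sigma>^8\<close>, one pair term has second moment at
  most \<open>210/8 \<sigma>^8\<close>, rounded up to \<open>27 \<sigma>^8\<close>. With
  \<open>4 n^3\<close> overlapping pairs of pairs this gives \<open>sqrt 108 <= 11\<close>. Since
  \<open>\<sigma>^2\<close> is of order 1/n, the bound is of order
  \<open>1 / sqrt n\<close>.\<close>

lemma quartic_concentration:
  "expectation (\<lambda>\<omega>. \<bar>(\<Sum>j=1..n. \<Sum>k=j+1..n. quartic_part ((X j \<omega> + X k \<omega>) / 2))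
      - real (n * (n - 1)) / 2 * quartic_mean \<sigma>\<bar>) \<le> 11 * sqrt n ^ 3 * \<sigma> ^ 4"
proof -
  define P where "P = {p \<in> {1..n} \<times> {1..n}. fst p < snd p}"
  define Y where "Y p \<omega> = quartic_part ((X (fst p) \<omega> + X (snd p) \<omega>) / 2)" for p \<omega>
  have mY[measurable]: "Y p \<in> borel_measurable M" if "p \<in> {1..n} \<times> {1..n}" for p
  proof -
    have [measurable]: "X (fst p) \<in> borel_measurable M" "X (snd p) \<in> borel_measurable M"
      using that by auto
    show ?thesis unfolding Y_def[abs_def] by measurable
  qed
  have Y2: "(Y p \<omega>)\<^sup>2 \<le> (X (fst p) \<omega> ^ 8 + X (snd p) \<omega> ^ 8) / 8" for p \<omega>
  proof -
    define a b where "a = X (fst p) \<omega>" and "b = X (snd p) \<omega>"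
    have "(Y p \<omega>)\<^sup>2 \<le> ((a ^ 4 + b ^ 4) / 4)\<^sup>2"
      unfolding Y_def a_def b_def using quartic_part_half_le quartic_part_bounds(1)
      by (intro power_mono) auto
    also have "\<dots> \<le> ((a ^ 4)\<^sup>2 + (b ^ 4)\<^sup>2) / 8"
      using sum_squares_bound[of "a ^ 4" "b ^ 4"] by (simp add: power2_eq_square field_simps)
    finally show ?thesis by (simp add: a_def b_def flip: power_mult)
  qed
  have intB: "integrable M (\<lambda>\<omega>. (X (fst p) \<omega> ^ 8 + X (snd p) \<omega> ^ 8) / 8)" if "p \<in> {1..n} \<times> {1..n}" for p
    using that integrable_X_power by auto
  have int: "integrable M (\<lambda>\<omega>. (Y p \<omega>)\<^sup>2)" if p: "p \<in> {1..n} \<times> {1..n}" for p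
    using mY[OF p] Y2[of p] by (intro Bochner_Integration.integrable_bound[OF intB[OF p]]) (auto simp: abs_le_iff intro!: AE_I2 order_trans[OF Y2])
  have B: "expectation (\<lambda>\<omega>. (Y p \<omega>)\<^sup>2) \<le> 27 * \<sigma> ^ 8" if p: "p \<in> {1..n} \<times> {1..n}" for p
  proof -
    have "expectation (\<lambda>\<omega>. (Y p \<omega>)\<^sup>2) \<le> expectation (\<lambda>\<omega>. (X (fst p) \<omega> ^ 8 + X (snd p) \<omega> ^ 8) / 8)"
      using int[OF p] intB[OF p] Y2 by (intro integral_mono) auto
    also have "\<dots> = 210 * \<sigma> ^ 8 / 8"
      using p integrable_X_power by (subst integral_divide_zero, subst Bochner_Integration.integral_add) (auto simp: expectation_X_8)
    also have "\<dots> \<le> 27 * \<sigma> ^ 8" by simp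
    finally show ?thesis .
  qed
  have mean: "expectation (Y p) = quartic_mean \<sigma>" if p: "p \<in> P" for p
  proof -
    obtain j k where jk: "p = (j, k)" "j \<in> {1..n}" "k \<in> {1..n}" "j \<noteq> k"
      using p unfolding P_def by auto
    have D: "distributed M lborel (\<lambda>\<omega>. X j \<omega> + X k \<omega>) (normal_density 0 (sqrt 2 * \<sigma>))"
      using distributed_sum[of "{j, k}"] jk by simp
    show ?thesis
      using distributed_integral[OF D, of "\<lambda>y. quartic_part (y / 2)"]
      unfolding quartic_mean_def Y_def[abs_def] jk by simp
  qed
  have "expectation (\<lambda>\<omega>. \<bar>(\<Sum>p\<in>P. Y p \<omega>) - (\<Sum>p\<in>P. expectation (Y p))\<bar>) \<le> sqrt (4 * n ^ 3 * (27 * \<sigma> ^ 8))"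
    unfolding Y_def[abs_def]
    by (rule pair_variance[where \<phi> = "\<lambda>a b. quartic_part ((a + b) / 2)"])
      (use int B in \<open>auto simp: Y_def P_def\<close>)
  also have "(\<Sum>p\<in>P. expectation (Y p)) = real (card P) * quartic_mean \<sigma>"
    using mean by simp
  also have "real (card P) = real (n * (n - 1)) / 2"
  proof -
    have "real (card P) = (\<Sum>j=1..n. \<Sum>k=j+1..n. 1)"
      unfolding P_def pair_sum_eq_sum by simp
    also have "\<dots> = ((\<Sum>j=1..n. \<Sum>k=1..n. 1) - (\<Sum>j=1..n. 1)) / 2"
      by (rule pair_sum_symmetric) simp
    finally show ?thesis using n_pos by (simp add: of_nat_diff algebra_simps)
  qed
  also have "sqrt (4 * n ^ 3 * (27 * \<sigma> ^ 8)) = sqrt 108 * sqrt n ^ 3 * \<sigma> ^ 4"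
  proof -
    have "4 * n ^ 3 * (27 * \<sigma> ^ 8) = 108 * real n ^ 3 * (\<sigma> ^ 4)\<^sup>2" by (simp flip: power_mult)
    moreover have "sqrt ((\<sigma> ^ 4)\<^sup>2) = \<sigma> ^ 4" by (simp only: real_sqrt_abs) simp
    ultimately show ?thesis by (simp only: real_sqrt_mult) (simp add: real_sqrt_power)
  qed
  also have "\<dots> \<le> 11 * sqrt n ^ 3 * \<sigma> ^ 4"
    using \<sigma>_pos by (intro mult_right_mono real_le_lsqrt) auto
  finally show ?thesis
    unfolding Y_def P_def pair_sum_eq_sum .
qed

text \<open>\<open>(n - 1) \<Sum> x\<^sub>j\<^sup>2\<close> is the sum of \<open>x\<^sub>j\<^sup>2 + x\<^sub>k\<^sup>2\<close> over all pairs.\<close>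

lemma square_sum_concentration:
  assumes n: "2 \<le> n"
  shows "expectation (\<lambda>\<omega>. \<bar>(\<Sum>j=1..n. (X j \<omega>)\<^sup>2) - real n * \<sigma>\<^sup>2\<bar>) \<le> 14 * sqrt n * \<sigma>\<^sup>2"
proof -
  define P where "P = {p \<in> {1..n} \<times> {1..n}. fst p < snd p}"
  define Y where "Y p \<omega> = (X (fst p) \<omega>)\<^sup>2 + (X (snd p) \<omega>)\<^sup>2" for p \<omega>
  have Y2: "(Y p \<omega>)\<^sup>2 \<le> 2 * (X (fst p) \<omega> ^ 4 + X (snd p) \<omega> ^ 4)" for p \<omega>
  proof -
    define a b where "a = (X (fst p) \<omega>)\<^sup>2" and "b = (X (snd p) \<omega>)\<^sup>2"
    have "(Y p \<omega>)\<^sup>2 = (a + b)\<^sup>2"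
      unfolding Y_def a_def b_def ..
    also have "\<dots> \<le> 2 * (a\<^sup>2 + b\<^sup>2)"
      using sum_squares_bound[of a b] by (simp add: power2_eq_square field_simps)
    finally show ?thesis by (simp add: a_def b_def flip: power_mult)
  qed
  have intB: "integrable M (\<lambda>\<omega>. 2 * (X (fst p) \<omega> ^ 4 + X (snd p) \<omega> ^ 4))" if "p \<in> {1..n} \<times> {1..n}" for p
    using that integrable_X_power by auto
  have int: "integrable M (\<lambda>\<omega>. (Y p \<omega>)\<^sup>2)" if p: "p \<in> {1..n} \<times> {1..n}" for p
  proof -
    have [measurable]: "X (fst p) \<in> borel_measurable M" "X (snd p) \<in> borel_measurable M"
      using p by auto
    have "Y p \<in> borel_measurable M" unfolding Y_def[abs_def] by measurable
    then show ?thesis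
      using Y2[of p] by (intro Bochner_Integration.integrable_bound[OF intB[OF p]]) (auto simp: abs_le_iff intro!: AE_I2 order_trans[OF Y2])
  qed
  have B: "expectation (\<lambda>\<omega>. (Y p \<omega>)\<^sup>2) \<le> 12 * \<sigma> ^ 4" if p: "p \<in> {1..n} \<times> {1..n}" for p
  proof -
    have "expectation (\<lambda>\<omega>. (Y p \<omega>)\<^sup>2) \<le> expectation (\<lambda>\<omega>. 2 * (X (fst p) \<omega> ^ 4 + X (snd p) \<omega> ^ 4))"
      using int[OF p] intB[OF p] Y2 by (intro integral_mono) auto
    also have "\<dots> = 12 * \<sigma> ^ 4"
      using p integrable_X_power by (subst integral_mult_right_zero, subst Bochner_Integration.integral_add) (auto simp: expectation_X_4)
    finally show ?thesis .
  qed
  have pairs: "(\<Sum>p\<in>P. f (fst p) + f (snd p)) = (real n - 1) * (\<Sum>j=1..n. f j)" for f :: "nat \<Rightarrow> real"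
  proof -
    have "(\<Sum>p\<in>P. f (fst p) + f (snd p)) = (\<Sum>j=1..n. \<Sum>k=j+1..n. f j + f k)"
      unfolding P_def pair_sum_eq_sum ..
    also have "\<dots> = ((\<Sum>j=1..n. \<Sum>k=1..n. f j + f k) - (\<Sum>j=1..n. f j + f j)) / 2"
      by (rule pair_sum_symmetric) simp
    also have "(\<Sum>j=1..n. \<Sum>k=1..n. f j + f k) = real n * (\<Sum>j=1..n. f j) + real n * (\<Sum>j=1..n. f j)"
      by (simp add: sum.distrib flip: sum_distrib_left)
    also have "(\<Sum>j=1..n. f j + f j) = (\<Sum>j=1..n. f j) + (\<Sum>j=1..n. f j)"
      by (rule sum.distrib)
    finally show ?thesis by (simp add: field_simps)
  qed
  have "expectation (\<lambda>\<omega>. \<bar>(\<Sum>p\<in>P. Y p \<omega>) - (\<Sum>p\<in>P. expectation (Y p))\<bar>) \<le> sqrt (4 * n ^ 3 * (12 * \<sigma> ^ 4))"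
    unfolding Y_def[abs_def]
    by (rule pair_variance[where \<phi> = "\<lambda>a b. a\<^sup>2 + b\<^sup>2"])
      (use int B in \<open>auto simp: Y_def P_def\<close>)
  also have "(\<Sum>p\<in>P. expectation (Y p)) = (\<Sum>p\<in>P. \<sigma>\<^sup>2 + \<sigma>\<^sup>2)"
    unfolding Y_def[abs_def] P_def using integrable_X_power
    by (intro sum.cong refl, subst Bochner_Integration.integral_add) (auto simp: expectation_X_2)
  also have "\<dots> = (real n - 1) * (real n * \<sigma>\<^sup>2)"
    using pairs[of "\<lambda>_. \<sigma>\<^sup>2"] by simp
  also have "(\<lambda>\<omega>. \<bar>(\<Sum>p\<in>P. Y p \<omega>) - (real n - 1) * (real n * \<sigma>\<^sup>2)\<bar>)
      = (\<lambda>\<omega>. (real n - 1) * \<bar>(\<Sum>j=1..n. (X j \<omega>)\<^sup>2) - real n * \<sigma>\<^sup>2\<bar>)"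
  proof
    fix \<omega>
    have "(\<Sum>p\<in>P. Y p \<omega>) = (real n - 1) * (\<Sum>j=1..n. (X j \<omega>)\<^sup>2)"
      unfolding Y_def by (rule pairs)
    then show "\<bar>(\<Sum>p\<in>P. Y p \<omega>) - (real n - 1) * (real n * \<sigma>\<^sup>2)\<bar>
        = (real n - 1) * \<bar>(\<Sum>j=1..n. (X j \<omega>)\<^sup>2) - real n * \<sigma>\<^sup>2\<bar>"
      using n by (simp only: right_diff_distrib[symmetric] abs_mult)
  qed
  also have "sqrt (4 * n ^ 3 * (12 * \<sigma> ^ 4)) = sqrt 48 * sqrt n ^ 3 * \<sigma>\<^sup>2"
  proof -
    have "4 * n ^ 3 * (12 * \<sigma> ^ 4) = 48 * real n ^ 3 * (\<sigma>\<^sup>2)\<^sup>2" by (simp flip: power_mult)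
    moreover have "sqrt ((\<sigma>\<^sup>2)\<^sup>2) = \<sigma>\<^sup>2" by (simp only: real_sqrt_abs) simp
    ultimately show ?thesis by (simp only: real_sqrt_mult) (simp add: real_sqrt_power)
  qed
  also have "\<dots> \<le> 7 * sqrt n ^ 3 * \<sigma>\<^sup>2"
    using \<sigma>_pos by (intro mult_right_mono real_le_lsqrt) auto
  also have "\<dots> = real n * (7 * sqrt n * \<sigma>\<^sup>2)"
    by (simp add: power3_eq_cube)
  \<comment> \<open>Each index occurs in \<open>n - 1\<close> pairs rather than \<open>n\<close>;
    \<open>n <= 2 (n - 1)\<close> turns the 7 into 14.\<close>
  also have "\<dots> \<le> (2 * (real n - 1)) * (7 * sqrt n * \<sigma>\<^sup>2)"
    using n by (intro mult_right_mono) auto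
  also have "\<dots> = (real n - 1) * (14 * sqrt n * \<sigma>\<^sup>2)"
    by simp
  finally have "(real n - 1) * expectation (\<lambda>\<omega>. \<bar>(\<Sum>j=1..n. (X j \<omega>)\<^sup>2) - real n * \<sigma>\<^sup>2\<bar>)
      \<le> (real n - 1) * (14 * sqrt n * \<sigma>\<^sup>2)"
    unfolding integral_mult_right_zero .
  then show ?thesis using n by (subst (asm) mult_le_cancel_left_pos) auto
qed

text \<open>After scaling, \<open>y powr (2 + q) <= 1 + y^4\<close> reduces the fractional moment to
  the fourth, and \<open>1 + 3 = 4\<close>.\<close>

lemma powr_abs_moment:
  assumes i: "i \<in> {1..n}" and q: "0 \<le> q" "q \<le> 1"
  shows "integrable M (\<lambda>\<omega>. \<bar>X i \<omega>\<bar> powr (2 + q))"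
    and "expectation (\<lambda>\<omega>. \<bar>X i \<omega>\<bar> powr (2 + q)) \<le> 4 * \<sigma> powr (2 + q)"
proof -
  have mX[measurable]: "X i \<in> borel_measurable M" using i by simp
  have le: "\<bar>X i \<omega>\<bar> powr (2 + q) \<le> \<sigma> powr (2 + q) * (1 + X i \<omega> ^ 4 / \<sigma> ^ 4)" for \<omega>
  proof -
    define y where "y = \<bar>X i \<omega>\<bar> / \<sigma>"
    have y: "0 \<le> y" unfolding y_def using \<sigma>_pos by simp
    have "y powr (2 + q) \<le> 1 + y ^ 4"
    proof (cases "y \<le> 1")
      case True
      then have "y powr (2 + q) \<le> 1" using y q by (intro powr_le1) auto
      then show ?thesis by (simp add: add_increasing2)
    next
      case False
      then have "y powr (2 + q) \<le> y powr 4" using q by (intro powr_mono) auto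
      also have "\<dots> = y ^ 4" using False by (simp add: powr_numeral)
      finally show ?thesis by simp
    qed
    then have "\<sigma> powr (2 + q) * y powr (2 + q) \<le> \<sigma> powr (2 + q) * (1 + y ^ 4)"
      by (intro mult_left_mono) auto
    moreover have "\<sigma> powr (2 + q) * y powr (2 + q) = \<bar>X i \<omega>\<bar> powr (2 + q)"
      unfolding y_def using \<sigma>_pos by (subst powr_mult[symmetric]) auto
    ultimately show ?thesis unfolding y_def by (simp add: power_divide power_even_abs)
  qed
  have intB: "integrable M (\<lambda>\<omega>. \<sigma> powr (2 + q) * (1 + X i \<omega> ^ 4 / \<sigma> ^ 4))"
    using integrable_X_power[OF i] by simp
  show int: "integrable M (\<lambda>\<omega>. \<bar>X i \<omega>\<bar> powr (2 + q))"
    by (rule Bochner_Integration.integrable_bound[OF intB])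
      (use le in \<open>auto intro!: AE_I2\<close>)
  have "expectation (\<lambda>\<omega>. \<bar>X i \<omega>\<bar> powr (2 + q)) \<le> expectation (\<lambda>\<omega>. \<sigma> powr (2 + q) * (1 + X i \<omega> ^ 4 / \<sigma> ^ 4))"
    using int intB le by (rule integral_mono)
  also have "\<dots> = \<sigma> powr (2 + q) * (1 + 3 * \<sigma> ^ 4 / \<sigma> ^ 4)"
    using integrable_X_power[OF i] expectation_X_4[OF i] by (simp add: prob_space)
  also have "\<dots> = 4 * \<sigma> powr (2 + q)" using \<sigma>_pos by simp
  finally show "expectation (\<lambda>\<omega>. \<bar>X i \<omega>\<bar> powr (2 + q)) \<le> 4 * \<sigma> powr (2 + q)" .
qed

text \<open>The integrand \<open>F\<close> is prescribed only where all coordinates are within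
  \<delta> of 0; elsewhere boundedness by 1 is enough, because leaving this region is already rare
  by fourth moments. This allows one statement for a weight that is cut off at the boundary of the
  well.\<close>

lemma one_well_expectation:
  fixes F :: "'a \<Rightarrow> complex" and G :: "'a \<Rightarrow> real" and \<beta> \<delta> q C t g0 g1 g2 :: real
  defines "S \<equiv> \<lambda>\<omega>. \<Sum>j=1..n. X j \<omega>"
    and "M2 \<equiv> \<lambda>\<omega>. \<Sum>j=1..n. (X j \<omega>)\<^sup>2"
    and "Q \<equiv> \<lambda>\<omega>. \<Sum>j=1..n. \<Sum>k=j+1..n. quartic_part ((X j \<omega> + X k \<omega>) / 2)"
    and "c0 \<equiv> real (n * (n - 1)) / 2 * quartic_mean \<sigma>"
    and "d \<equiv> 1 + \<beta> * (real n * \<sigma>\<^sup>2) / 4"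
  assumes n: "2 \<le> n" and \<beta>: "0 < \<beta>" and \<delta>: "0 < \<delta>" and q: "0 \<le> q" "q \<le> 1" and C: "0 \<le> C"
    and F[measurable]: "F \<in> borel_measurable M" and F1: "\<And>\<omega>. \<omega> \<in> space M \<Longrightarrow> norm (F \<omega>) \<le> 1"
    and Feq: "\<And>\<omega>. \<omega> \<in> space M \<Longrightarrow> (\<And>j. j \<in> {1..n} \<Longrightarrow> \<bar>X j \<omega>\<bar> \<le> \<delta>) \<Longrightarrow>
      F \<omega> = of_real (exp (- (\<beta> / 8) * (S \<omega>)\<^sup>2 - \<beta> * Q \<omega>)) * iexp (t * G \<omega>)"
    and Geq: "\<And>\<omega>. \<omega> \<in> space M \<Longrightarrow> (\<And>j. j \<in> {1..n} \<Longrightarrow> \<bar>X j \<omega>\<bar> \<le> \<delta>) \<Longrightarrow>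
      \<bar>G \<omega> - (n * g0 + g1 * S \<omega> + g2 / 2 * M2 \<omega>)\<bar> \<le> C * (\<Sum>j=1..n. \<bar>X j \<omega>\<bar> powr (2 + q))"
  shows "norm (expectation F - of_real (exp (- (\<beta> * c0))) * iexp (t * (n * g0 + 2 * g2 / \<beta>))
           * of_real (1 / sqrt d * exp (- ((t * g1)\<^sup>2 * (real n * \<sigma>\<^sup>2) / (2 * d)))))
    \<le> \<beta> * (11 * sqrt n ^ 3 * \<sigma> ^ 4)
      + \<bar>t\<bar> * (\<bar>g2\<bar> / 2 * (14 * sqrt n * \<sigma>\<^sup>2 + \<bar>real n * \<sigma>\<^sup>2 - 4 / \<beta>\<bar>) + C * (n * (4 * \<sigma> powr (2 + q))))
      + 2 * (n * (3 * \<sigma> ^ 4)) / \<delta> ^ 4"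
proof -
  have [measurable]: "S \<in> borel_measurable M" unfolding S_def by measurable
  have [measurable]: "M2 \<in> borel_measurable M" unfolding M2_def by measurable
  have mQ[measurable]: "Q \<in> borel_measurable M" unfolding Q_def
  proof (intro borel_measurable_sum)
    fix j k assume "j \<in> {1..n}" "k \<in> {j+1..n}"
    then have [measurable]: "X j \<in> borel_measurable M" "X k \<in> borel_measurable M" by auto
    show "(\<lambda>\<omega>. quartic_part ((X j \<omega> + X k \<omega>) / 2)) \<in> borel_measurable M" by measurable
  qed
  have Q0: "0 \<le> Q \<omega>" for \<omega> unfolding Q_def by (intro sum_nonneg quartic_part_bounds)
  have c00: "0 \<le> c0" unfolding c0_def quartic_mean_def
    by (intro mult_nonneg_nonneg integral_nonneg_AE AE_I2) (auto simp: quartic_part_bounds)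
  define D where "D = of_real (exp (- (\<beta> * c0))) * iexp (t * (n * g0 + 2 * g2 / \<beta>))"
  \<comment> \<open>The comparison function: \<open>Q\<close> is frozen at its mean and
    \<open>M2\<close> at 4/\<beta>, and the Taylor remainder is dropped. Only \<open>S\<close> stays
    random, so its expectation is an explicit Gaussian integral.\<close>
  define F0 where "F0 \<omega> = D * (of_real (exp (- (\<beta> / 8) * (S \<omega>)\<^sup>2)) * iexp ((t * g1) * S \<omega>))" for \<omega>
  have [measurable]: "F0 \<in> borel_measurable M" unfolding F0_def[abs_def] by measurable
  have nD: "norm D \<le> 1" unfolding D_def norm_mult norm_exp_i_times using \<beta> c00 by simp
  have F01: "norm (F0 \<omega>) \<le> 1" for \<omega>
  proof -
    have "norm (F0 \<omega>) \<le> 1 * (1 * 1)"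
      unfolding F0_def norm_mult using \<beta> nD by (intro mult_mono) (auto simp del: of_real_mult)
    then show ?thesis by simp
  qed
  have distS: "distributed M lborel S (normal_density 0 (sqrt n * \<sigma>))"
    using distributed_sum[of "{1..n}"] n unfolding S_def by simp
  have EF0: "expectation F0 = D * of_real (1 / sqrt d * exp (- ((t * g1)\<^sup>2 * (real n * \<sigma>\<^sup>2) / (2 * d))))"
  proof -
    have "expectation F0 = D * expectation (\<lambda>\<omega>. of_real (exp (- (\<beta> / 8) * (S \<omega>)\<^sup>2)) * iexp ((t * g1) * S \<omega>))"
      unfolding F0_def[abs_def] by (rule integral_mult_right_zero)
    also have "\<dots> = D * of_real (1 / sqrt (1 + 2 * (\<beta> / 8) * (sqrt n * \<sigma>)\<^sup>2)
        * exp (- ((t * g1)\<^sup>2 * (sqrt n * \<sigma>)\<^sup>2 / (2 * (1 + 2 * (\<beta> / 8) * (sqrt n * \<sigma>)\<^sup>2)))))"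
      using n \<sigma>_pos \<beta> by (subst expectation_gaussian_iexp[OF distS]) auto
    finally show ?thesis by (simp add: d_def power_mult_distrib)
  qed
  \<comment> \<open>A pointwise majorant of the difference whose expectation is controlled by the
    concentration and moment bounds. The last summand handles the region outside the Taylor
    neighbourhood.\<close>
  define W where "W \<omega> = \<beta> * \<bar>Q \<omega> - c0\<bar>
      + \<bar>t\<bar> * (\<bar>g2\<bar> / 2 * (\<bar>M2 \<omega> - n * \<sigma>\<^sup>2\<bar> + \<bar>n * \<sigma>\<^sup>2 - 4 / \<beta>\<bar>) + C * (\<Sum>j=1..n. \<bar>X j \<omega>\<bar> powr (2 + q)))
      + 2 * (\<Sum>j=1..n. X j \<omega> ^ 4) / \<delta> ^ 4" for \<omega>
  have FW: "norm (F \<omega> - F0 \<omega>) \<le> W \<omega>" if \<omega>: "\<omega> \<in> space M" for \<omega>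
  proof (cases "\<forall>j\<in>{1..n}. \<bar>X j \<omega>\<bar> \<le> \<delta>")
    case True
    \<comment> \<open>The Gaussian factor in \<open>S\<close> is common to \<open>F\<close> and
      \<open>F0\<close> and has modulus at most 1, so only the remaining exponents are
      compared.\<close>
    define E where "E = of_real (exp (- (\<beta> / 8) * (S \<omega>)\<^sup>2)) * iexp ((t * g1) * S \<omega>)"
    have E1: "norm E \<le> 1"
      unfolding E_def norm_mult using \<beta> by (simp del: of_real_mult)
    define a b where "a = t * G \<omega> - t * g1 * S \<omega>" and "b = t * (n * g0 + 2 * g2 / \<beta>)"
    have "F \<omega> = E * (of_real (exp (- (\<beta> * Q \<omega>))) * iexp a)"
    proof -
      have "exp (- (\<beta> / 8) * (S \<omega>)\<^sup>2 - \<beta> * Q \<omega>) = exp (- (\<beta> / 8) * (S \<omega>)\<^sup>2) * exp (- (\<beta> * Q \<omega>))"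
        by (simp flip: exp_add)
      moreover have "iexp (t * G \<omega>) = iexp ((t * g1) * S \<omega>) * iexp a"
        unfolding a_def exp_add[symmetric] by (simp add: algebra_simps)
      moreover have "F \<omega> = of_real (exp (- (\<beta> / 8) * (S \<omega>)\<^sup>2 - \<beta> * Q \<omega>)) * iexp (t * G \<omega>)"
        using Feq[OF \<omega>] True by blast
      ultimately show ?thesis unfolding E_def by simp
    qed
    then have "F \<omega> - F0 \<omega> = E * (of_real (exp (- (\<beta> * Q \<omega>))) * iexp a - of_real (exp (- (\<beta> * c0))) * iexp b)"
      unfolding F0_def D_def E_def[symmetric] b_def[symmetric] by (simp add: algebra_simps)
    then have "norm (F \<omega> - F0 \<omega>) = norm E * norm (of_real (exp (- (\<beta> * Q \<omega>))) * iexp a - of_real (exp (- (\<beta> * c0))) * iexp b)"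
      by (simp only: norm_mult)
    also have "\<dots> \<le> 1 * norm (of_real (exp (- (\<beta> * Q \<omega>))) * iexp a - of_real (exp (- (\<beta> * c0))) * iexp b)"
      using E1 norm_ge_zero by (rule mult_right_mono)
    also have "\<dots> \<le> \<bar>\<beta> * Q \<omega> - \<beta> * c0\<bar> + \<bar>a - b\<bar>"
      using norm_exp_iexp_diff_le[of "\<beta> * Q \<omega>" "\<beta> * c0" a b] \<beta> Q0 c00 by simp
    also have "\<bar>\<beta> * Q \<omega> - \<beta> * c0\<bar> = \<beta> * \<bar>Q \<omega> - c0\<bar>"
      using \<beta> by (simp add: right_diff_distrib[symmetric] abs_mult)
    also have "\<bar>a - b\<bar> \<le> \<bar>t\<bar> * (\<bar>g2\<bar> / 2 * (\<bar>M2 \<omega> - n * \<sigma>\<^sup>2\<bar> + \<bar>n * \<sigma>\<^sup>2 - 4 / \<beta>\<bar>) + C * (\<Sum>j=1..n. \<bar>X j \<omega>\<bar> powr (2 + q)))"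
    proof -
      have "a - b = t * ((G \<omega> - (n * g0 + g1 * S \<omega> + g2 / 2 * M2 \<omega>)) + g2 / 2 * (M2 \<omega> - 4 / \<beta>))"
        unfolding a_def b_def by (simp add: algebra_simps)
      then have "\<bar>a - b\<bar> = \<bar>t\<bar> * \<bar>(G \<omega> - (n * g0 + g1 * S \<omega> + g2 / 2 * M2 \<omega>)) + g2 / 2 * (M2 \<omega> - 4 / \<beta>)\<bar>"
        by (simp only: abs_mult)
      also have "\<dots> \<le> \<bar>t\<bar> * (\<bar>g2\<bar> / 2 * (\<bar>M2 \<omega> - n * \<sigma>\<^sup>2\<bar> + \<bar>n * \<sigma>\<^sup>2 - 4 / \<beta>\<bar>) + C * (\<Sum>j=1..n. \<bar>X j \<omega>\<bar> powr (2 + q)))"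
      proof (rule mult_left_mono)
        have "\<bar>g2 / 2 * (M2 \<omega> - 4 / \<beta>)\<bar> \<le> \<bar>g2\<bar> / 2 * (\<bar>M2 \<omega> - n * \<sigma>\<^sup>2\<bar> + \<bar>n * \<sigma>\<^sup>2 - 4 / \<beta>\<bar>)"
          unfolding abs_mult by (intro mult_mono) auto
        then show "\<bar>(G \<omega> - (n * g0 + g1 * S \<omega> + g2 / 2 * M2 \<omega>)) + g2 / 2 * (M2 \<omega> - 4 / \<beta>)\<bar>
            \<le> \<bar>g2\<bar> / 2 * (\<bar>M2 \<omega> - n * \<sigma>\<^sup>2\<bar> + \<bar>n * \<sigma>\<^sup>2 - 4 / \<beta>\<bar>) + C * (\<Sum>j=1..n. \<bar>X j \<omega>\<bar> powr (2 + q))"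
          using Geq[OF \<omega>] True by (intro order_trans[OF abs_triangle_ineq]) (simp add: add.commute add_mono)
      qed simp
      finally show ?thesis .
    qed
    finally show ?thesis
      unfolding W_def by (simp add: add_increasing2 sum_nonneg)
  next
    case False
    then obtain i where i: "i \<in> {1..n}" "\<delta> < \<bar>X i \<omega>\<bar>" by force
    \<comment> \<open>Markov's inequality in pointwise form: one coordinate beyond \<delta> makes
      the fourth-power sum large enough to pay for the trivial bound 2.\<close>
    have "norm (F \<omega> - F0 \<omega>) \<le> 2"
      using F1[OF \<omega>] F01[of \<omega>] norm_triangle_ineq4[of "F \<omega>" "F0 \<omega>"] by simp
    moreover have "\<delta> ^ 4 \<le> (\<Sum>j=1..n. X j \<omega> ^ 4)"
    proof -
      have "\<delta> ^ 4 \<le> \<bar>X i \<omega>\<bar> ^ 4" using i \<delta> by (intro power_mono) auto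
      also have "\<dots> = X i \<omega> ^ 4" by (simp add: power_even_abs)
      also have "\<dots> \<le> (\<Sum>j=1..n. X j \<omega> ^ 4)" using i by (intro member_le_sum) auto
      finally show ?thesis .
    qed
    then have "2 \<le> 2 * (\<Sum>j=1..n. X j \<omega> ^ 4) / \<delta> ^ 4"
      using \<delta> by (simp add: field_simps)
    moreover have "0 \<le> W \<omega> - 2 * (\<Sum>j=1..n. X j \<omega> ^ 4) / \<delta> ^ 4"
      unfolding W_def using \<beta> C by (auto intro!: add_nonneg_nonneg mult_nonneg_nonneg sum_nonneg)
    ultimately show ?thesis by linarith
  qed
  have iQ: "integrable M Q"
  proof -
    have "integrable M (\<lambda>\<omega>. quartic_part ((X j \<omega> + X k \<omega>) / 2))" if "j \<in> {1..n}" "k \<in> {1..n}" for j k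
    proof (rule Bochner_Integration.integrable_bound)
      show "integrable M (\<lambda>\<omega>. (X j \<omega> ^ 4 + X k \<omega> ^ 4) / 4)" using that integrable_X_power by simp
      show "AE \<omega> in M. norm (quartic_part ((X j \<omega> + X k \<omega>) / 2)) \<le> norm ((X j \<omega> ^ 4 + X k \<omega> ^ 4) / 4)"
      proof (intro AE_I2)
        fix \<omega>
        show "norm (quartic_part ((X j \<omega> + X k \<omega>) / 2)) \<le> norm ((X j \<omega> ^ 4 + X k \<omega> ^ 4) / 4)"
          using quartic_part_half_le[of "X j \<omega>" "X k \<omega>"] quartic_part_bounds(1)[of "(X j \<omega> + X k \<omega>) / 2"]
          unfolding real_norm_def by linarith
      qed
    qed (use that in measurable)
    then show ?thesis unfolding Q_def by (intro Bochner_Integration.integrable_sum) auto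
  qed
  have iM2: "integrable M M2" unfolding M2_def by (intro Bochner_Integration.integrable_sum integrable_X_power) auto
  have iP: "integrable M (\<lambda>\<omega>. \<Sum>j=1..n. \<bar>X j \<omega>\<bar> powr (2 + q))"
    by (intro Bochner_Integration.integrable_sum powr_abs_moment(1) q) auto
  have i4: "integrable M (\<lambda>\<omega>. \<Sum>j=1..n. X j \<omega> ^ 4)"
    by (intro Bochner_Integration.integrable_sum integrable_X_power) auto
  have iW: "integrable M W" unfolding W_def[abs_def] using iQ iM2 iP i4 by simp
  have iF: "integrable M F" using F1 by (intro integrable_const_bound[where B=1]) auto
  have iF0: "integrable M F0" using F01 by (intro integrable_const_bound[where B=1]) auto
  have "norm (expectation F - expectation F0) = norm (expectation (\<lambda>\<omega>. F \<omega> - F0 \<omega>))"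
    using iF iF0 by simp
  also have "\<dots> \<le> expectation (\<lambda>\<omega>. norm (F \<omega> - F0 \<omega>))" by (rule integral_norm_bound)
  also have "\<dots> \<le> expectation W"
    using iF iF0 iW FW by (intro integral_mono) auto
  also have "\<dots> = \<beta> * expectation (\<lambda>\<omega>. \<bar>Q \<omega> - c0\<bar>)
      + \<bar>t\<bar> * (\<bar>g2\<bar> / 2 * (expectation (\<lambda>\<omega>. \<bar>M2 \<omega> - n * \<sigma>\<^sup>2\<bar>) + \<bar>n * \<sigma>\<^sup>2 - 4 / \<beta>\<bar>)
          + C * (\<Sum>j=1..n. expectation (\<lambda>\<omega>. \<bar>X j \<omega>\<bar> powr (2 + q))))
      + 2 * (\<Sum>j=1..n. expectation (\<lambda>\<omega>. X j \<omega> ^ 4)) / \<delta> ^ 4"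
    unfolding W_def[abs_def] using iQ iM2 iP i4 powr_abs_moment(1)[OF _ q] integrable_X_power
    by (simp add: prob_space)
  also have "\<dots> \<le> \<beta> * (11 * sqrt n ^ 3 * \<sigma> ^ 4)
      + \<bar>t\<bar> * (\<bar>g2\<bar> / 2 * (14 * sqrt n * \<sigma>\<^sup>2 + \<bar>real n * \<sigma>\<^sup>2 - 4 / \<beta>\<bar>) + C * (\<Sum>j=1..n. 4 * \<sigma> powr (2 + q)))
      + 2 * (\<Sum>j=1..n. 3 * \<sigma> ^ 4) / \<delta> ^ 4"
    using \<beta> C \<delta> quartic_concentration square_sum_concentration[OF n] powr_abs_moment(2)[OF _ q] expectation_X_4
    by (intro add_mono mult_left_mono divide_right_mono sum_mono) (auto simp: Q_def M2_def c0_def)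
  finally show ?thesis unfolding EF0 D_def by simp
qed

end

section \<open>Change of measure from the torus to Gaussian clouds\<close>

text \<open>Rectangles determine a product measure, and on them both sides factor. The factors
  \<open>M i\<close> and \<open>N i\<close> may have different spaces and sigma-algebras, as the
  torus interval and the line do; hence the pushforward along the identity instead of an equality of
  densities.\<close>

lemma (in product_sigma_finite) distr_density_PiM_eq:
  assumes I: "finite I" and N: "\<And>i. sigma_finite_measure (N i)"
    and f[measurable]: "\<And>i. i \<in> I \<Longrightarrow> f i \<in> borel_measurable (M i)"
    and id: "\<And>i. i \<in> I \<Longrightarrow> (\<lambda>x. x) \<in> M i \<rightarrow>\<^sub>M N i"
    and dens: "\<And>i A. i \<in> I \<Longrightarrow> A \<in> sets (N i) \<Longrightarrow> emeasure (N i) A = (\<integral>\<^sup>+x. f i x * indicator A x \<partial>M i)"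
  shows "distr (density (PiM I M) (\<lambda>x. \<Prod>i\<in>I. f i (x i))) (PiM I N) (\<lambda>x. x) = PiM I N"
    and "(\<lambda>x. x) \<in> PiM I M \<rightarrow>\<^sub>M PiM I N"
proof -
  show id_PiM[measurable]: "(\<lambda>x. x) \<in> PiM I M \<rightarrow>\<^sub>M PiM I N"
  proof (rule measurable_PiM_single')
    fix i assume i: "i \<in> I"
    show "(\<lambda>\<omega>. \<omega> i) \<in> PiM I M \<rightarrow>\<^sub>M N i"
      by (rule measurable_compose[where f = "\<lambda>x. x i" and g = "\<lambda>x. x" and N = "M i"],
          rule measurable_component_singleton[OF i], rule id[OF i])
  next
    show "(\<lambda>\<omega> i. \<omega> i) \<in> space (PiM I M) \<rightarrow> (\<Pi>\<^sub>E i\<in>I. space (N i))"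
      using id[THEN measurable_space] by (auto simp: space_PiM PiE_iff)
  qed
  interpret N: product_sigma_finite N
    by (rule product_sigma_finite.intro) (rule N)
  have fP[measurable]: "(\<lambda>x. \<Prod>i\<in>I. f i (x i)) \<in> borel_measurable (PiM I M)"
  proof (rule borel_measurable_prod_ennreal)
    fix i assume i: "i \<in> I"
    show "(\<lambda>x. f i (x i)) \<in> borel_measurable (PiM I M)"
      by (rule measurable_compose[where f = "\<lambda>x. x i" and g = "f i" and N = "M i"],
          rule measurable_component_singleton[OF i], rule f[OF i])
  qed
  show "distr (density (PiM I M) (\<lambda>x. \<Prod>i\<in>I. f i (x i))) (PiM I N) (\<lambda>x. x) = PiM I N"
  proof (rule N.PiM_eqI[OF I])
    fix A assume A: "\<And>i. i \<in> I \<Longrightarrow> A i \<in> sets (N i)"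
    have PA: "Pi\<^sub>E I A \<in> sets (PiM I N)"
      using A I by (intro sets_PiM_I_finite) auto
    have vim: "Pi\<^sub>E I A \<inter> space (PiM I M) \<in> sets (PiM I M)"
      using measurable_sets[OF id_PiM PA] by simp
    have "emeasure (distr (density (PiM I M) (\<lambda>x. \<Prod>i\<in>I. f i (x i))) (PiM I N) (\<lambda>x. x)) (Pi\<^sub>E I A)
        = emeasure (density (PiM I M) (\<lambda>x. \<Prod>i\<in>I. f i (x i))) (Pi\<^sub>E I A \<inter> space (PiM I M))"
      using PA by (subst emeasure_distr) auto
    also have "\<dots> = (\<integral>\<^sup>+x. (\<Prod>i\<in>I. f i (x i)) * indicator (Pi\<^sub>E I A \<inter> space (PiM I M)) x \<partial>PiM I M)"
      using vim by (subst emeasure_density) auto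
    also have "\<dots> = (\<integral>\<^sup>+x. (\<Prod>i\<in>I. f i (x i) * indicator (A i) (x i)) \<partial>PiM I M)"
    proof (intro nn_integral_cong)
      fix x assume x: "x \<in> space (PiM I M)"
      have "indicator (Pi\<^sub>E I A \<inter> space (PiM I M)) x = (\<Prod>i\<in>I. indicator (A i) (x i) :: ennreal)"
        using x I by (cases "\<forall>i\<in>I. x i \<in> A i") (auto simp: indicator_def space_PiM PiE_iff)
      then show "(\<Prod>i\<in>I. f i (x i)) * indicator (Pi\<^sub>E I A \<inter> space (PiM I M)) x = (\<Prod>i\<in>I. f i (x i) * indicator (A i) (x i))"
        by (simp add: prod.distrib)
    qed
    also have "\<dots> = (\<Prod>i\<in>I. \<integral>\<^sup>+x. f i x * indicator (A i) x \<partial>M i)"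
    proof (rule product_nn_integral_prod[OF I])
      fix i assume i: "i \<in> I"
      have "indicator (A i) \<in> M i \<rightarrow>\<^sub>M (borel :: ennreal measure)"
        by (rule measurable_compose[where g = "indicator (A i)", OF id[OF i] borel_measurable_indicator[OF A[OF i]]])
      then show "(\<lambda>x. f i x * indicator (A i) x) \<in> borel_measurable (M i)"
        using f[OF i] by measurable
    qed
    also have "\<dots> = (\<Prod>i\<in>I. emeasure (N i) (A i))"
      using dens A by simp
    finally show "emeasure (distr (density (PiM I M) (\<lambda>x. \<Prod>i\<in>I. f i (x i))) (PiM I N) (\<lambda>x. x)) (Pi\<^sub>E I A)
        = (\<Prod>i\<in>I. emeasure (N i) (A i))" .
  qed simp
qed

lemma (in product_sigma_finite) integral_PiM_density:
  fixes F :: "('i \<Rightarrow> 'a) \<Rightarrow> complex" and f :: "'i \<Rightarrow> 'a \<Rightarrow> real"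
  assumes I: "finite I" and N: "\<And>i. sigma_finite_measure (N i)"
    and f: "\<And>i. i \<in> I \<Longrightarrow> f i \<in> borel_measurable (M i)" "\<And>i x. 0 \<le> f i x"
    and id: "\<And>i. i \<in> I \<Longrightarrow> (\<lambda>x. x) \<in> M i \<rightarrow>\<^sub>M N i"
    and dens: "\<And>i A. i \<in> I \<Longrightarrow> A \<in> sets (N i) \<Longrightarrow> emeasure (N i) A = (\<integral>\<^sup>+x. ennreal (f i x) * indicator A x \<partial>M i)"
    and F[measurable]: "F \<in> borel_measurable (PiM I N)"
  shows "(\<integral>x. of_real (\<Prod>i\<in>I. f i (x i)) * F x \<partial>PiM I M) = (\<integral>x. F x \<partial>PiM I N)"
proof -
  note * = distr_density_PiM_eq[of I N "\<lambda>i x. ennreal (f i x)", OF I N _ id dens]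
  have f': "\<And>i. i \<in> I \<Longrightarrow> (\<lambda>x. ennreal (f i x)) \<in> borel_measurable (M i)" using f(1) by measurable
  note id_PiM[measurable] = *(2)[OF f']
  have [measurable]: "(\<lambda>x. \<Prod>i\<in>I. f i (x i)) \<in> borel_measurable (PiM I M)"
  proof (rule borel_measurable_prod)
    fix i assume i: "i \<in> I"
    show "(\<lambda>x. f i (x i)) \<in> borel_measurable (PiM I M)"
      by (rule measurable_compose[where f = "\<lambda>x. x i" and g = "f i" and N = "M i"],
          rule measurable_component_singleton[OF i], rule f(1)[OF i])
  qed
  have mF: "F \<in> borel_measurable (PiM I M)"
    by (rule measurable_compose[OF id_PiM F])
  have "(\<integral>x. F x \<partial>PiM I N) = (\<integral>x. F x \<partial>distr (density (PiM I M) (\<lambda>x. \<Prod>i\<in>I. ennreal (f i (x i)))) (PiM I N) (\<lambda>x. x))"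
    by (simp only: *(1)[OF f'])
  also have "\<dots> = (\<integral>x. F x \<partial>density (PiM I M) (\<lambda>x. \<Prod>i\<in>I. ennreal (f i (x i))))"
    by (rule integral_distr[where g = "\<lambda>x. x" and f = F]) (simp_all add: id_PiM F)
  also have "(\<lambda>x. \<Prod>i\<in>I. ennreal (f i (x i))) = (\<lambda>x. ennreal (\<Prod>i\<in>I. f i (x i)))"
    using f(2) by (simp add: prod_ennreal)
  also have "(\<integral>x. F x \<partial>density (PiM I M) (\<lambda>x. ennreal (\<Prod>i\<in>I. f i (x i)))) = (\<integral>x. (\<Prod>i\<in>I. f i (x i)) *\<^sub>R F x \<partial>PiM I M)"
    using f(2) mF by (intro integral_density) (auto intro: prod_nonneg)
  finally show ?thesis by (simp add: scaleR_conv_of_real)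
qed

section \<open>Gaussian clouds over completed Lebesgue measure\<close>

lemma finite_measure_lebesgue_on_torus: "finite_measure (lebesgue_on {- pi<..pi})"
  by (rule finite_measureI) (simp add: emeasure_restrict_space)

text \<open>The density is taken over the completed measure because \<open>g\<close> is only
  Lebesgue measurable.\<close>

definition normal_lebesgue :: "real \<Rightarrow> real \<Rightarrow> real measure" where
  "normal_lebesgue \<mu> \<sigma> = density lebesgue (\<lambda>x. ennreal (normal_density \<mu> \<sigma> x))"

lemma sets_normal_lebesgue [measurable_cong, simp]: "sets (normal_lebesgue \<mu> \<sigma>) = sets lebesgue"
  by (simp add: normal_lebesgue_def)

lemma space_normal_lebesgue [simp]: "space (normal_lebesgue \<mu> \<sigma>) = UNIV"
  by (simp add: normal_lebesgue_def)

lemma measurable_id_lebesgue: "(\<lambda>x::real. x) \<in> borel_measurable lebesgue"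
  by (intro measurable_completion) simp

text \<open>Completion changes nothing on Borel sets, so the facts about normal distributions over
  \<open>lborel\<close> become available.\<close>

lemma distr_normal_lebesgue:
  "distr (normal_lebesgue \<mu> \<sigma>) lborel (\<lambda>x. x) = density lborel (normal_density \<mu> \<sigma>)"
proof (rule measure_eqI)
  fix A :: "real set" assume "A \<in> sets (distr (normal_lebesgue \<mu> \<sigma>) lborel (\<lambda>x. x))"
  then have A[measurable]: "A \<in> sets borel" by simp
  have [measurable]: "normal_density \<mu> \<sigma> \<in> borel_measurable lebesgue"
    by (intro measurable_completion) simp
  have "emeasure (distr (normal_lebesgue \<mu> \<sigma>) lborel (\<lambda>x. x)) A = emeasure (normal_lebesgue \<mu> \<sigma>) A"
    by (subst emeasure_distr) (auto simp: measurable_cong_sets[OF sets_normal_lebesgue refl] measurable_id_lebesgue)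
  also have "\<dots> = (\<integral>\<^sup>+x. ennreal (normal_density \<mu> \<sigma> x) * indicator A x \<partial>lebesgue)"
    unfolding normal_lebesgue_def by (subst emeasure_density) auto
  also have "\<dots> = emeasure (density lborel (normal_density \<mu> \<sigma>)) A"
    unfolding nn_integral_completion by (subst emeasure_density) auto
  finally show "emeasure (distr (normal_lebesgue \<mu> \<sigma>) lborel (\<lambda>x. x)) A = emeasure (density lborel (normal_density \<mu> \<sigma>)) A" .
qed simp

lemma prob_space_normal_lebesgue:
  assumes "0 < \<sigma>"
  shows "prob_space (normal_lebesgue \<mu> \<sigma>)"
proof -
  have "prob_space (distr (normal_lebesgue \<mu> \<sigma>) lborel (\<lambda>x. x))"
    unfolding distr_normal_lebesgue using assms by (rule prob_space_normal_density)
  then show ?thesis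
    by (rule prob_space_distrD[rotated]) (simp add: measurable_cong_sets[OF sets_normal_lebesgue refl] measurable_id_lebesgue)
qed

text \<open>The Gaussians live on the whole line and are not truncated to the well, which keeps all
  moments and the law of \<open>S\<close> exact; the restriction to the well goes into the
  integrand.\<close>

definition gaussian_cloud :: "nat \<Rightarrow> real \<Rightarrow> real \<Rightarrow> (nat \<Rightarrow> real) measure" where
  "gaussian_cloud n \<mu> \<sigma> = (\<Pi>\<^sub>M j\<in>{1..n}. normal_lebesgue \<mu> \<sigma>)"

lemma prob_space_gaussian_cloud: "0 < \<sigma> \<Longrightarrow> prob_space (gaussian_cloud n \<mu> \<sigma>)"
  unfolding gaussian_cloud_def by (intro prob_space_PiM prob_space_normal_lebesgue)

lemma distributed_gaussian_cloud:
  assumes j: "j \<in> {1..n}" and \<sigma>: "0 < \<sigma>"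
  shows "distributed (gaussian_cloud n \<mu> \<sigma>) lborel (\<lambda>\<theta>. \<theta> j - \<mu>) (normal_density 0 \<sigma>)"
proof -
  interpret prob_space "gaussian_cloud n \<mu> \<sigma>" using \<sigma> by (rule prob_space_gaussian_cloud)
  have id: "(\<lambda>x. x) \<in> normal_lebesgue \<mu> \<sigma> \<rightarrow>\<^sub>M lborel"
    by (simp add: measurable_cong_sets[OF sets_normal_lebesgue refl] measurable_id_lebesgue)
  have comp: "(\<lambda>\<theta>. \<theta> j) \<in> gaussian_cloud n \<mu> \<sigma> \<rightarrow>\<^sub>M normal_lebesgue \<mu> \<sigma>"
    unfolding gaussian_cloud_def using j by (rule measurable_component_singleton)
  have "distr (gaussian_cloud n \<mu> \<sigma>) lborel (\<lambda>\<theta>. \<theta> j)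
      = distr (distr (gaussian_cloud n \<mu> \<sigma>) (normal_lebesgue \<mu> \<sigma>) (\<lambda>\<theta>. \<theta> j)) lborel (\<lambda>x. x)"
    by (subst distr_distr[OF id comp]) (simp add: comp_def)
  also have "distr (gaussian_cloud n \<mu> \<sigma>) (normal_lebesgue \<mu> \<sigma>) (\<lambda>\<theta>. \<theta> j) = normal_lebesgue \<mu> \<sigma>"
    unfolding gaussian_cloud_def using j \<sigma> by (intro distr_PiM_component prob_space_normal_lebesgue)
  finally have "distributed (gaussian_cloud n \<mu> \<sigma>) lborel (\<lambda>\<theta>. \<theta> j) (normal_density \<mu> \<sigma>)"
    unfolding distributed_def distr_normal_lebesgue using measurable_compose[OF comp id] by simp
  from normal_density_affine[OF this \<sigma>, of 1 "- \<mu>"] show ?thesis by simp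
qed

lemma gaussian_sample_cloud:
  assumes n: "0 < n" and \<sigma>: "0 < \<sigma>"
  shows "gaussian_sample (gaussian_cloud n \<mu> \<sigma>) (\<lambda>j \<theta>. \<theta> j - \<mu>) n \<sigma>"
proof -
  interpret prob_space "gaussian_cloud n \<mu> \<sigma>" using \<sigma> by (rule prob_space_gaussian_cloud)
  have "indep_vars (\<lambda>_. normal_lebesgue \<mu> \<sigma>) (\<lambda>j \<theta>. \<theta> j) {1..n}"
  proof (subst indep_vars_iff_distr_eq_PiM')
    show "{1..n} \<noteq> {}" using n by auto
    show "random_variable (normal_lebesgue \<mu> \<sigma>) (\<lambda>\<theta>. \<theta> j)" if "j \<in> {1..n}" for j
      unfolding gaussian_cloud_def using that by (rule measurable_component_singleton)
    have "distr (gaussian_cloud n \<mu> \<sigma>) (\<Pi>\<^sub>M j\<in>{1..n}. normal_lebesgue \<mu> \<sigma>) (\<lambda>\<theta>. \<lambda>j\<in>{1..n}. \<theta> j)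
        = distr (gaussian_cloud n \<mu> \<sigma>) (gaussian_cloud n \<mu> \<sigma>) (\<lambda>\<theta>. \<theta>)"
      by (intro distr_cong) (auto simp: gaussian_cloud_def space_PiM extensional_restrict)
    also have "\<dots> = gaussian_cloud n \<mu> \<sigma>" by (rule distr_id)
    also have "\<dots> = (\<Pi>\<^sub>M j\<in>{1..n}. distr (gaussian_cloud n \<mu> \<sigma>) (normal_lebesgue \<mu> \<sigma>) (\<lambda>\<theta>. \<theta> j))"
      unfolding gaussian_cloud_def using \<sigma>
      by (intro PiM_cong refl distr_PiM_component[symmetric] prob_space_normal_lebesgue)
    finally show "distr (gaussian_cloud n \<mu> \<sigma>) (\<Pi>\<^sub>M j\<in>{1..n}. normal_lebesgue \<mu> \<sigma>) (\<lambda>\<theta>. \<lambda>j\<in>{1..n}. \<theta> j)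
        = (\<Pi>\<^sub>M j\<in>{1..n}. distr (gaussian_cloud n \<mu> \<sigma>) (normal_lebesgue \<mu> \<sigma>) (\<lambda>\<theta>. \<theta> j))" .
  qed
  then have "indep_vars (\<lambda>_. borel) (\<lambda>j \<theta>. \<theta> j - \<mu>) {1..n}"
    by (rule indep_vars_compose2)
      (simp add: measurable_cong_sets[OF sets_normal_lebesgue refl] measurable_id_lebesgue borel_measurable_diff)
  then show ?thesis
    using n \<sigma> distributed_gaussian_cloud by unfold_locales auto
qed

text \<open>Half-open, so that the two wells tile the interval of the process without
  overlap.\<close>

definition well :: "real \<Rightarrow> real set" where
  "well s = {s - pi / 2<..s + pi / 2}"

lemma sets_well [measurable, simp]: "well s \<in> sets borel" "well s \<in> sets lebesgue"
  by (auto simp: well_def)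

lemma well_subset_torus:
  assumes "s = pi / 2 \<or> s = - (pi / 2)"
  shows "well s \<subseteq> {- pi<..pi}"
  using assms pi_gt_zero by (auto simp: well_def)

text \<open>Both sides are the integral of \<open>F\<close> over the product of one truncated
  Gaussian: its density is indicator times normal density over the torus interval, and the indicator
  alone over the full Gaussian.\<close>

lemma torus_well_transfer:
  fixes F :: "(nat \<Rightarrow> real) \<Rightarrow> complex"
  assumes s: "s = pi / 2 \<or> s = - (pi / 2)" and \<sigma>: "0 < \<sigma>"
    and F: "F \<in> borel_measurable (\<Pi>\<^sub>M j\<in>{1..n}. lebesgue)"
  shows "(\<integral>\<theta>. of_real (\<Prod>j\<in>{1..n}. indicator (well s) (\<theta> j) * normal_density s \<sigma> (\<theta> j)) * F \<theta> \<partial>torus_measure n)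
    = (\<integral>\<theta>. of_real (\<Prod>j\<in>{1..n}. indicator (well s) (\<theta> j)) * F \<theta> \<partial>gaussian_cloud n s \<sigma>)"
proof -
  define N where "N = density lebesgue (\<lambda>x. ennreal (indicator (well s) x * normal_density s \<sigma> x))"
  have mf[measurable]: "(\<lambda>x. indicator (well s) x * normal_density s \<sigma> x) \<in> borel_measurable lebesgue"
    "normal_density s \<sigma> \<in> borel_measurable lebesgue"
    by (auto intro!: measurable_completion)
  have setsN: "sets N = sets lebesgue" by (simp add: N_def)
  have FN: "F \<in> borel_measurable (\<Pi>\<^sub>M j\<in>{1..n}. N)"
    using F by (simp cong: measurable_cong_sets add: sets_PiM_cong[OF refl setsN])
  have NA: "emeasure N A = (\<integral>\<^sup>+x. ennreal (indicator (well s) x * normal_density s \<sigma> x) * indicator A x \<partial>lebesgue)"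
    if "A \<in> sets lebesgue" for A
    unfolding N_def using that by (intro emeasure_density) measurable
  interpret G: prob_space "normal_lebesgue s \<sigma>" using \<sigma> by (rule prob_space_normal_lebesgue)
  have NG: "emeasure N A = (\<integral>\<^sup>+x. ennreal (indicator (well s) x) * indicator A x \<partial>normal_lebesgue s \<sigma>)"
    if [measurable]: "A \<in> sets lebesgue" for A
    unfolding NA[OF that] normal_lebesgue_def
    by (subst nn_integral_density)
      (auto intro!: nn_integral_cong simp: ennreal_mult'' mult_ac split: split_indicator)
  have NT: "emeasure N A = (\<integral>\<^sup>+x. ennreal (indicator (well s) x * normal_density s \<sigma> x) * indicator A x \<partial>lebesgue_on {- pi<..pi})"
    if [measurable]: "A \<in> sets lebesgue" for A
    unfolding NA[OF that] using well_subset_torus[OF s]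
    by (subst nn_integral_restrict_space) (auto intro!: nn_integral_cong split: split_indicator)
  have "finite_measure N"
  proof (rule finite_measureI)
    have "emeasure N (space N) = (\<integral>\<^sup>+x. ennreal (indicator (well s) x) * indicator (space N) x \<partial>normal_lebesgue s \<sigma>)"
      using setsN by (intro NG) (auto simp: N_def)
    also have "\<dots> \<le> (\<integral>\<^sup>+x. indicator (space (normal_lebesgue s \<sigma>)) x \<partial>normal_lebesgue s \<sigma>)"
      by (intro nn_integral_mono) (auto split: split_indicator)
    also have "\<dots> = 1"
      using G.emeasure_space_1 by (subst nn_integral_indicator) auto
    finally have "emeasure N (space N) \<le> 1" .
    then show "emeasure N (space N) \<noteq> \<infinity>"
      by (auto simp: top_unique)
  qed
  then interpret N: finite_measure N .
  interpret T: finite_measure "lebesgue_on {- pi<..pi}" by (rule finite_measure_lebesgue_on_torus)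
  interpret PT: product_sigma_finite "\<lambda>_::nat. lebesgue_on {- pi<..pi}" ..
  interpret PG: product_sigma_finite "\<lambda>_::nat. normal_lebesgue s \<sigma>" ..
  have idT: "(\<lambda>x. x) \<in> lebesgue_on {- pi<..pi} \<rightarrow>\<^sub>M N"
    unfolding measurable_cong_sets[OF refl setsN] by (intro measurable_restrict_space1) simp
  have idG: "(\<lambda>x. x) \<in> normal_lebesgue s \<sigma> \<rightarrow>\<^sub>M N"
    unfolding measurable_cong_sets[OF sets_normal_lebesgue setsN] by simp
  have "(\<integral>\<theta>. of_real (\<Prod>j\<in>{1..n}. indicator (well s) (\<theta> j) * normal_density s \<sigma> (\<theta> j)) * F \<theta> \<partial>torus_measure n)
      = (\<integral>\<theta>. F \<theta> \<partial>(\<Pi>\<^sub>M j\<in>{1..n}. N))"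
    unfolding torus_measure_def
  proof (rule PT.integral_PiM_density)
    show "(\<lambda>x. indicator (well s) x * normal_density s \<sigma> x) \<in> borel_measurable (lebesgue_on {- pi<..pi})"
      by (intro measurable_restrict_space1 mf)
  qed (use NT setsN idT FN N.sigma_finite_measure_axioms in auto)
  also have "\<dots> = (\<integral>\<theta>. of_real (\<Prod>j\<in>{1..n}. indicator (well s) (\<theta> j)) * F \<theta> \<partial>gaussian_cloud n s \<sigma>)"
    unfolding gaussian_cloud_def
  proof (rule PG.integral_PiM_density[symmetric])
    show "indicator (well s) \<in> borel_measurable (normal_lebesgue s \<sigma>)"
      unfolding measurable_cong_sets[OF sets_normal_lebesgue refl] by simp
  qed (use NG setsN idG FN N.sigma_finite_measure_axioms in auto)
  finally show ?thesis .
qed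

text \<open>Second-order Taylor expansion with Lagrange remainder: moving the second derivative from
  the intermediate point to \<open>x\<close> costs a constant times \<open>|y| powr q\<close> by
  Hoelder continuity. The bound 1/2 on \<delta> keeps the expansion inside the region where the
  formula for the weight is exact.\<close>

lemma C2_Hoelder_near_taylor:
  assumes "C2_Hoelder_near q g x" "0 < q"
  obtains \<delta> C where "0 < \<delta>" "\<delta> \<le> 1 / 2" "0 \<le> C"
    "\<And>y. \<bar>y\<bar> \<le> \<delta> \<Longrightarrow> \<bar>g (x + y) - (g x + deriv g x * y + deriv (deriv g) x / 2 * y\<^sup>2)\<bar> \<le> C * \<bar>y\<bar> powr (2 + q)"
proof -
  obtain U K where U: "open U" "x \<in> U"
    and diff: "\<And>y. y \<in> U \<Longrightarrow> g differentiable (at y)" "\<And>y. y \<in> U \<Longrightarrow> deriv g differentiable (at y)"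
    and K: "\<And>y z. y \<in> U \<Longrightarrow> z \<in> U \<Longrightarrow> \<bar>deriv (deriv g) y - deriv (deriv g) z\<bar> \<le> K * \<bar>y - z\<bar> powr q"
    using assms unfolding C2_Hoelder_near_def by blast
  obtain e where e: "0 < e" "cball x e \<subseteq> U" using U open_contains_cball by blast
  define \<delta> where "\<delta> = min e (1 / 2)"
  define D where "D m = (if m = 0 then g else if m = 1 then deriv g else deriv (deriv g))" for m :: nat
  have inU: "z \<in> U" if "\<bar>z - x\<bar> \<le> \<delta>" for z
    using that e unfolding \<delta>_def by (auto simp: subset_iff dist_real_def)
  have D: "DERIV (D m) z :> D (Suc m) z" if "m < 2" "\<bar>z - x\<bar> \<le> \<delta>" for m z
    using diff[OF inU[OF that(2)]] that(1)
    by (auto simp: D_def less_Suc_eq numeral_2_eq_2 DERIV_deriv_iff_real_differentiable)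
  have main: "\<bar>g (x + y) - (g x + deriv g x * y + deriv (deriv g) x / 2 * y\<^sup>2)\<bar> \<le> \<bar>K\<bar> * \<bar>y\<bar> powr (2 + q)" if y: "\<bar>y\<bar> \<le> \<delta>" for y
  proof (cases "y = 0")
    case False
    have "\<exists>z. (if x + y < x then x + y < z \<and> z < x else x < z \<and> z < x + y) \<and>
        g (x + y) = (\<Sum>m<2. D m x / fact m * (x + y - x) ^ m) + D 2 z / fact 2 * (x + y - x) ^ 2"
    proof (rule Taylor[where a = "x - \<delta>" and b = "x + \<delta>"])
      show "D 0 = g" by (simp add: D_def)
      show "\<forall>m t. m < 2 \<and> x - \<delta> \<le> t \<and> t \<le> x + \<delta> \<longrightarrow> DERIV (D m) t :> D (Suc m) t"
        using D by (auto simp: abs_le_iff)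
    qed (use y False in auto)
    then obtain z where between: "if x + y < x then x + y < z \<and> z < x else x < z \<and> z < x + y"
      and eq: "g (x + y) = (\<Sum>m<2. D m x / fact m * (x + y - x) ^ m) + D 2 z / fact 2 * (x + y - x) ^ 2"
      by blast
    have z: "\<bar>z - x\<bar> \<le> \<bar>y\<bar>"
      using between by (auto split: if_splits)
    have "g (x + y) - (g x + deriv g x * y + deriv (deriv g) x / 2 * y\<^sup>2)
        = (deriv (deriv g) z - deriv (deriv g) x) / 2 * y\<^sup>2"
      unfolding eq by (simp add: D_def numeral_2_eq_2 field_simps)
    also have "\<bar>\<dots>\<bar> = \<bar>deriv (deriv g) z - deriv (deriv g) x\<bar> / 2 * y\<^sup>2"
      by (simp add: abs_mult)
    also have "\<dots> \<le> (\<bar>K\<bar> * \<bar>y\<bar> powr q) * y\<^sup>2"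
    proof (rule mult_right_mono)
      have "\<bar>deriv (deriv g) z - deriv (deriv g) x\<bar> \<le> K * \<bar>z - x\<bar> powr q"
        using y z by (intro K inU) (auto simp: \<delta>_def e(1) less_imp_le)
      also have "\<dots> \<le> \<bar>K\<bar> * \<bar>y\<bar> powr q"
        using z assms(2) by (intro mult_mono powr_mono2) auto
      finally show "\<bar>deriv (deriv g) z - deriv (deriv g) x\<bar> / 2 \<le> \<bar>K\<bar> * \<bar>y\<bar> powr q"
        by simp
    qed simp
    also have "\<dots> = \<bar>K\<bar> * \<bar>y\<bar> powr (2 + q)"
      using False by (simp add: powr_add powr_numeral)
    finally show ?thesis .
  qed simp
  show ?thesis
    by (rule that[of \<delta> "\<bar>K\<bar>"]) (use e main in \<open>auto simp: \<delta>_def\<close>)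
qed

section \<open>Contribution of a single well\<close>

definition well_scale :: "real \<Rightarrow> nat \<Rightarrow> real" where
  "well_scale \<beta> n = sqrt (4 / (\<beta> * (real n - 2)))"

text \<open>For positive \<beta> and \<open>n >= 3\<close>, the integral over the whole space of
  \<open>pair_const\<close> times the Gaussian factor alone, without the corrections from
  \<open>S\<close> and \<open>Q\<close>.\<close>

definition well_mass :: "real \<Rightarrow> nat \<Rightarrow> real" where
  "well_mass \<beta> n = pair_const n \<beta> * sqrt (2 * pi * (well_scale \<beta> n)\<^sup>2) ^ n"

text \<open>For \<beta> > 0 and \<open>n >= 3\<close>, the value \<open>exp (- \<beta> c)\<close>
  with \<open>c\<close> the mean of \<open>Q\<close>, times the mean of
  \<open>exp (- \<beta> S^2 / 8)\<close>. It is left unevaluated because it cancels in the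
  quotient.\<close>

definition well_amplitude :: "real \<Rightarrow> nat \<Rightarrow> real" where
  "well_amplitude \<beta> n = exp (- (\<beta> * (real (n * (n - 1)) / 2 * quartic_mean (well_scale \<beta> n)))) / sqrt (1 + real n / (real n - 2))"

lemma abs_diff_le_of_well: "x \<in> well s \<Longrightarrow> \<bar>x - s\<bar> \<le> pi / 2"
  unfolding well_def by (intro abs_leI) auto

lemma well_scale_pos: "0 < \<beta> \<Longrightarrow> 3 \<le> n \<Longrightarrow> 0 < well_scale \<beta> n"
  by (simp add: well_scale_def)

lemma well_scale_square: "0 < \<beta> \<Longrightarrow> 3 \<le> n \<Longrightarrow> (well_scale \<beta> n)\<^sup>2 = 4 / (\<beta> * (real n - 2))"
  by (simp add: well_scale_def)

lemma well_scale_square_le: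
  assumes "0 < \<beta>" "4 \<le> n"
  shows "(well_scale \<beta> n)\<^sup>2 \<le> 8 / \<beta> * (1 / n)"
proof -
  have "n \<le> 2 * (real n - 2)" using assms by simp
  then show ?thesis using assms by (simp add: well_scale_square field_simps)
qed

lemma well_mass_pos: "0 < \<beta> \<Longrightarrow> 3 \<le> n \<Longrightarrow> 0 < well_mass \<beta> n"
  unfolding well_mass_def using well_scale_pos[of \<beta> n] by (intro mult_pos_pos pair_const_pos zero_less_power) auto

text \<open>\<open>quartic_part (y / 2) <= y^4 / 32\<close>, and the fourth moment at variance
  \<open>2 \<sigma>^2\<close> is \<open>12 \<sigma>^4\<close>.\<close>

lemma quartic_mean_bounds:
  assumes "0 < \<sigma>"
  shows "0 \<le> quartic_mean \<sigma>" "quartic_mean \<sigma> \<le> 3 / 8 * \<sigma> ^ 4"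
proof -
  let ?\<tau> = "sqrt 2 * \<sigma>"
  show "0 \<le> quartic_mean \<sigma>"
    unfolding quartic_mean_def by (intro integral_nonneg_AE AE_I2) (auto simp: quartic_part_bounds)
  have i4: "integrable lborel (\<lambda>y. normal_density 0 ?\<tau> y * y ^ 4)"
    using integrable_normal_moment[of ?\<tau> 0 4] assms by simp
  have le: "normal_density 0 ?\<tau> y * quartic_part (y / 2) \<le> normal_density 0 ?\<tau> y * y ^ 4 / 32" for y
    using mult_left_mono[OF quartic_part_bounds(2)[of "y / 2"] normal_density_nonneg[of 0 ?\<tau> y]]
    by (simp add: power_divide)
  have "quartic_mean \<sigma> \<le> (\<integral>y. normal_density 0 ?\<tau> y * y ^ 4 / 32 \<partial>lborel)"
    unfolding quartic_mean_def
  proof (rule integral_mono)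
    show "integrable lborel (\<lambda>y. normal_density 0 ?\<tau> y * quartic_part (y / 2))"
      by (rule Bochner_Integration.integrable_bound[of _ "\<lambda>y. normal_density 0 ?\<tau> y * y ^ 4 / 32"])
        (use i4 le in \<open>auto simp: quartic_part_bounds intro!: AE_I2\<close>)
  qed (use i4 le in auto)
  also have "\<dots> = 3 / 8 * \<sigma> ^ 4"
    using integral_normal_moment_even[of ?\<tau> 0 2] assms
    by (simp add: fact_numeral power_mult_distrib power_divide)
  finally show "quartic_mean \<sigma> \<le> 3 / 8 * \<sigma> ^ 4" .
qed

text \<open>With \<open>\<sigma>^2 <= 8 / (\<beta> n)\<close> the mean of \<open>Q\<close> is at
  most \<open>n^2/2 * 3/8 * 64 / (\<beta> n)^2 = 12 / \<beta>^2\<close>, uniformly in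
  \<open>n\<close>; and \<open>n / (n - 2) <= 2\<close> gives the \<open>sqrt 3\<close>. The lower
  bound permits division by the amplitude, the upper one keeps the additive error small.\<close>

lemma well_amplitude_bounds:
  assumes "0 < \<beta>" "4 \<le> n"
  shows "well_amplitude \<beta> n \<le> 1" "exp (- (12 / \<beta>)) / sqrt 3 \<le> well_amplitude \<beta> n"
proof -
  let ?c = "real (n * (n - 1)) / 2 * quartic_mean (well_scale \<beta> n)"
  have \<sigma>: "0 < well_scale \<beta> n" using assms by (intro well_scale_pos) auto
  have r: "0 \<le> real n / (real n - 2)" "real n / (real n - 2) \<le> 2"
    using assms by (auto simp: field_simps)
  have c0: "0 \<le> ?c" using quartic_mean_bounds(1)[OF \<sigma>] by simp
  have "?c \<le> real n ^ 2 / 2 * (3 / 8 * (8 / \<beta> * (1 / n))\<^sup>2)"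
  proof (intro mult_mono quartic_mean_bounds(1)[OF \<sigma>])
    show "quartic_mean (well_scale \<beta> n) \<le> 3 / 8 * (8 / \<beta> * (1 / n))\<^sup>2"
    proof -
      have "(well_scale \<beta> n) ^ 4 = ((well_scale \<beta> n)\<^sup>2)\<^sup>2" by (simp flip: power_mult)
      also have "\<dots> \<le> (8 / \<beta> * (1 / n))\<^sup>2"
        using well_scale_square_le[OF assms] by (intro power_mono) auto
      finally show ?thesis using quartic_mean_bounds(2)[OF \<sigma>] by linarith
    qed
    have "n * (n - 1) \<le> n ^ 2" by (simp add: power2_eq_square)
    then have "real (n * (n - 1)) \<le> real (n ^ 2)" by (simp only: of_nat_le_iff)
    then show "real (n * (n - 1)) / 2 \<le> real n ^ 2 / 2" by simp
  qed auto
  also have "\<dots> = 12 / \<beta>\<^sup>2" using assms by (simp add: power2_eq_square field_simps)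
  finally have "\<beta> * ?c \<le> \<beta> * (12 / \<beta>\<^sup>2)" using assms by (intro mult_left_mono) auto
  then have c1: "\<beta> * ?c \<le> 12 / \<beta>" using assms by (simp add: power2_eq_square)
  show "well_amplitude \<beta> n \<le> 1"
  proof -
    have "0 \<le> \<beta> * ?c" using c0 assms by simp
    then have "exp (- (\<beta> * ?c)) \<le> 1" by simp
    also have "1 \<le> sqrt (1 + real n / (real n - 2))"
      using r(1) by (intro real_le_rsqrt, unfold power_one) linarith
    finally show ?thesis
      unfolding well_amplitude_def using r(1) by (subst divide_le_eq_1_pos) (simp_all add: add_pos_nonneg del: of_nat_mult)
  qed
  show "exp (- (12 / \<beta>)) / sqrt 3 \<le> well_amplitude \<beta> n"
    unfolding well_amplitude_def using c1 r by (intro frac_le) auto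
qed

lemma measurable_mirror_weight_lebesgue:
  "mirror_weight n \<beta> \<in> borel_measurable (\<Pi>\<^sub>M j\<in>{1..n}. lebesgue)"
  unfolding mirror_weight_def
proof (intro borel_measurable_prod)
  fix j k assume "j \<in> {1..n}" "k \<in> {j+1..n}"
  then have *: "j \<in> {1..n}" "k \<in> {1..n}" by auto
  have [measurable]: "(\<lambda>\<theta>. \<theta> i) \<in> borel_measurable (\<Pi>\<^sub>M j\<in>{1..n}. lebesgue :: real measure)" if "i \<in> {1..n}" for i
    by (rule measurable_compose[where f = "\<lambda>x. x i" and g = "\<lambda>x. x" and N = lebesgue])
      (use that measurable_id_lebesgue in \<open>auto intro: measurable_component_singleton\<close>)
  note [measurable] = this[OF *(1)] this[OF *(2)]
  show "(\<lambda>\<theta>. norm (exp (\<i> * of_real (\<theta> j)) - exp (- (\<i> * of_real (\<theta> k)))) powr \<beta>)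
     \<in> borel_measurable (\<Pi>\<^sub>M j\<in>{1..n}. lebesgue)"
    by measurable
qed

lemma measurable_sum_lebesgue:
  fixes g :: "real \<Rightarrow> real"
  assumes "g \<in> borel_measurable lebesgue"
  shows "(\<lambda>\<theta>. \<Sum>j=1..n. g (\<theta> j)) \<in> borel_measurable (\<Pi>\<^sub>M j\<in>{1..n}. lebesgue)"
proof (rule borel_measurable_sum)
  fix j assume "j \<in> {1..n}"
  then show "(\<lambda>\<theta>. g (\<theta> j)) \<in> borel_measurable (\<Pi>\<^sub>M j\<in>{1..n}. lebesgue)"
    by (intro measurable_compose[where f = "\<lambda>x. x j" and g = g and N = lebesgue, OF _ assms]
        measurable_component_singleton)
qed

lemma sets_gaussian_cloud: "sets (gaussian_cloud n \<mu> \<sigma>) = sets (\<Pi>\<^sub>M j\<in>{1..n}. lebesgue)"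
  unfolding gaussian_cloud_def by (intro sets_PiM_cong) auto

text \<open>Dividing the weight by the unnormalised Gaussian leaves a factor \<open>V\<close> that
  is at most 1 on the whole well, by the global upper bound, and is known exactly within \<delta> of
  the centre. These are the two properties that the abstract comparison asks for.\<close>

lemma one_well_integral:
  fixes g :: "real \<Rightarrow> real"
  assumes \<beta>: "0 < \<beta>" and n: "4 \<le> n" and s: "s = pi / 2 \<or> s = - (pi / 2)"
    and g: "g \<in> borel_measurable lebesgue"
    and \<delta>: "0 < \<delta>" "\<delta> \<le> 1 / 2" and C: "0 \<le> C" and q: "0 < q" "q \<le> 1"
    and taylor: "\<And>y. \<bar>y\<bar> \<le> \<delta> \<Longrightarrow> \<bar>g (s + y) - (g0 + g1 * y + g2 / 2 * y\<^sup>2)\<bar> \<le> C * \<bar>y\<bar> powr (2 + q)"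
  defines "\<sigma> \<equiv> well_scale \<beta> n"
  shows "norm ((\<integral>\<theta>. of_real (\<Prod>j\<in>{1..n}. indicator (well s) (\<theta> j))
            * (of_real (mirror_weight n \<beta> \<theta>) * iexp (t * (\<Sum>j=1..n. g (\<theta> j)))) \<partial>torus_measure n) / of_real (well_mass \<beta> n)
          - of_real (well_amplitude \<beta> n) * iexp (t * (n * g0 + 2 * g2 / \<beta>))
           * of_real (exp (- ((t * g1)\<^sup>2 / \<beta> * (n / (real n - 1))))))
    \<le> \<beta> * (11 * sqrt n ^ 3 * \<sigma> ^ 4)
      + \<bar>t\<bar> * (\<bar>g2\<bar> / 2 * (14 * sqrt n * \<sigma>\<^sup>2 + \<bar>real n * \<sigma>\<^sup>2 - 4 / \<beta>\<bar>) + C * (n * (4 * \<sigma> powr (2 + q))))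
      + 2 * (n * (3 * \<sigma> ^ 4)) / \<delta> ^ 4"
proof -
  have \<sigma>: "0 < \<sigma>" unfolding \<sigma>_def using \<beta> n by (intro well_scale_pos) auto
  have \<sigma>2: "\<sigma>\<^sup>2 = 4 / (\<beta> * (real n - 2))" unfolding \<sigma>_def using \<beta> n by (intro well_scale_square) auto
  define P where "P = gaussian_cloud n s \<sigma>"
  define M2 where "M2 \<theta> = (\<Sum>j=1..n. (\<theta> j - s)\<^sup>2)" for \<theta> :: "nat \<Rightarrow> real"
  define S where "S \<theta> = (\<Sum>j=1..n. \<theta> j - s)" for \<theta> :: "nat \<Rightarrow> real"
  define V where "V \<theta> = mirror_weight n \<beta> \<theta> / (pair_const n \<beta> * exp (- (\<beta> / 8) * ((real n - 2) * M2 \<theta>)))" for \<theta>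
  define F where "F \<theta> = of_real (V \<theta>) * iexp (t * (\<Sum>j=1..n. g (\<theta> j)))" for \<theta>
  define F' where "F' \<theta> = of_real (\<Prod>j\<in>{1..n}. indicator (well s) (\<theta> j)) * F \<theta>" for \<theta>
  interpret G: gaussian_sample P "\<lambda>j \<theta>. \<theta> j - s" n \<sigma>
    unfolding P_def using n \<sigma> by (intro gaussian_sample_cloud) auto
  have comp: "(\<lambda>\<theta>. \<theta> j) \<in> (\<Pi>\<^sub>M j\<in>{1..n}. lebesgue :: real measure) \<rightarrow>\<^sub>M lebesgue" if "j \<in> {1..n}" for j
    using that by (rule measurable_component_singleton)
  have mM2: "M2 \<in> borel_measurable (\<Pi>\<^sub>M j\<in>{1..n}. lebesgue)"
  proof -
    have "(\<lambda>x::real. (x - s)\<^sup>2) \<in> borel_measurable lebesgue"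
      by (intro measurable_completion) simp
    then show ?thesis unfolding M2_def[abs_def] by (rule measurable_sum_lebesgue)
  qed
  have mF: "F \<in> borel_measurable (\<Pi>\<^sub>M j\<in>{1..n}. lebesgue)"
  proof -
    note [measurable] = mM2 measurable_mirror_weight_lebesgue[of n \<beta>] measurable_sum_lebesgue[OF g, of n]
    show ?thesis unfolding F_def[abs_def] V_def by measurable
  qed
  have mI: "(\<lambda>\<theta>. \<Prod>j\<in>{1..n}. indicator (well s) (\<theta> j) :: real) \<in> borel_measurable (\<Pi>\<^sub>M j\<in>{1..n}. lebesgue)"
  proof (rule borel_measurable_prod)
    fix j assume j: "j \<in> {1..n}"
    show "(\<lambda>\<theta>. indicator (well s) (\<theta> j) :: real) \<in> borel_measurable (\<Pi>\<^sub>M j\<in>{1..n}. lebesgue)"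
      by (rule measurable_compose[OF comp[OF j]]) simp
  qed
  have mF': "F' \<in> borel_measurable P"
    unfolding P_def measurable_cong_sets[OF sets_gaussian_cloud refl] F'_def[abs_def]
    using mF mI by (intro borel_measurable_times borel_measurable_of_real) auto
  have ind: "(\<Prod>j\<in>{1..n}. indicator (well s) (\<theta> j)) = (if \<forall>j\<in>{1..n}. \<theta> j \<in> well s then 1 else (0::real))" for \<theta>
    by (auto simp: indicator_def)
  have "(\<integral>\<theta>. of_real (\<Prod>j\<in>{1..n}. indicator (well s) (\<theta> j))
            * (of_real (mirror_weight n \<beta> \<theta>) * iexp (t * (\<Sum>j=1..n. g (\<theta> j)))) \<partial>torus_measure n)
      = (\<integral>\<theta>. of_real (well_mass \<beta> n) * (of_real (\<Prod>j\<in>{1..n}. indicator (well s) (\<theta> j) * normal_density s \<sigma> (\<theta> j)) * F \<theta>) \<partial>torus_measure n)"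
  proof (intro Bochner_Integration.integral_cong refl)
    fix \<theta> :: "nat \<Rightarrow> real"
    define c where "c = sqrt (2 * pi * \<sigma>\<^sup>2)"
    have c: "0 < c" unfolding c_def using \<sigma> by simp
    have "(\<Prod>j\<in>{1..n}. normal_density s \<sigma> (\<theta> j)) = (\<Prod>j\<in>{1..n}. (1 / c) * exp (- (\<beta> / 8) * (real n - 2) * (\<theta> j - s)\<^sup>2))"
      unfolding normal_density_def c_def \<sigma>2 using \<beta> n by (intro prod.cong refl) (simp add: field_simps)
    also have "\<dots> = (1 / c) ^ n * exp (- (\<beta> / 8) * (real n - 2) * M2 \<theta>)"
      unfolding prod.distrib M2_def sum_distrib_left by (subst exp_sum) auto
    finally have nd: "(\<Prod>j\<in>{1..n}. normal_density s \<sigma> (\<theta> j)) = (1 / c) ^ n * exp (- (\<beta> / 8) * ((real n - 2) * M2 \<theta>))"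
      by (simp add: mult.assoc)
    have "mirror_weight n \<beta> \<theta> = well_mass \<beta> n * ((\<Prod>j\<in>{1..n}. normal_density s \<sigma> (\<theta> j)) * V \<theta>)"
      unfolding nd V_def well_mass_def \<sigma>_def[symmetric] c_def[symmetric]
      using pair_const_pos[of n \<beta>] c by (simp add: power_one_over)
    then show "of_real (\<Prod>j\<in>{1..n}. indicator (well s) (\<theta> j)) * (of_real (mirror_weight n \<beta> \<theta>) * iexp (t * (\<Sum>j=1..n. g (\<theta> j))))
        = of_real (well_mass \<beta> n) * (of_real (\<Prod>j\<in>{1..n}. indicator (well s) (\<theta> j) * normal_density s \<sigma> (\<theta> j)) * F \<theta>)"
      unfolding F_def by (simp only: prod.distrib of_real_mult mult_ac)
  qed
  also have "\<dots> = of_real (well_mass \<beta> n) * G.expectation F'"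
    using torus_well_transfer[OF s \<sigma> mF] by (simp only: integral_mult_right_zero F'_def[abs_def] P_def)
  finally have int: "(\<integral>\<theta>. of_real (\<Prod>j\<in>{1..n}. indicator (well s) (\<theta> j))
            * (of_real (mirror_weight n \<beta> \<theta>) * iexp (t * (\<Sum>j=1..n. g (\<theta> j)))) \<partial>torus_measure n) / of_real (well_mass \<beta> n)
          = G.expectation F'"
    using well_mass_pos[of \<beta> n] \<beta> n by simp
  have d: "1 + \<beta> * (real n * \<sigma>\<^sup>2) / 4 = 1 + real n / (real n - 2)"
    unfolding \<sigma>2 using \<beta> n by (simp add: field_simps)
  \<comment> \<open>Under the damping \<open>S\<close> has variance
    \<open>n \<sigma>^2 / d = 2 n / (\<beta> (n - 1))\<close>, and half of it enters the
    characteristic function.\<close>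
  have frac: "(t * g1)\<^sup>2 * (real n * \<sigma>\<^sup>2) / (2 * (1 + real n / (real n - 2))) = (t * g1)\<^sup>2 / \<beta> * (n / (real n - 1))"
  proof -
    define m where "m = real n - 1"
    have "1 + real n / (real n - 2) = 2 * m / (real n - 2)" using n by (simp add: m_def field_simps)
    moreover have "0 < m" using n by (simp add: m_def)
    ultimately show ?thesis unfolding \<sigma>2 m_def[symmetric] using \<beta> n by simp
  qed
  have "norm (G.expectation F' - of_real (exp (- (\<beta> * (real (n * (n - 1)) / 2 * quartic_mean \<sigma>)))) * iexp (t * (n * g0 + 2 * g2 / \<beta>))
           * of_real (1 / sqrt (1 + \<beta> * (real n * \<sigma>\<^sup>2) / 4) * exp (- ((t * g1)\<^sup>2 * (real n * \<sigma>\<^sup>2) / (2 * (1 + \<beta> * (real n * \<sigma>\<^sup>2) / 4))))))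
    \<le> \<beta> * (11 * sqrt n ^ 3 * \<sigma> ^ 4)
      + \<bar>t\<bar> * (\<bar>g2\<bar> / 2 * (14 * sqrt n * \<sigma>\<^sup>2 + \<bar>real n * \<sigma>\<^sup>2 - 4 / \<beta>\<bar>) + C * (n * (4 * \<sigma> powr (2 + q))))
      + 2 * (n * (3 * \<sigma> ^ 4)) / \<delta> ^ 4"
  proof (rule G.one_well_expectation[where G = "\<lambda>\<theta>. \<Sum>j=1..n. g (\<theta> j)"])
    show "norm (F' \<theta>) \<le> 1" for \<theta>
    proof (cases "\<forall>j\<in>{1..n}. \<theta> j \<in> well s")
      case True
      have "mirror_weight n \<beta> \<theta> \<le> pair_const n \<beta> * exp (- (\<beta>/8) * ((real n - 2) * M2 \<theta> + (S \<theta>)\<^sup>2))"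
        unfolding M2_def S_def using True by (intro mirror_weight_one_well_le \<beta> s abs_diff_le_of_well) auto
      also have "\<dots> \<le> pair_const n \<beta> * exp (- (\<beta>/8) * ((real n - 2) * M2 \<theta>))"
        using \<beta> pair_const_pos[of n \<beta>] by (intro mult_left_mono) (auto simp: algebra_simps)
      finally have "V \<theta> \<le> 1" "0 \<le> V \<theta>"
        unfolding V_def using pair_const_pos[of n \<beta>] mirror_weight_nonneg[of n \<beta> \<theta>]
        by (auto simp: divide_le_eq_1_pos)
      then show ?thesis
        unfolding F'_def F_def norm_mult norm_exp_i_times ind using True by simp
    next
      case False
      then show ?thesis unfolding F'_def ind by auto
    qed
    fix \<theta> assume x: "\<And>j. j \<in> {1..n} \<Longrightarrow> \<bar>\<theta> j - s\<bar> \<le> \<delta>"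
    have "\<theta> j \<in> well s" if "j \<in> {1..n}" for j
    proof -
      have "\<bar>\<theta> j - s\<bar> \<le> 1 / 2" using x[OF that] \<delta> by simp
      moreover have "1 / 2 < pi / 2" using pi_gt3 by simp
      ultimately show ?thesis unfolding well_def greaterThanAtMost_iff by linarith
    qed
    moreover have "V \<theta> = exp (- (\<beta> / 8) * (S \<theta>)\<^sup>2 - \<beta> * (\<Sum>j=1..n. \<Sum>k=j+1..n. quartic_part (((\<theta> j - s) + (\<theta> k - s)) / 2)))"
    proof -
      have "mirror_weight n \<beta> \<theta> = pair_const n \<beta>
         * exp (- (\<beta>/8) * ((real n - 2) * M2 \<theta> + (S \<theta>)\<^sup>2)
            - \<beta> * (\<Sum>j=1..n. \<Sum>k=j+1..n. quartic_part (((\<theta> j - s) + (\<theta> k - s)) / 2)))"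
        unfolding M2_def S_def by (rule mirror_weight_one_well_eq[OF s order_trans[OF x \<delta>(2)]])
      also have "\<dots> = (pair_const n \<beta> * exp (- (\<beta>/8) * ((real n - 2) * M2 \<theta>)))
          * exp (- (\<beta> / 8) * (S \<theta>)\<^sup>2 - \<beta> * (\<Sum>j=1..n. \<Sum>k=j+1..n. quartic_part (((\<theta> j - s) + (\<theta> k - s)) / 2)))"
        unfolding mult.assoc exp_add[symmetric] by (simp add: algebra_simps)
      finally show ?thesis unfolding V_def using pair_const_pos[of n \<beta>] by simp
    qed
    ultimately show "F' \<theta> = of_real (exp (- (\<beta> / 8) * (\<Sum>j=1..n. \<theta> j - s)\<^sup>2
        - \<beta> * (\<Sum>j=1..n. \<Sum>k=j+1..n. quartic_part (((\<theta> j - s) + (\<theta> k - s)) / 2)))) * iexp (t * (\<Sum>j=1..n. g (\<theta> j)))"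
      unfolding F'_def F_def ind by (simp add: S_def)
    have "(\<Sum>j=1..n. g (\<theta> j)) - (n * g0 + g1 * (\<Sum>j=1..n. \<theta> j - s) + g2 / 2 * (\<Sum>j=1..n. (\<theta> j - s)\<^sup>2))
        = (\<Sum>j=1..n. g (s + (\<theta> j - s)) - (g0 + g1 * (\<theta> j - s) + g2 / 2 * (\<theta> j - s)\<^sup>2))"
      by (simp only: sum_subtractf sum.distrib sum_distrib_left[symmetric]) simp
    also have "\<bar>\<dots>\<bar> \<le> (\<Sum>j=1..n. C * \<bar>\<theta> j - s\<bar> powr (2 + q))"
      using x taylor by (intro order_trans[OF sum_abs] sum_mono) blast
    finally show "\<bar>(\<Sum>j=1..n. g (\<theta> j)) - (n * g0 + g1 * (\<Sum>j=1..n. \<theta> j - s) + g2 / 2 * (\<Sum>j=1..n. (\<theta> j - s)\<^sup>2))\<bar>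
        \<le> C * (\<Sum>j=1..n. \<bar>\<theta> j - s\<bar> powr (2 + q))"
      by (simp only: sum_distrib_left)
  qed (use n \<beta> \<delta> q C mF' in auto)
  then show ?thesis
    unfolding int d frac by (simp add: well_amplitude_def \<sigma>_def)
qed

text \<open>With \<open>\<sigma>^2 <= 8 / (\<beta> n)\<close> every term is of order
  \<open>n^(-1/2)\<close>, \<open>n^(-q/2)\<close> or \<open>1/n\<close>, and \<open>q <= 1\<close>
  makes \<open>n^(-q/2)\<close> the slowest. The numerals are \<open>704 = 11 * 64\<close>,
  \<open>128 = 112 + 16\<close> and \<open>384 = 6 * 64\<close>.\<close>

lemma one_well_error_le:
  assumes \<beta>: "0 < \<beta>" and n: "4 \<le> n" and q: "0 < q" "q \<le> 1" and \<delta>: "0 < \<delta>" and C: "0 \<le> C"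
  defines "\<sigma> \<equiv> well_scale \<beta> n"
  shows "\<beta> * (11 * sqrt n ^ 3 * \<sigma> ^ 4)
      + \<bar>t\<bar> * (\<bar>g2\<bar> / 2 * (14 * sqrt n * \<sigma>\<^sup>2 + \<bar>real n * \<sigma>\<^sup>2 - 4 / \<beta>\<bar>) + C * (n * (4 * \<sigma> powr (2 + q))))
      + 2 * (n * (3 * \<sigma> ^ 4)) / \<delta> ^ 4
    \<le> (704 / \<beta> + \<bar>t\<bar> * (\<bar>g2\<bar> / 2 * (128 / \<beta>) + C * (4 * (8 / \<beta>) powr (1 + q / 2))) + 384 / (\<beta>\<^sup>2 * \<delta> ^ 4)) * n powr (- (q / 2))"
proof -
  define p where "p = real n powr (- (q / 2))"
  have n0: "0 < real n" using n by simp
  have \<sigma>: "0 < \<sigma>" unfolding \<sigma>_def using \<beta> n by (intro well_scale_pos) auto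
  have s2: "\<sigma>\<^sup>2 \<le> 8 / \<beta> * (1 / n)" unfolding \<sigma>_def by (rule well_scale_square_le[OF \<beta> n])
  have s4: "\<sigma> ^ 4 \<le> 64 / \<beta>\<^sup>2 * (1 / n) ^ 2"
  proof -
    have "\<sigma> ^ 4 = (\<sigma>\<^sup>2)\<^sup>2" by (simp flip: power_mult)
    also have "\<dots> \<le> (8 / \<beta> * (1 / n))\<^sup>2" using s2 by (intro power_mono) auto
    finally show ?thesis by (simp add: power_divide power_mult_distrib)
  qed
  have p1: "1 / sqrt n \<le> p"
  proof -
    have "1 / sqrt n = real n powr (- (1 / 2))"
      using n0 by (simp add: powr_minus powr_half_sqrt inverse_eq_divide)
    also have "\<dots> \<le> p" unfolding p_def using n q by (intro powr_mono) auto
    finally show ?thesis .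
  qed
  have p2: "1 / real n \<le> p"
  proof -
    have "1 / real n = real n powr (- 1)" using n0 by (simp add: powr_minus_divide)
    also have "\<dots> \<le> p" unfolding p_def using n q by (intro powr_mono) auto
    finally show ?thesis .
  qed
  have t1: "\<beta> * (11 * sqrt n ^ 3 * \<sigma> ^ 4) \<le> 704 / \<beta> * p"
  proof -
    have "\<beta> * (11 * sqrt n ^ 3 * \<sigma> ^ 4) \<le> \<beta> * (11 * sqrt n ^ 3 * (64 / \<beta>\<^sup>2 * (1 / n) ^ 2))"
      using \<beta> s4 by (intro mult_left_mono) auto
    also have "\<dots> = 704 / \<beta> * (1 / sqrt n)"
    proof -
      have "sqrt n ^ 3 * (1 / real n) ^ 2 = 1 / sqrt n"
        using n0 by (simp add: power2_eq_square power3_eq_cube field_simps)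
      then have "\<beta> * (11 * sqrt n ^ 3 * (64 / \<beta>\<^sup>2 * (1 / n) ^ 2)) = \<beta> * 704 / \<beta>\<^sup>2 * (1 / sqrt n)"
        by (simp only: mult_ac times_divide_eq_right times_divide_eq_left)
      then show ?thesis using \<beta> by (simp add: power2_eq_square)
    qed
    also have "\<dots> \<le> 704 / \<beta> * p" using p1 \<beta> by (intro mult_left_mono) auto
    finally show ?thesis .
  qed
  have t2: "14 * sqrt n * \<sigma>\<^sup>2 \<le> 112 / \<beta> * p"
  proof -
    have "14 * sqrt n * \<sigma>\<^sup>2 \<le> 14 * sqrt n * (8 / \<beta> * (1 / n))"
      using s2 by (intro mult_left_mono) auto
    also have "\<dots> = 112 / \<beta> * (1 / sqrt n)"
      using n0 \<beta> by (simp add: field_simps)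
    also have "\<dots> \<le> 112 / \<beta> * p" using p1 \<beta> by (intro mult_left_mono) auto
    finally show ?thesis .
  qed
  have t3: "\<bar>real n * \<sigma>\<^sup>2 - 4 / \<beta>\<bar> \<le> 16 / \<beta> * p"
  proof -
    have "real n * \<sigma>\<^sup>2 - 4 / \<beta> = 2 * \<sigma>\<^sup>2"
      unfolding \<sigma>_def using \<beta> n by (subst (1 2) well_scale_square) (auto simp: field_simps)
    then have "\<bar>real n * \<sigma>\<^sup>2 - 4 / \<beta>\<bar> = 2 * \<sigma>\<^sup>2" by simp
    also have "\<dots> \<le> 2 * (8 / \<beta> * (1 / n))" using s2 by simp
    also have "\<dots> \<le> 2 * (8 / \<beta> * p)" using p2 \<beta> by (intro mult_left_mono) auto
    finally show ?thesis by simp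
  qed
  have t4: "n * (4 * \<sigma> powr (2 + q)) \<le> 4 * (8 / \<beta>) powr (1 + q / 2) * p"
  proof -
    have "\<sigma> powr (2 + q) = (\<sigma>\<^sup>2) powr (1 + q / 2)"
      using \<sigma> by (simp add: powr_powr flip: powr_numeral)
    also have "\<dots> \<le> (8 / \<beta> * (1 / n)) powr (1 + q / 2)"
      using s2 q by (intro powr_mono2) auto
    also have "\<dots> = (8 / \<beta>) powr (1 + q / 2) * (1 / n) powr (1 + q / 2)"
      by (rule powr_mult)
    also have "(1 / n) powr (1 + q / 2) = (1 / n) * p"
      using n0 unfolding p_def by (simp add: powr_add powr_divide powr_minus_divide)
    finally have "n * (4 * \<sigma> powr (2 + q)) \<le> n * (4 * ((8 / \<beta>) powr (1 + q / 2) * ((1 / n) * p)))"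
      using n0 by (intro mult_left_mono) auto
    then show ?thesis using n0 by (simp add: mult.assoc)
  qed
  have t5: "2 * (n * (3 * \<sigma> ^ 4)) / \<delta> ^ 4 \<le> 384 / (\<beta>\<^sup>2 * \<delta> ^ 4) * p"
  proof -
    have "2 * (n * (3 * \<sigma> ^ 4)) / \<delta> ^ 4 \<le> 2 * (n * (3 * (64 / \<beta>\<^sup>2 * (1 / n) ^ 2))) / \<delta> ^ 4"
      using s4 \<delta> by (intro divide_right_mono mult_left_mono) auto
    also have "\<dots> = 384 / (\<beta>\<^sup>2 * \<delta> ^ 4) * (1 / n)" using n0 by (simp add: power2_eq_square field_simps)
    also have "\<dots> \<le> 384 / (\<beta>\<^sup>2 * \<delta> ^ 4) * p" using p2 \<delta> by (intro mult_left_mono) auto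
    finally show ?thesis .
  qed
  have "\<beta> * (11 * sqrt n ^ 3 * \<sigma> ^ 4)
      + \<bar>t\<bar> * (\<bar>g2\<bar> / 2 * (14 * sqrt n * \<sigma>\<^sup>2 + \<bar>real n * \<sigma>\<^sup>2 - 4 / \<beta>\<bar>) + C * (n * (4 * \<sigma> powr (2 + q))))
      + 2 * (n * (3 * \<sigma> ^ 4)) / \<delta> ^ 4
    \<le> 704 / \<beta> * p + \<bar>t\<bar> * (\<bar>g2\<bar> / 2 * (112 / \<beta> * p + 16 / \<beta> * p) + C * (4 * (8 / \<beta>) powr (1 + q / 2) * p))
      + 384 / (\<beta>\<^sup>2 * \<delta> ^ 4) * p"
    using C by (intro add_mono t1 t2 t3 t4 t5 mult_left_mono) auto
  also have "\<dots> = (704 / \<beta> + \<bar>t\<bar> * (\<bar>g2\<bar> / 2 * (128 / \<beta>) + C * (4 * (8 / \<beta>) powr (1 + q / 2))) + 384 / (\<beta>\<^sup>2 * \<delta> ^ 4)) * p"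
    by (simp add: algebra_simps)
  finally show ?thesis unfolding p_def .
qed

text \<open>What remains is to replace \<open>n / (n - 1)\<close> by 1 in the exponent, which costs
  \<open>t^2 / n\<close>. The constant is uniform in \<open>n\<close> and \<open>t\<close> with
  explicit growth in \<open>t\<close>, so that one estimate serves compact sets of \<open>t\<close>
  and the normalisation at \<open>t = 0\<close> alike.\<close>

lemma one_well_asymptotics:
  fixes g :: "real \<Rightarrow> real"
  assumes \<beta>: "0 < \<beta>" and s: "s = pi / 2 \<or> s = - (pi / 2)"
    and g: "g \<in> borel_measurable lebesgue" and q: "0 < q" "q \<le> 1" and C2: "C2_Hoelder_near q g s"
  shows "\<exists>K\<ge>0. \<forall>n\<ge>4. \<forall>t. norm ((\<integral>\<theta>. of_real (\<Prod>j\<in>{1..n}. indicator (well s) (\<theta> j))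
            * (of_real (mirror_weight n \<beta> \<theta>) * iexp (t * (\<Sum>j=1..n. g (\<theta> j)))) \<partial>torus_measure n) / of_real (well_mass \<beta> n)
          - of_real (well_amplitude \<beta> n) * (exp (of_nat n * \<i> * of_real t * of_real (g s)) *
             exp (- of_real ((deriv g s)\<^sup>2 / \<beta> * t\<^sup>2) + of_real (2 * deriv (deriv g) s / \<beta>) * \<i> * of_real t)))
      \<le> K * (1 + \<bar>t\<bar> + t\<^sup>2) * n powr (- (q / 2))"
proof -
  obtain \<delta> C where \<delta>: "0 < \<delta>" "\<delta> \<le> 1 / 2" and C: "0 \<le> C"
    and taylor: "\<And>y. \<bar>y\<bar> \<le> \<delta> \<Longrightarrow> \<bar>g (s + y) - (g s + deriv g s * y + deriv (deriv g) s / 2 * y\<^sup>2)\<bar> \<le> C * \<bar>y\<bar> powr (2 + q)"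
    using C2_Hoelder_near_taylor[OF C2 q(1)] by metis
  define g1 g2 where "g1 = deriv g s" and "g2 = deriv (deriv g) s"
  define K1 where "K1 = 704 / \<beta> + 384 / (\<beta>\<^sup>2 * \<delta> ^ 4)"
  define K2 where "K2 = \<bar>g2\<bar> / 2 * (128 / \<beta>) + C * (4 * (8 / \<beta>) powr (1 + q / 2))"
  define K3 where "K3 = 2 * g1\<^sup>2 / \<beta>"
  have K: "0 \<le> K1" "0 \<le> K2" "0 \<le> K3"
    using \<beta> \<delta> C unfolding K1_def K2_def K3_def by auto
  show ?thesis
  proof (intro exI[of _ "K1 + K2 + K3"] conjI allI impI)
    show "0 \<le> K1 + K2 + K3" using K by simp
    fix n :: nat and t :: real assume n: "4 \<le> n"
    define J where "J = (\<integral>\<theta>. of_real (\<Prod>j\<in>{1..n}. indicator (well s) (\<theta> j))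
            * (of_real (mirror_weight n \<beta> \<theta>) * iexp (t * (\<Sum>j=1..n. g (\<theta> j)))) \<partial>torus_measure n) / of_real (well_mass \<beta> n)"
    define A where "A = (of_real (well_amplitude \<beta> n) * iexp (t * (n * g s + 2 * g2 / \<beta>)) :: complex)"
    define e1 e2 where "e1 = exp (- ((t * g1)\<^sup>2 / \<beta> * (n / (real n - 1))))" and "e2 = exp (- ((t * g1)\<^sup>2 / \<beta>))"
    define p where "p = real n powr (- (q / 2))"
    have p: "0 \<le> p" unfolding p_def by simp
    have target: "of_real (well_amplitude \<beta> n) * (exp (of_nat n * \<i> * of_real t * of_real (g s)) *
             exp (- of_real ((deriv g s)\<^sup>2 / \<beta> * t\<^sup>2) + of_real (2 * deriv (deriv g) s / \<beta>) * \<i> * of_real t)) = A * of_real e2"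
    proof -
      have "A * of_real e2 = of_real (well_amplitude \<beta> n) * exp (\<i> * of_real (t * (n * g s + 2 * g2 / \<beta>)) + of_real (- ((t * g1)\<^sup>2 / \<beta>)))"
        unfolding A_def e2_def exp_add exp_of_real by (simp add: mult.assoc)
      also have "\<i> * of_real (t * (n * g s + 2 * g2 / \<beta>)) + of_real (- ((t * g1)\<^sup>2 / \<beta>))
          = of_nat n * \<i> * of_real t * of_real (g s) + (- of_real ((deriv g s)\<^sup>2 / \<beta> * t\<^sup>2) + of_real (2 * deriv (deriv g) s / \<beta>) * \<i> * of_real t)"
        by (simp add: g1_def g2_def algebra_simps power_mult_distrib)
      finally show ?thesis by (simp only: exp_add)
    qed
    have "norm (J - A * of_real e1) \<le> (704 / \<beta> + \<bar>t\<bar> * (\<bar>g2\<bar> / 2 * (128 / \<beta>) + C * (4 * (8 / \<beta>) powr (1 + q / 2))) + 384 / (\<beta>\<^sup>2 * \<delta> ^ 4)) * p"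
      unfolding J_def A_def e1_def p_def g1_def g2_def
      by (rule order_trans[OF one_well_integral[OF \<beta> n s g \<delta> C q taylor] one_well_error_le[OF \<beta> n q \<delta>(1) C]])
    also have "\<dots> = (K1 + K2 * \<bar>t\<bar>) * p"
      unfolding K1_def K2_def by (simp add: algebra_simps)
    finally have b1: "norm (J - A * of_real e1) \<le> (K1 + K2 * \<bar>t\<bar>) * p" .
    have A1: "norm A \<le> 1"
    proof -
      have "0 \<le> well_amplitude \<beta> n" using n by (auto simp: well_amplitude_def)
      then show ?thesis
        unfolding A_def norm_mult norm_exp_i_times using well_amplitude_bounds(1)[OF \<beta> n] by simp
    qed
    have n1: "1 / (real n - 1) \<le> 2 * p"
    proof -
      have "1 / (real n - 1) \<le> 2 * (1 / real n)" using n by (simp add: field_simps)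
      also have "1 / real n \<le> p"
      proof -
        have "1 / real n = real n powr (- 1)" using n by (simp add: powr_minus_divide)
        also have "\<dots> \<le> p" unfolding p_def using n q by (intro powr_mono) auto
        finally show ?thesis .
      qed
      finally show ?thesis by simp
    qed
    have b2: "norm (A * of_real e1 - A * of_real e2) \<le> K3 * t\<^sup>2 * p"
    proof -
      have "norm (A * of_real e1 - A * of_real e2) = norm A * norm (of_real e1 * iexp 0 - of_real e2 * iexp 0)"
        unfolding norm_mult[symmetric] by (simp add: algebra_simps)
      also have "\<dots> \<le> 1 * (\<bar>(t * g1)\<^sup>2 / \<beta> * (n / (real n - 1)) - (t * g1)\<^sup>2 / \<beta>\<bar> + \<bar>0 - 0\<bar>)"
        unfolding e1_def e2_def using \<beta> n A1 by (intro mult_mono norm_exp_iexp_diff_le) auto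
      also have "\<dots> = (t * g1)\<^sup>2 / \<beta> * (1 / (real n - 1))"
      proof -
        have "(t * g1)\<^sup>2 / \<beta> * (n / (real n - 1)) - (t * g1)\<^sup>2 / \<beta> = (t * g1)\<^sup>2 / \<beta> * (1 / (real n - 1))"
          using n \<beta> by (simp add: field_simps)
        moreover have "0 \<le> (t * g1)\<^sup>2 / \<beta> * (1 / (real n - 1))" using n \<beta> by simp
        ultimately show ?thesis by (simp only: abs_of_nonneg diff_self abs_zero add_0_right mult_1)
      qed
      also have "\<dots> \<le> (t * g1)\<^sup>2 / \<beta> * (2 * p)" using n1 \<beta> by (intro mult_left_mono) auto
      also have "\<dots> = K3 * t\<^sup>2 * p" unfolding K3_def by (simp add: power_mult_distrib)
      finally show ?thesis .
    qed
    have "norm (J - A * of_real e2) \<le> norm (J - A * of_real e1) + norm (A * of_real e1 - A * of_real e2)"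
      using norm_triangle_ineq[of "J - A * of_real e1" "A * of_real e1 - A * of_real e2"] by simp
    also have "\<dots> \<le> (K1 + K2 * \<bar>t\<bar> + K3 * t\<^sup>2) * p"
      using b1 b2 by (simp add: algebra_simps)
    also have "\<dots> \<le> ((K1 + K2 + K3) * (1 + \<bar>t\<bar> + t\<^sup>2)) * p"
    proof (rule mult_right_mono[OF _ p])
      have "0 \<le> K1 * (\<bar>t\<bar> + t\<^sup>2) + K2 * (1 + t\<^sup>2) + K3 * (1 + \<bar>t\<bar>)"
        using K by auto
      then show "K1 + K2 * \<bar>t\<bar> + K3 * t\<^sup>2 \<le> (K1 + K2 + K3) * (1 + \<bar>t\<bar> + t\<^sup>2)"
        by (simp add: algebra_simps)
    qed
    finally show "norm ((\<integral>\<theta>. of_real (\<Prod>j\<in>{1..n}. indicator (well s) (\<theta> j))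
            * (of_real (mirror_weight n \<beta> \<theta>) * iexp (t * (\<Sum>j=1..n. g (\<theta> j)))) \<partial>torus_measure n) / of_real (well_mass \<beta> n)
          - of_real (well_amplitude \<beta> n) * (exp (of_nat n * \<i> * of_real t * of_real (g s)) *
             exp (- of_real ((deriv g s)\<^sup>2 / \<beta> * t\<^sup>2) + of_real (2 * deriv (deriv g) s / \<beta>) * \<i> * of_real t)))
      \<le> (K1 + K2 + K3) * (1 + \<bar>t\<bar> + t\<^sup>2) * n powr (- (q / 2))"
      unfolding target J_def p_def .
  qed
qed

section \<open>Mixed configurations\<close>

lemma nn_integral_torus_le:
  assumes "f \<in> borel_measurable borel"
  shows "(\<integral>\<^sup>+x. f x \<partial>lebesgue_on {- pi<..pi}) \<le> (\<integral>\<^sup>+x. f x \<partial>lborel)"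
proof -
  have "(\<integral>\<^sup>+x. f x \<partial>lebesgue_on {- pi<..pi}) = (\<integral>\<^sup>+x. f x * indicator {- pi<..pi} x \<partial>lebesgue)"
    by (subst nn_integral_restrict_space) auto
  also have "\<dots> \<le> (\<integral>\<^sup>+x. f x \<partial>lebesgue)"
    by (intro nn_integral_mono) (auto split: split_indicator)
  finally show ?thesis by (simp add: nn_integral_completion)
qed

lemma nn_integral_gaussian:
  assumes "0 < a"
  shows "(\<integral>\<^sup>+x. ennreal (exp (- a * (x - s)\<^sup>2)) \<partial>lborel) = ennreal (sqrt (pi / a))"
proof -
  define v where "v = sqrt (1 / (2 * a))"
  have v: "0 < v" "v\<^sup>2 = 1 / (2 * a)" unfolding v_def using assms by auto
  have "exp (- a * (x - s)\<^sup>2) = sqrt (pi / a) * normal_density s v x" for x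
    using assms unfolding normal_density_def v(2) by (simp add: real_sqrt_divide)
  then have "(\<integral>\<^sup>+x. ennreal (exp (- a * (x - s)\<^sup>2)) \<partial>lborel) = (\<integral>\<^sup>+x. ennreal (sqrt (pi / a)) * ennreal (normal_density s v x) \<partial>lborel)"
    using assms by (simp add: ennreal_mult'')
  also have "\<dots> = ennreal (sqrt (pi / a)) * (\<integral>\<^sup>+x. ennreal (normal_density s v x) \<partial>lborel)"
    by (intro nn_integral_cmult) simp
  also have "(\<integral>\<^sup>+x. ennreal (normal_density s v x) \<partial>lborel) = 1"
    using v by (subst nn_integral_eq_integral) auto
  finally show ?thesis by simp
qed

text \<open>Bounds the price per angle of the minority well: \<open>sqrt (\<beta> n)\<close> for giving up its Gaussian decay, \<open>exp 14\<close> for the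
  weakened decay of the majority, and \<open>exp (- \<beta> n / 24)\<close> from at least \<open>n / 2\<close> cross interactions.\<close>

definition mixed_ratio :: "real \<Rightarrow> nat \<Rightarrow> real" where
  "mixed_ratio \<beta> n = sqrt (\<beta> * n) * exp (14 - \<beta> * n / 24)"

text \<open>The majority keeps the exponent \<open>\<beta>/8 * m\<close>: of
  \<open>n - k - 2\<close>, the cross interactions take \<open>3/4 k\<close>. For
  \<open>2 k <= n\<close> this leaves at least \<open>n/8 - 2\<close>, which is at least
  \<open>n/16\<close> once \<open>n >= 32\<close>. Then
  \<open>(n - 2) / m <= exp (28 k / n)\<close>, and the square root raised to at most the power
  \<open>n\<close> gives \<open>exp 14 ^ k\<close>.\<close>

lemma mixed_constant_le:
  assumes \<beta>: "0 < \<beta>" and n: "32 \<le> n" and k: "2 * k \<le> n"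
  defines "m \<equiv> real n - 2 - 7 / 4 * real k"
  shows "0 < m"
    and "exp (- (\<beta> / 12) * (real k * real (n - k))) * (pi ^ k * sqrt (8 * pi / (\<beta> * m)) ^ (n - k))
      \<le> sqrt (2 * pi * (well_scale \<beta> n)\<^sup>2) ^ n * mixed_ratio \<beta> n ^ k"
proof -
  define c where "c = sqrt (2 * pi * (well_scale \<beta> n)\<^sup>2)"
  have k': "2 * real k \<le> real n" using k by (metis of_nat_le_iff of_nat_mult of_nat_numeral)
  have mn: "real n / 16 \<le> m" unfolding m_def using k' n by simp
  then show m: "0 < m" using n by simp
  have c2: "c = sqrt (8 * pi / (\<beta> * (real n - 2)))"
    unfolding c_def using \<beta> n by (subst well_scale_square) (auto simp: field_simps)
  have c: "0 < c" unfolding c2 using \<beta> n by simp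
  \<comment> \<open>A minority angle contributes the full length pi of its well instead of a
    Gaussian width \<open>c\<close>. The comparison reduces to \<open>pi <= 8\<close>.\<close>
  have "pi\<^sup>2 \<le> (sqrt (\<beta> * n) * c)\<^sup>2"
  proof -
    have "pi\<^sup>2 \<le> 8 * pi * (real n / (real n - 2))"
    proof -
      have "pi\<^sup>2 \<le> 8 * pi * 1" using pi_less_4 by (simp add: power2_eq_square)
      also have "8 * pi * 1 \<le> 8 * pi * (real n / (real n - 2))"
        using n by (intro mult_left_mono) auto
      finally show ?thesis .
    qed
    also have "\<dots> = (sqrt (\<beta> * n) * c)\<^sup>2"
      unfolding c2 power_mult_distrib using \<beta> n by simp
    finally show ?thesis .
  qed
  then have pi: "pi \<le> sqrt (\<beta> * n) * c"
    by (rule power2_le_imp_le) (use \<beta> c in auto)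
  have ratio: "sqrt (8 * pi / (\<beta> * m)) ^ (n - k) \<le> c ^ (n - k) * exp 14 ^ k"
  proof -
    have "(real n - 2) / m = 1 + 7 / 4 * real k / m" unfolding m_def using m by (simp add: m_def field_simps)
    also have "\<dots> \<le> exp (7 / 4 * real k / m)" by (rule exp_ge_add_one_self)
    also have "\<dots> \<le> exp (2 * (14 * real k / n))"
    proof -
      have "7 / 4 * real k / m \<le> 7 / 4 * real k / (real n / 16)"
        using mn n by (intro divide_left_mono) auto
      then show ?thesis by simp
    qed
    also have "\<dots> = (exp (14 * real k / n))\<^sup>2" by (rule exp_double)
    finally have "sqrt ((real n - 2) / m) \<le> exp (14 * real k / n)"
      by (intro real_le_lsqrt) auto
    moreover have "sqrt (8 * pi / (\<beta> * m)) = c * sqrt ((real n - 2) / m)"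
      unfolding c2 real_sqrt_mult[symmetric] using \<beta> n by simp
    ultimately have "sqrt (8 * pi / (\<beta> * m)) \<le> c * exp (14 * real k / n)"
      using c by simp
    then have "sqrt (8 * pi / (\<beta> * m)) ^ (n - k) \<le> (c * exp (14 * real k / n)) ^ (n - k)"
      using \<beta> m by (intro power_mono) auto
    also have "\<dots> = c ^ (n - k) * exp (14 * real k * (real (n - k) / n))"
      unfolding power_mult_distrib by (simp add: mult_ac flip: exp_of_nat_mult)
    also have "\<dots> \<le> c ^ (n - k) * exp (14 * real k * 1)"
    proof (intro mult_left_mono)
      have "real (n - k) / n \<le> 1" using n by simp
      then have "14 * real k * (real (n - k) / n) \<le> 14 * real k * 1" by (rule mult_left_mono) simp
      then show "exp (14 * real k * (real (n - k) / n)) \<le> exp (14 * real k * 1)" by (simp only: exp_le_cancel_iff)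
    qed (use c in simp)
    also have "exp (14 * real k * 1) = exp 14 ^ k"
      by (simp add: mult.commute flip: exp_of_nat_mult)
    finally show ?thesis .
  qed
  have dec: "exp (- (\<beta> / 12) * (real k * real (n - k))) \<le> exp (- \<beta> * n / 24) ^ k"
  proof -
    have "real n / 2 \<le> real (n - k)" using k' k by (simp add: of_nat_diff)
    then have "\<beta> / 12 * (real k * (real n / 2)) \<le> \<beta> / 12 * (real k * real (n - k))"
      using \<beta> by (intro mult_left_mono) auto
    then show ?thesis by (simp add: mult_ac flip: exp_of_nat_mult)
  qed
  have "exp (- (\<beta> / 12) * (real k * real (n - k))) * (pi ^ k * sqrt (8 * pi / (\<beta> * m)) ^ (n - k))
      \<le> exp (- \<beta> * n / 24) ^ k * ((sqrt (\<beta> * n) * c) ^ k * (c ^ (n - k) * exp 14 ^ k))"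
    using dec ratio pi \<beta> m c by (intro mult_mono power_mono) auto
  also have "\<dots> = (c ^ k * c ^ (n - k)) * (sqrt (\<beta> * n) * (exp 14 * exp (- \<beta> * n / 24))) ^ k"
    unfolding power_mult_distrib by (simp only: mult_ac)
  also have "c ^ k * c ^ (n - k) = c ^ n" using k by (simp flip: power_add)
  also have "exp 14 * exp (- \<beta> * n / 24) = exp (14 - \<beta> * n / 24)" by (simp flip: exp_add)
  finally show "exp (- (\<beta> / 12) * (real k * real (n - k))) * (pi ^ k * sqrt (8 * pi / (\<beta> * m)) ^ (n - k))
      \<le> sqrt (2 * pi * (well_scale \<beta> n)\<^sup>2) ^ n * mixed_ratio \<beta> n ^ k"
    unfolding c_def mixed_ratio_def .
qed

text \<open>The pointwise bound factors over the angles, so the integral is at most a product: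
  length pi for each minority angle, a widened Gaussian for each majority angle.\<close>

lemma mixed_wells_integral_le:
  assumes \<beta>: "0 < \<beta>" and n: "32 \<le> n" and s: "s = pi / 2 \<or> s = - (pi / 2)"
    and T: "T \<subseteq> {1..n}" and k: "2 * card T \<le> n"
  shows "(\<integral>\<^sup>+\<theta>. ennreal (mirror_weight n \<beta> \<theta> * (\<Prod>j\<in>{1..n}. indicator (if j \<in> T then well (- s) else well s) (\<theta> j))) \<partial>torus_measure n)
    \<le> ennreal (well_mass \<beta> n * mixed_ratio \<beta> n ^ card T)"
proof -
  define k where "k = card T"
  define m where "m = real n - 2 - 7 / 4 * real k"
  have m: "0 < m" unfolding m_def k_def using mixed_constant_le(1)[OF \<beta> n k] .
  have cardT: "card ({1..n} - T) = n - k"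
    unfolding k_def using T by (subst card_Diff_subset) (auto intro: finite_subset)
  have kn: "k \<le> n" using k unfolding k_def by simp
  define \<phi> where "\<phi> j x = indicator (if j \<in> T then well (- s) else well s) x
      * (if j \<in> T then 1 else exp (- (\<beta> / 8 * m) * (x - s)\<^sup>2))" for j x
  have \<phi>m[measurable]: "\<phi> j \<in> borel_measurable borel" for j
    unfolding \<phi>_def[abs_def] by (cases "j \<in> T") simp_all
  have \<phi>0: "0 \<le> \<phi> j x" for j x unfolding \<phi>_def by simp
  define D where "D = pair_const n \<beta> * exp (- (\<beta> / 12) * (real k * real (n - k)))"
  have D0: "0 \<le> D" unfolding D_def using pair_const_pos[of n \<beta>] by simp
  have split: "(\<Prod>j\<in>{1..n}. if j \<in> T then f j else h j) = (\<Prod>j\<in>T. f j) * (\<Prod>j\<in>{1..n} - T. h j)" for f h :: "nat \<Rightarrow> 'b::comm_monoid_mult"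
    using T by (subst prod.If_cases) (auto simp: Int_absorb1 Diff_eq)
  have pw: "mirror_weight n \<beta> \<theta> * (\<Prod>j\<in>{1..n}. indicator (if j \<in> T then well (- s) else well s) (\<theta> j))
      \<le> D * (\<Prod>j\<in>{1..n}. \<phi> j (\<theta> j))" for \<theta>
  proof (cases "\<forall>j\<in>{1..n}. \<theta> j \<in> (if j \<in> T then well (- s) else well s)")
    case True
    define M where "M = (\<Sum>j\<in>{1..n} - T. (\<theta> j - s)\<^sup>2)"
    define X where "X = (\<Sum>j\<in>{1..n} - T. \<theta> j - s)"
    have "mirror_weight n \<beta> \<theta> \<le> pair_const n \<beta>
       * exp (\<beta> * (- (1/8) * ((real (card ({1..n} - T)) - 2) * M + X\<^sup>2) + real (card T) * (- (1/12) * real (card ({1..n} - T)) + 3/32 * M)))"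
      unfolding M_def X_def
    proof (rule mirror_weight_wells_le[OF \<beta> s T])
      show "\<bar>\<theta> j - s\<bar> \<le> pi / 2" if "j \<in> {1..n} - T" for j
        using bspec[OF True, of j] that by (intro abs_diff_le_of_well) auto
      show "\<bar>\<theta> j + s\<bar> \<le> pi / 2" if "j \<in> T" for j
      proof -
        have "\<theta> j \<in> well (- s)" using bspec[OF True, of j] T that by auto
        from abs_diff_le_of_well[OF this] show ?thesis by simp
      qed
    qed
    \<comment> \<open>Dropping the square of the sum removes the only coupling between the majority
      angles.\<close>
    also have "\<dots> \<le> pair_const n \<beta> * exp (\<beta> * (- (1/8) * m * M - (1/12) * (real k * real (n - k))))"
    proof -
      have "- (1/8) * ((real (card ({1..n} - T)) - 2) * M + X\<^sup>2) + real (card T) * (- (1/12) * real (card ({1..n} - T)) + 3/32 * M)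
          = (- (1/8) * m * M - (1/12) * (real k * real (n - k))) - X\<^sup>2 / 8"
        unfolding cardT k_def[symmetric] m_def using kn by (simp add: of_nat_diff field_simps)
      then have "\<dots> \<le> - (1/8) * m * M - (1/12) * (real k * real (n - k))" by simp
      then show ?thesis
        using \<beta> pair_const_pos[of n \<beta>] \<open>_ = _ - X\<^sup>2 / 8\<close> by (intro mult_left_mono) (auto simp del: of_nat_diff)
    qed
    also have "\<dots> = D * exp (- (\<beta> / 8 * m) * M)"
      unfolding D_def mult.assoc exp_add[symmetric] by (simp add: algebra_simps)
    finally have "mirror_weight n \<beta> \<theta> \<le> D * exp (- (\<beta> / 8 * m) * M)" .
    moreover have "(\<Prod>j\<in>{1..n}. \<phi> j (\<theta> j)) = exp (- (\<beta> / 8 * m) * M)"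
    proof -
      have "(\<Prod>j\<in>{1..n}. \<phi> j (\<theta> j)) = (\<Prod>j\<in>{1..n}. if j \<in> T then 1 else exp (- (\<beta> / 8 * m) * (\<theta> j - s)\<^sup>2))"
        using True by (intro prod.cong refl) (auto simp: \<phi>_def)
      also have "\<dots> = exp (- (\<beta> / 8 * m) * M)"
        unfolding split M_def sum_distrib_left by (subst exp_sum) auto
      finally show ?thesis .
    qed
    moreover have "(\<Prod>j\<in>{1..n}. indicator (if j \<in> T then well (- s) else well s) (\<theta> j)) = (1::real)"
      using True by (intro prod.neutral) auto
    ultimately show ?thesis by simp
  next
    case False
    then have zero: "(\<Prod>j\<in>{1..n}. indicator (if j \<in> T then well (- s) else well s) (\<theta> j)) = (0::real)"
      by (intro prod_zero) (auto simp: indicator_def)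
    show ?thesis unfolding zero using D0 \<phi>0 by (simp add: prod_nonneg)
  qed
  interpret Tm: finite_measure "lebesgue_on {- pi<..pi}" by (rule finite_measure_lebesgue_on_torus)
  interpret PT: product_sigma_finite "\<lambda>_::nat. lebesgue_on {- pi<..pi}" ..
  have \<phi>T: "(\<lambda>x. ennreal (\<phi> j x)) \<in> borel_measurable (lebesgue_on {- pi<..pi})" for j
    by (intro measurable_restrict_space1 measurable_completion) simp
  have one: "(\<integral>\<^sup>+x. ennreal (\<phi> j x) \<partial>lebesgue_on {- pi<..pi}) \<le> (if j \<in> T then ennreal pi else ennreal (sqrt (8 * pi / (\<beta> * m))))" for j
  proof (cases "j \<in> T")
    case True
    have "(\<integral>\<^sup>+x. ennreal (\<phi> j x) \<partial>lebesgue_on {- pi<..pi}) \<le> (\<integral>\<^sup>+x. ennreal (\<phi> j x) \<partial>lborel)"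
      by (rule nn_integral_torus_le) simp
    also have "\<dots> = (\<integral>\<^sup>+x. indicator (well (- s)) x \<partial>lborel)"
      using True by (simp add: \<phi>_def ennreal_indicator)
    also have "\<dots> = emeasure lborel (well (- s))"
      by (rule nn_integral_indicator) simp
    also have "\<dots> = ennreal pi" by (simp add: well_def)
    finally show ?thesis using True by simp
  next
    case False
    have "(\<integral>\<^sup>+x. ennreal (\<phi> j x) \<partial>lebesgue_on {- pi<..pi}) \<le> (\<integral>\<^sup>+x. ennreal (\<phi> j x) \<partial>lborel)"
      by (rule nn_integral_torus_le) simp
    also have "\<dots> \<le> (\<integral>\<^sup>+x. ennreal (exp (- (\<beta> / 8 * m) * (x - s)\<^sup>2)) \<partial>lborel)"
      using False by (intro nn_integral_mono ennreal_leI) (auto simp: \<phi>_def split: split_indicator)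
    also have "\<dots> = ennreal (sqrt (pi / (\<beta> / 8 * m)))"
      using \<beta> m by (intro nn_integral_gaussian) simp
    also have "pi / (\<beta> / 8 * m) = 8 * pi / (\<beta> * m)" using \<beta> m by (simp add: field_simps)
    finally show ?thesis using False by simp
  qed
  have "(\<integral>\<^sup>+\<theta>. ennreal (mirror_weight n \<beta> \<theta> * (\<Prod>j\<in>{1..n}. indicator (if j \<in> T then well (- s) else well s) (\<theta> j))) \<partial>torus_measure n)
      \<le> (\<integral>\<^sup>+\<theta>. ennreal D * (\<Prod>j\<in>{1..n}. ennreal (\<phi> j (\<theta> j))) \<partial>torus_measure n)"
    using pw D0 \<phi>0 by (intro nn_integral_mono) (simp add: prod_ennreal prod_nonneg ennreal_leI flip: ennreal_mult)
  also have "\<dots> = ennreal D * (\<integral>\<^sup>+\<theta>. (\<Prod>j\<in>{1..n}. ennreal (\<phi> j (\<theta> j))) \<partial>torus_measure n)"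
  proof (rule nn_integral_cmult)
    show "(\<lambda>\<theta>. \<Prod>j\<in>{1..n}. ennreal (\<phi> j (\<theta> j))) \<in> borel_measurable (torus_measure n)"
    proof (rule borel_measurable_prod_ennreal)
      fix j assume "j \<in> {1..n}"
      then have [measurable]: "(\<lambda>\<theta>. \<theta> j) \<in> borel_measurable (torus_measure n)" by simp
      show "(\<lambda>\<theta>. ennreal (\<phi> j (\<theta> j))) \<in> borel_measurable (torus_measure n)" by measurable
    qed
  qed
  also have "(\<integral>\<^sup>+\<theta>. (\<Prod>j\<in>{1..n}. ennreal (\<phi> j (\<theta> j))) \<partial>torus_measure n)
      = (\<Prod>j\<in>{1..n}. \<integral>\<^sup>+x. ennreal (\<phi> j x) \<partial>lebesgue_on {- pi<..pi})"
    unfolding torus_measure_def by (rule PT.product_nn_integral_prod) (simp_all add: \<phi>T)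
  also have "\<dots> \<le> (\<Prod>j\<in>{1..n}. if j \<in> T then ennreal pi else ennreal (sqrt (8 * pi / (\<beta> * m))))"
    using one by (intro prod_mono_ennreal) auto
  also have "\<dots> = ennreal (pi ^ k * sqrt (8 * pi / (\<beta> * m)) ^ (n - k))"
    unfolding split prod_constant cardT k_def[symmetric] using \<beta> m by (simp add: ennreal_power ennreal_mult)
  also have "ennreal D * \<dots> = ennreal (D * (pi ^ k * sqrt (8 * pi / (\<beta> * m)) ^ (n - k)))"
    using D0 \<beta> m by (intro ennreal_mult[symmetric]) auto
  also have "\<dots> \<le> ennreal (well_mass \<beta> n * mixed_ratio \<beta> n ^ k)"
    using mixed_constant_le(2)[OF \<beta> n k] pair_const_pos[of n \<beta>]
    unfolding D_def well_mass_def m_def k_def by (intro ennreal_leI) (simp add: mult.assoc)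
  finally show ?thesis by (simp add: k_def mult_left_mono)
qed

section \<open>Covering the mixed configurations by minority sets\<close>

lemma well_disjoint: "x \<in> well (pi / 2) \<Longrightarrow> x \<notin> well (- (pi / 2))"
  using pi_gt_zero unfolding well_def greaterThanAtMost_iff by linarith

lemma torus_eq_wells: "{- pi<..pi} = well (pi / 2) \<union> well (- (pi / 2))"
  using pi_gt_zero unfolding well_def by auto

definition in_well :: "nat \<Rightarrow> real \<Rightarrow> (nat \<Rightarrow> real) \<Rightarrow> real" where
  "in_well n s \<theta> = (\<Prod>j\<in>{1..n}. indicator (well s) (\<theta> j))"

lemma in_well_eq: "in_well n s \<theta> = (if \<forall>j\<in>{1..n}. \<theta> j \<in> well s then 1 else 0)"
  by (auto simp: in_well_def indicator_def)

lemma measurable_in_well: "in_well n s \<in> borel_measurable (torus_measure n)"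
  unfolding in_well_def[abs_def]
proof (rule borel_measurable_prod)
  fix j assume "j \<in> {1..n}"
  then have [measurable]: "(\<lambda>\<theta>. \<theta> j) \<in> borel_measurable (torus_measure n)" by simp
  show "(\<lambda>\<theta>. indicator (well s) (\<theta> j) :: real) \<in> borel_measurable (torus_measure n)" by measurable
qed

lemma mixed_wells_cover:
  assumes n: "1 \<le> n" and \<theta>: "\<theta> \<in> space (torus_measure n)"
  shows "1 - in_well n (pi / 2) \<theta> - in_well n (- (pi / 2)) \<theta> \<in> {0, 1}"
    and "1 - in_well n (pi / 2) \<theta> - in_well n (- (pi / 2)) \<theta>
      \<le> (\<Sum>s\<in>{pi / 2, - (pi / 2)}. \<Sum>T | T \<subseteq> {1..n} \<and> T \<noteq> {} \<and> 2 * card T \<le> n.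
          (\<Prod>j\<in>{1..n}. indicator (if j \<in> T then well (- s) else well s) (\<theta> j)))" (is "_ \<le> ?R")
proof -
  have in_torus: "\<theta> j \<in> well (pi / 2) \<or> \<theta> j \<in> well (- (pi / 2))" if "j \<in> {1..n}" for j
    using \<theta> that torus_eq_wells unfolding space_torus_measure by blast
  \<comment> \<open>For \<open>n = 0\<close> both products are empty and equal to 1, which is why
    \<open>1 <= n\<close> is assumed.\<close>
  have not_both: "\<not> ((\<forall>j\<in>{1..n}. \<theta> j \<in> well (pi / 2)) \<and> (\<forall>j\<in>{1..n}. \<theta> j \<in> well (- (pi / 2))))"
    using n well_disjoint[of "\<theta> 1"] by force
  then show bin: "1 - in_well n (pi / 2) \<theta> - in_well n (- (pi / 2)) \<theta> \<in> {0, 1}"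
    unfolding in_well_eq by auto
  have R0: "0 \<le> ?R" by (intro sum_nonneg prod_nonneg) auto
  show "1 - in_well n (pi / 2) \<theta> - in_well n (- (pi / 2)) \<theta> \<le> ?R"
  proof (cases "(\<forall>j\<in>{1..n}. \<theta> j \<in> well (pi / 2)) \<or> (\<forall>j\<in>{1..n}. \<theta> j \<in> well (- (pi / 2)))")
    case True
    then have "1 - in_well n (pi / 2) \<theta> - in_well n (- (pi / 2)) \<theta> \<le> 0"
      unfolding in_well_eq by auto
    then show ?thesis using R0 by linarith
  next
    case False
    define L where "L = {j \<in> {1..n}. \<theta> j \<in> well (- (pi / 2))}"
    \<comment> \<open>\<open>T\<close> is the smaller of the two groups and \<open>s\<close> the
      well of the larger one. \<open>T\<close> is nonempty because neither well contains all
      angles.\<close>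
    define s T where "s = (if 2 * card L \<le> n then pi / 2 else - (pi / 2))"
      and "T = (if 2 * card L \<le> n then L else {1..n} - L)"
    have "\<exists>j\<in>{1..n}. \<theta> j \<notin> well (pi / 2)" "\<exists>j\<in>{1..n}. \<theta> j \<notin> well (- (pi / 2))"
      using False by auto
    then have L: "L \<subseteq> {1..n}" "L \<noteq> {}" "{1..n} - L \<noteq> {}"
      using in_torus unfolding L_def by blast+
    have cardT: "card ({1..n} - L) = n - card L"
      using L(1) by (subst card_Diff_subset) (auto intro: finite_subset)
    have s: "s \<in> {pi / 2, - (pi / 2)}" unfolding s_def by simp
    have T: "T \<in> {T. T \<subseteq> {1..n} \<and> T \<noteq> {} \<and> 2 * card T \<le> n}"
      unfolding T_def using L cardT by auto
    have mem: "\<theta> j \<in> (if j \<in> T then well (- s) else well s)" if "j \<in> {1..n}" for j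
      using in_torus[OF that] that unfolding T_def s_def L_def by auto
    have "1 - in_well n (pi / 2) \<theta> - in_well n (- (pi / 2)) \<theta> \<le> 1"
      unfolding in_well_eq by simp
    also have "1 = (\<Prod>j\<in>{1..n}. indicator (if j \<in> T then well (- s) else well s) (\<theta> j) :: real)"
      using mem by (intro prod.neutral[symmetric]) auto
    also have "\<dots> \<le> (\<Sum>T | T \<subseteq> {1..n} \<and> T \<noteq> {} \<and> 2 * card T \<le> n.
          (\<Prod>j\<in>{1..n}. indicator (if j \<in> T then well (- s) else well s) (\<theta> j)))"
      by (rule member_le_sum[OF T]) (auto intro!: prod_nonneg)
    also have "\<dots> \<le> ?R"
      by (rule member_le_sum[OF s, where f = "\<lambda>s. \<Sum>T | T \<subseteq> {1..n} \<and> T \<noteq> {} \<and> 2 * card T \<le> n.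
          (\<Prod>j\<in>{1..n}. indicator (if j \<in> T then well (- s) else well s) (\<theta> j))"])
        (auto intro!: sum_nonneg prod_nonneg)
    finally show ?thesis .
  qed
qed

lemma sum_subsets_power:
  fixes b :: real
  shows "(\<Sum>T\<in>Pow {1..n}. b ^ card T) = (1 + b) ^ n"
proof -
  have "(1 + b) ^ n = (\<Prod>j\<in>{1..n}. b + 1)" by (simp add: add.commute)
  also have "\<dots> = (\<Sum>T\<in>Pow {1..n}. b ^ card T)"
    by (subst prod_add) auto
  finally show ?thesis by simp
qed

text \<open>Summing \<open>b ^ card T\<close> over nonempty sets gives at most
  \<open>(1 + b)^n - 1 <= exp (n b) - 1\<close>; removing the empty set is what makes the bound
  small. The factor 2 counts the choices of the majority well.\<close>

lemma mixed_integral_le: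
  assumes \<beta>: "0 < \<beta>" and n: "32 \<le> n"
  shows "(\<integral>\<theta>. (1 - in_well n (pi / 2) \<theta> - in_well n (- (pi / 2)) \<theta>) * mirror_weight n \<beta> \<theta> \<partial>torus_measure n)
    \<le> well_mass \<beta> n * (2 * (exp (n * mixed_ratio \<beta> n) - 1))"
proof -
  define b where "b = mixed_ratio \<beta> n"
  have b: "0 \<le> b" unfolding b_def mixed_ratio_def by (simp add: less_imp_le[OF \<beta>])
  define \<T> where "\<T> = {T. T \<subseteq> {1..n} \<and> T \<noteq> {} \<and> 2 * card T \<le> n}"
  have fin: "finite \<T>" unfolding \<T>_def by (rule finite_subset[of _ "Pow {1..n}"]) auto
  define Y where "Y s T \<theta> = mirror_weight n \<beta> \<theta> * (\<Prod>j\<in>{1..n}. indicator (if j \<in> T then well (- s) else well s) (\<theta> j))" for s T \<theta>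
  have Y0: "0 \<le> Y s T \<theta>" for s T \<theta>
    unfolding Y_def by (intro mult_nonneg_nonneg mirror_weight_nonneg prod_nonneg) auto
  have Ym: "Y s T \<in> borel_measurable (torus_measure n)" for s T
    unfolding Y_def[abs_def]
  proof (intro borel_measurable_times borel_measurable_prod measurable_mirror_weight)
    fix j assume "j \<in> {1..n}"
    then have [measurable]: "(\<lambda>\<theta>. \<theta> j) \<in> borel_measurable (torus_measure n)" by simp
    show "(\<lambda>\<theta>. indicator (if j \<in> T then well (- s) else well s) (\<theta> j) :: real) \<in> borel_measurable (torus_measure n)"
      by (cases "j \<in> T"; simp; measurable)
  qed
  have Ym': "(\<lambda>\<theta>. ennreal (Y s T \<theta>)) \<in> borel_measurable (torus_measure n)" for s T
    by (intro measurable_compose[OF Ym measurable_ennreal])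
  have mass: "0 \<le> well_mass \<beta> n" using well_mass_pos[of \<beta> n] \<beta> n by simp
  have "(\<integral>\<^sup>+\<theta>. ennreal ((1 - in_well n (pi / 2) \<theta> - in_well n (- (pi / 2)) \<theta>) * mirror_weight n \<beta> \<theta>) \<partial>torus_measure n)
      \<le> (\<integral>\<^sup>+\<theta>. (\<Sum>s\<in>{pi / 2, - (pi / 2)}. \<Sum>T\<in>\<T>. ennreal (Y s T \<theta>)) \<partial>torus_measure n)"
  proof (rule nn_integral_mono)
    fix \<theta> assume \<theta>: "\<theta> \<in> space (torus_measure n)"
    have "(1 - in_well n (pi / 2) \<theta> - in_well n (- (pi / 2)) \<theta>) * mirror_weight n \<beta> \<theta>
        \<le> (\<Sum>s\<in>{pi / 2, - (pi / 2)}. \<Sum>T\<in>\<T>. (\<Prod>j\<in>{1..n}. indicator (if j \<in> T then well (- s) else well s) (\<theta> j))) * mirror_weight n \<beta> \<theta>"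
      unfolding \<T>_def using n by (intro mult_right_mono mixed_wells_cover(2)[OF _ \<theta>] mirror_weight_nonneg) auto
    also have "\<dots> = (\<Sum>s\<in>{pi / 2, - (pi / 2)}. \<Sum>T\<in>\<T>. Y s T \<theta>)"
      unfolding Y_def sum_distrib_right by (simp only: mult.commute)
    finally show "ennreal ((1 - in_well n (pi / 2) \<theta> - in_well n (- (pi / 2)) \<theta>) * mirror_weight n \<beta> \<theta>)
        \<le> (\<Sum>s\<in>{pi / 2, - (pi / 2)}. \<Sum>T\<in>\<T>. ennreal (Y s T \<theta>))"
      using Y0 by (simp only: sum_ennreal sum_nonneg ennreal_leI)
  qed
  also have "\<dots> = (\<Sum>s\<in>{pi / 2, - (pi / 2)}. \<Sum>T\<in>\<T>. \<integral>\<^sup>+\<theta>. ennreal (Y s T \<theta>) \<partial>torus_measure n)"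
    using Ym' by (simp add: nn_integral_sum nn_integral_add borel_measurable_sum)
  also have "\<dots> \<le> (\<Sum>s\<in>{pi / 2, - (pi / 2)}. \<Sum>T\<in>\<T>. ennreal (well_mass \<beta> n * b ^ card T))"
    unfolding Y_def b_def by (intro sum_mono mixed_wells_integral_le \<beta> n) (auto simp: \<T>_def)
  also have "\<dots> = ennreal (\<Sum>s\<in>{pi / 2, - (pi / 2)}. \<Sum>T\<in>\<T>. well_mass \<beta> n * b ^ card T)"
    using b mass by (simp only: sum_ennreal sum_nonneg mult_nonneg_nonneg zero_le_power)
  also have "\<dots> \<le> ennreal (well_mass \<beta> n * (2 * (exp (n * b) - 1)))"
  proof (rule ennreal_leI)
    have "(\<Sum>T\<in>\<T>. b ^ card T) \<le> (\<Sum>T\<in>Pow {1..n} - {{}}. b ^ card T)"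
      using b by (intro sum_mono2) (auto simp: \<T>_def)
    also have "\<dots> = (1 + b) ^ n - 1"
      using sum_subsets_power[of b n] by (subst sum_diff1) auto
    also have "(1 + b) ^ n \<le> exp b ^ n"
      using b by (intro power_mono exp_ge_add_one_self) auto
    also have "exp b ^ n = exp (n * b)" by (rule exp_of_nat_mult[symmetric])
    finally have "(\<Sum>T\<in>\<T>. b ^ card T) \<le> exp (n * b) - 1" by simp
    then have "well_mass \<beta> n * (2 * (\<Sum>T\<in>\<T>. b ^ card T)) \<le> well_mass \<beta> n * (2 * (exp (n * b) - 1))"
      using mass by (intro mult_left_mono) auto
    then show "(\<Sum>s\<in>{pi / 2, - (pi / 2)}. \<Sum>T\<in>\<T>. well_mass \<beta> n * b ^ card T) \<le> well_mass \<beta> n * (2 * (exp (n * b) - 1))"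
      by (simp add: sum_distrib_left[symmetric] mult_ac)
  qed
  finally have le: "(\<integral>\<^sup>+\<theta>. ennreal ((1 - in_well n (pi / 2) \<theta> - in_well n (- (pi / 2)) \<theta>) * mirror_weight n \<beta> \<theta>) \<partial>torus_measure n)
      \<le> ennreal (well_mass \<beta> n * (2 * (exp (n * b) - 1)))" .
  have "0 \<le> exp (n * b) - 1" using b by simp
  then show ?thesis
    using le mass unfolding b_def
    by (intro integral_real_bounded) auto
qed

section \<open>The expectation as a quotient of torus integrals\<close>

lemma measurable_torus_lebesgue:
  assumes "F \<in> borel_measurable (\<Pi>\<^sub>M j\<in>{1..n}. lebesgue)"
  shows "F \<in> borel_measurable (torus_measure n)"
proof -
  have "(\<lambda>x. x) \<in> torus_measure n \<rightarrow>\<^sub>M (\<Pi>\<^sub>M j\<in>{1..n}. lebesgue)"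
  proof (rule measurable_PiM_single')
    fix j assume j: "j \<in> {1..n}"
    have "(\<lambda>\<theta>. \<theta> j) \<in> torus_measure n \<rightarrow>\<^sub>M lebesgue_on {- pi<..pi}"
      unfolding torus_measure_def using j by (rule measurable_component_singleton)
    moreover have "(\<lambda>x. x) \<in> lebesgue_on {- pi<..pi} \<rightarrow>\<^sub>M (lebesgue :: real measure)"
      by (intro measurable_restrict_space1) simp
    ultimately show "(\<lambda>\<theta>. \<theta> j) \<in> torus_measure n \<rightarrow>\<^sub>M lebesgue"
      by (rule measurable_compose)
  qed (auto simp: space_torus_measure PiE_iff)
  then show ?thesis using assms by (rule measurable_compose)
qed

lemma mirror_expectation_eq:
  fixes g :: "real \<Rightarrow> real"
  assumes \<beta>: "0 < \<beta>" and g: "g \<in> borel_measurable lebesgue"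
  shows "(\<integral>\<theta>. exp (\<i> * of_real t * (\<Sum>j=1..n. of_real (g (\<theta> j)))) \<partial>mirror_process n \<beta>)
    = (\<integral>\<theta>. of_real (mirror_weight n \<beta> \<theta>) * iexp (t * (\<Sum>j=1..n. g (\<theta> j))) \<partial>torus_measure n) / of_real (mirror_Z n \<beta>)"
proof -
  note [measurable] = measurable_torus_lebesgue[OF measurable_sum_lebesgue[OF g, of n]]
  have m: "(\<lambda>\<theta>. iexp (t * (\<Sum>j=1..n. g (\<theta> j)))) \<in> borel_measurable (torus_measure n)"
    by measurable
  have "(\<integral>\<theta>. exp (\<i> * of_real t * (\<Sum>j=1..n. of_real (g (\<theta> j)))) \<partial>mirror_process n \<beta>)
      = (\<integral>\<theta>. iexp (t * (\<Sum>j=1..n. g (\<theta> j))) \<partial>mirror_process n \<beta>)"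
    by (simp add: mult.assoc)
  also have "\<dots> = (\<integral>\<theta>. (mirror_weight n \<beta> \<theta> / mirror_Z n \<beta>) *\<^sub>R iexp (t * (\<Sum>j=1..n. g (\<theta> j))) \<partial>torus_measure n)"
    unfolding mirror_process_def using mirror_Z_pos[OF \<beta>, of n]
    by (intro integral_density m) (auto simp: mirror_weight_nonneg)
  also have "\<dots> = (\<integral>\<theta>. of_real (mirror_weight n \<beta> \<theta>) * iexp (t * (\<Sum>j=1..n. g (\<theta> j))) / of_real (mirror_Z n \<beta>) \<partial>torus_measure n)"
    by (simp add: scaleR_conv_of_real)
  finally show ?thesis by simp
qed

lemma mirror_I_eq:
  "mirror_I n \<beta> (\<lambda>x. \<i> * of_real t * of_real (g x))
    = (\<integral>\<theta>. of_real (mirror_weight n \<beta> \<theta>) * iexp (t * (\<Sum>j=1..n. g (\<theta> j))) \<partial>torus_measure n)"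
  unfolding mirror_I_def by (simp add: exp_sum[symmetric] sum_distrib_left mult.assoc)

section \<open>Assembling the expectation\<close>

text \<open>\<open>n * mixed_ratio \<beta> n\<close> tends to 0 exponentially fast, hence so does
  the difference; comparison with \<open>1/n\<close> is more than enough.\<close>

lemma mixed_error_small:
  assumes \<beta>: "0 < \<beta>" and q: "0 < q" "q \<le> 1"
  shows "\<forall>\<^sub>F n in sequentially. 2 * (exp (n * mixed_ratio \<beta> n) - 1) \<le> n powr (- (q / 2))"
proof -
  have "\<forall>\<^sub>F n in sequentially. 2 * (exp (real n * (sqrt (\<beta> * n) * exp (14 - \<beta> * n / 24))) - 1) \<le> 1 / real n"
    using \<beta> by real_asymp
  then show ?thesis
    using eventually_ge_at_top[of 1]
  proof eventually_elim
    case (elim n)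
    have "1 / real n = real n powr (- 1)" using elim by (simp add: powr_minus_divide)
    also have "\<dots> \<le> real n powr (- (q / 2))" using elim q by (intro powr_mono) auto
    finally show ?case using elim by (simp add: mixed_ratio_def)
  qed
qed

text \<open>The common amplitude \<open>a\<close> cancels in the main term, leaving
  \<open>(et - e0 * (M0 / 2))\<close> over the denominator. The hypothesis on \<open>e0\<close>
  keeps that denominator at least \<open>a\<close> in modulus.\<close>

lemma ratio_error_le:
  fixes e0 et M0 :: complex and a :: real
  assumes a: "0 < a" and e0: "norm e0 \<le> a" and M0: "norm M0 \<le> 2"
  shows "norm ((of_real a * M0 + et) / (of_real a * 2 + e0) - M0 / 2) \<le> (norm et + norm e0) / a"
proof -
  have den: "a \<le> norm (of_real a * 2 + e0)"
    using norm_diff_ineq[of "of_real a * 2" e0] e0 a by (simp add: norm_mult)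
  then have nz: "of_real a * 2 + e0 \<noteq> 0" using a by auto
  have "(of_real a * M0 + et) / (of_real a * 2 + e0) - M0 / 2 = (et - e0 * (M0 / 2)) / (of_real a * 2 + e0)"
    using nz by (simp add: field_simps)
  also have "norm \<dots> \<le> (norm et + norm e0) / a"
    unfolding norm_divide
  proof (rule frac_le)
    have "norm (et - e0 * (M0 / 2)) \<le> norm et + norm e0 * (norm M0 / 2)"
      using norm_triangle_ineq4[of et "e0 * (M0 / 2)"] by (simp add: norm_mult norm_divide)
    also have "norm e0 * (norm M0 / 2) \<le> norm e0 * 1" using M0 by (intro mult_left_mono) auto
    finally show "norm (et - e0 * (M0 / 2)) \<le> norm et + norm e0" by simp
  qed (use den a in auto)
  finally show ?thesis .
qed

definition limit_term :: "real \<Rightarrow> (real \<Rightarrow> real) \<Rightarrow> real \<Rightarrow> nat \<Rightarrow> real \<Rightarrow> complex" where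
  "limit_term \<beta> g s n t = exp (of_nat n * \<i> * of_real t * of_real (g s)) *
     exp (- of_real ((deriv g s)\<^sup>2 / \<beta> * t\<^sup>2) + of_real (2 * deriv (deriv g) s / \<beta>) * \<i> * of_real t)"

lemma norm_limit_term: "norm (limit_term \<beta> g s n t) = exp (- ((deriv g s)\<^sup>2 / \<beta> * t\<^sup>2))"
  unfolding limit_term_def norm_mult norm_exp_eq_Re by simp

lemma limit_term_0: "limit_term \<beta> g s n 0 = 1"
  by (simp add: limit_term_def)

text \<open>The normalisation is the numerator at \<open>t = 0\<close>, where the main term equals
  2, so one error estimate serves numerator and denominator.\<close>

lemma mirror_expectation_asymptotics:
  fixes g :: "real \<Rightarrow> real"
  assumes \<beta>: "0 < \<beta>" and g: "g \<in> borel_measurable lebesgue" and q: "0 < q" "q \<le> 1"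
    and C2: "C2_Hoelder_near q g (pi / 2)" "C2_Hoelder_near q g (- (pi / 2))"
  shows "\<exists>K\<ge>0. \<forall>\<^sub>F n in sequentially. \<forall>t.
      norm ((\<integral>\<theta>. exp (\<i> * of_real t * (\<Sum>j=1..n. of_real (g (\<theta> j)))) \<partial>mirror_process n \<beta>)
        - (limit_term \<beta> g (pi / 2) n t + limit_term \<beta> g (- (pi / 2)) n t) / 2)
      \<le> K * (1 + \<bar>t\<bar> + t\<^sup>2) * n powr (- (q / 2))"
proof -
  define J where "J n t = (\<integral>\<theta>. of_real (mirror_weight n \<beta> \<theta>) * iexp (t * (\<Sum>j=1..n. g (\<theta> j))) \<partial>torus_measure n)" for n t
  define Js where "Js s n t = (\<integral>\<theta>. of_real (in_well n s \<theta>) * (of_real (mirror_weight n \<beta> \<theta>) * iexp (t * (\<Sum>j=1..n. g (\<theta> j)))) \<partial>torus_measure n)" for s n t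
  define Jm where "Jm n t = (\<integral>\<theta>. of_real (1 - in_well n (pi / 2) \<theta> - in_well n (- (pi / 2)) \<theta>) * (of_real (mirror_weight n \<beta> \<theta>) * iexp (t * (\<Sum>j=1..n. g (\<theta> j)))) \<partial>torus_measure n)" for n t
  define p where "p n = real n powr (- (q / 2))" for n :: nat
  define M where "M n t = limit_term \<beta> g (pi / 2) n t + limit_term \<beta> g (- (pi / 2)) n t" for n t
  define e where "e n t = J n t / of_real (well_mass \<beta> n) - of_real (well_amplitude \<beta> n) * M n t" for n t
  define a0 where "a0 = exp (- (12 / \<beta>)) / sqrt 3"
  have a0: "0 < a0" unfolding a0_def by simp
  note m[measurable] = measurable_torus_lebesgue[OF measurable_sum_lebesgue[OF g]] measurable_in_well
  have split: "J n t = Js (pi / 2) n t + Js (- (pi / 2)) n t + Jm n t" for n t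
  proof -
    define F where "F \<theta> = complex_of_real (mirror_weight n \<beta> \<theta>) * iexp (t * (\<Sum>j=1..n. g (\<theta> j)))" for \<theta>
    have mF[measurable]: "F \<in> borel_measurable (torus_measure n)" unfolding F_def[abs_def] by measurable
    have int: "integrable (torus_measure n) (\<lambda>\<theta>. of_real (h \<theta>) * F \<theta>)"
      if h[measurable]: "h \<in> borel_measurable (torus_measure n)" and h1: "\<And>\<theta>. \<theta> \<in> space (torus_measure n) \<Longrightarrow> \<bar>h \<theta>\<bar> \<le> 1" for h :: "_ \<Rightarrow> real"
    proof (rule Bochner_Integration.integrable_bound[OF integrable_mirror_weight[OF \<beta>, of n]])
      show "AE \<theta> in torus_measure n. norm (of_real (h \<theta>) * F \<theta>) \<le> norm (mirror_weight n \<beta> \<theta>)"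
      proof (rule AE_I2)
        fix \<theta> assume \<theta>: "\<theta> \<in> space (torus_measure n)"
        have "norm (of_real (h \<theta>) * F \<theta>) = \<bar>h \<theta>\<bar> * \<bar>mirror_weight n \<beta> \<theta>\<bar>"
          unfolding F_def norm_mult norm_exp_i_times by simp
        also have "\<dots> \<le> 1 * \<bar>mirror_weight n \<beta> \<theta>\<bar>" using h1[OF \<theta>] by (intro mult_right_mono) auto
        finally show "norm (of_real (h \<theta>) * F \<theta>) \<le> norm (mirror_weight n \<beta> \<theta>)" by simp
      qed
    qed measurable
    have i1: "integrable (torus_measure n) (\<lambda>\<theta>. of_real (in_well n s \<theta>) * F \<theta>)" for s
      by (intro int) (auto simp: in_well_eq intro: m)
    have i2: "integrable (torus_measure n) (\<lambda>\<theta>. of_real (1 - in_well n (pi / 2) \<theta> - in_well n (- (pi / 2)) \<theta>) * F \<theta>)"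
      by (intro int) (auto simp: in_well_eq intro!: m borel_measurable_diff)
    have "J n t = (\<integral>\<theta>. (of_real (in_well n (pi / 2) \<theta>) * F \<theta> + of_real (in_well n (- (pi / 2)) \<theta>) * F \<theta>)
        + of_real (1 - in_well n (pi / 2) \<theta> - in_well n (- (pi / 2)) \<theta>) * F \<theta> \<partial>torus_measure n)"
      unfolding J_def F_def by (intro Bochner_Integration.integral_cong refl) (simp add: algebra_simps)
    also have "\<dots> = Js (pi / 2) n t + Js (- (pi / 2)) n t + Jm n t"
      unfolding Js_def Jm_def F_def[symmetric]
      by (subst Bochner_Integration.integral_add[OF Bochner_Integration.integrable_add[OF i1 i1] i2],
          subst Bochner_Integration.integral_add[OF i1 i1]) (rule refl)
    finally show ?thesis .
  qed
  have mixed: "norm (Jm n t) \<le> well_mass \<beta> n * (2 * (exp (n * mixed_ratio \<beta> n) - 1))" if n: "32 \<le> n" for n t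
  proof -
    have "norm (Jm n t) \<le> (\<integral>\<theta>. norm (of_real (1 - in_well n (pi / 2) \<theta> - in_well n (- (pi / 2)) \<theta>) * (of_real (mirror_weight n \<beta> \<theta>) * iexp (t * (\<Sum>j=1..n. g (\<theta> j))))) \<partial>torus_measure n)"
      unfolding Jm_def by (rule integral_norm_bound)
    also have "\<dots> = (\<integral>\<theta>. (1 - in_well n (pi / 2) \<theta> - in_well n (- (pi / 2)) \<theta>) * mirror_weight n \<beta> \<theta> \<partial>torus_measure n)"
    proof (intro Bochner_Integration.integral_cong refl)
      fix \<theta> assume "\<theta> \<in> space (torus_measure n)"
      then have "0 \<le> 1 - in_well n (pi / 2) \<theta> - in_well n (- (pi / 2)) \<theta>"
        using mixed_wells_cover(1)[of n \<theta>] n by force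
      then show "norm (of_real (1 - in_well n (pi / 2) \<theta> - in_well n (- (pi / 2)) \<theta>) * (of_real (mirror_weight n \<beta> \<theta>) * iexp (t * (\<Sum>j=1..n. g (\<theta> j)))))
          = (1 - in_well n (pi / 2) \<theta> - in_well n (- (pi / 2)) \<theta>) * mirror_weight n \<beta> \<theta>"
        unfolding norm_mult norm_exp_i_times norm_of_real using mirror_weight_nonneg[of n \<beta> \<theta>] by simp
    qed
    also have "\<dots> \<le> well_mass \<beta> n * (2 * (exp (n * mixed_ratio \<beta> n) - 1))"
      by (rule mixed_integral_le[OF \<beta> n])
    finally show ?thesis .
  qed
  obtain K1 where K1: "0 \<le> K1" and b1: "\<And>n t. 4 \<le> n \<Longrightarrow>
      norm (Js (pi / 2) n t / of_real (well_mass \<beta> n) - of_real (well_amplitude \<beta> n) * limit_term \<beta> g (pi / 2) n t) \<le> K1 * (1 + \<bar>t\<bar> + t\<^sup>2) * p n"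
    using one_well_asymptotics[OF \<beta> _ g q C2(1)] unfolding Js_def limit_term_def p_def in_well_def by blast
  obtain K2 where K2: "0 \<le> K2" and b2: "\<And>n t. 4 \<le> n \<Longrightarrow>
      norm (Js (- (pi / 2)) n t / of_real (well_mass \<beta> n) - of_real (well_amplitude \<beta> n) * limit_term \<beta> g (- (pi / 2)) n t) \<le> K2 * (1 + \<bar>t\<bar> + t\<^sup>2) * p n"
    using one_well_asymptotics[OF \<beta> _ g q C2(2)] unfolding Js_def limit_term_def p_def in_well_def by blast
  define K where "K = K1 + K2 + 1"
  have K: "0 \<le> K" unfolding K_def using K1 K2 by simp
  have p_lim: "(\<lambda>n. K * p n) \<longlonglongrightarrow> 0"
    unfolding p_def using q by real_asymp
  have ev_e: "\<forall>\<^sub>F n in sequentially. \<forall>t. norm (e n t) \<le> K * (1 + \<bar>t\<bar> + t\<^sup>2) * p n"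
    using mixed_error_small[OF \<beta> q] eventually_ge_at_top[of 32]
  proof eventually_elim
    case (elim n)
    have mass: "0 < well_mass \<beta> n" using elim \<beta> by (intro well_mass_pos) auto
    show ?case
    proof
      fix t
      have "norm (Jm n t / of_real (well_mass \<beta> n)) = norm (Jm n t) / well_mass \<beta> n"
        using mass by (simp add: norm_divide)
      also have "\<dots> \<le> (well_mass \<beta> n * (2 * (exp (n * mixed_ratio \<beta> n) - 1))) / well_mass \<beta> n"
        using mass elim by (intro divide_right_mono mixed) auto
      also have "\<dots> \<le> 1 * p n" using elim mass unfolding p_def by simp
      also have "\<dots> \<le> (1 + \<bar>t\<bar> + t\<^sup>2) * p n" by (intro mult_right_mono) (auto simp: p_def)
      finally have b3: "norm (Jm n t / of_real (well_mass \<beta> n)) \<le> (1 + \<bar>t\<bar> + t\<^sup>2) * p n" .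
      have "e n t = (Js (pi / 2) n t / of_real (well_mass \<beta> n) - of_real (well_amplitude \<beta> n) * limit_term \<beta> g (pi / 2) n t)
          + (Js (- (pi / 2)) n t / of_real (well_mass \<beta> n) - of_real (well_amplitude \<beta> n) * limit_term \<beta> g (- (pi / 2)) n t)
          + Jm n t / of_real (well_mass \<beta> n)"
        unfolding e_def split M_def by (simp add: add_divide_distrib algebra_simps)
      also have "norm \<dots> \<le> K1 * (1 + \<bar>t\<bar> + t\<^sup>2) * p n + K2 * (1 + \<bar>t\<bar> + t\<^sup>2) * p n + (1 + \<bar>t\<bar> + t\<^sup>2) * p n"
        using b1[of n t] b2[of n t] b3 elim by (intro norm_triangle_mono) auto
      also have "\<dots> = K * (1 + \<bar>t\<bar> + t\<^sup>2) * p n"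
        unfolding K_def by (simp add: algebra_simps)
      finally show "norm (e n t) \<le> K * (1 + \<bar>t\<bar> + t\<^sup>2) * p n" .
    qed
  qed
  \<comment> \<open>Makes the error of the denominator smaller than the amplitude, as the quotient
    estimate demands.\<close>
  have ev_p: "\<forall>\<^sub>F n in sequentially. K * p n < a0"
    using order_tendstoD(2)[OF p_lim a0] .
  have "\<forall>\<^sub>F n in sequentially. \<forall>t.
      norm ((\<integral>\<theta>. exp (\<i> * of_real t * (\<Sum>j=1..n. of_real (g (\<theta> j)))) \<partial>mirror_process n \<beta>) - M n t / 2)
      \<le> (2 * K / a0) * (1 + \<bar>t\<bar> + t\<^sup>2) * n powr (- (q / 2))"
    using ev_e ev_p eventually_ge_at_top[of 4]
  proof eventually_elim
    case (elim n)
    have mass: "0 < well_mass \<beta> n" using elim \<beta> by (intro well_mass_pos) auto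
    have amp: "a0 \<le> well_amplitude \<beta> n" unfolding a0_def using elim \<beta> by (intro well_amplitude_bounds) auto
    have J0: "J n 0 = of_real (mirror_Z n \<beta>)" unfolding J_def mirror_Z_def by simp
    have M0: "M n 0 = 2" unfolding M_def limit_term_0 by simp
    have e0: "norm (e n 0) \<le> K * p n" using elim(1)[rule_format, of 0] by simp
    show ?case
    proof
      fix t
      have "(\<integral>\<theta>. exp (\<i> * of_real t * (\<Sum>j=1..n. of_real (g (\<theta> j)))) \<partial>mirror_process n \<beta>) = J n t / J n 0"
        by (simp only: J0 mirror_expectation_eq[OF \<beta> g]) (simp only: J_def)
      also have "\<dots> = (of_real (well_amplitude \<beta> n) * M n t + e n t) / (of_real (well_amplitude \<beta> n) * 2 + e n 0)"
        unfolding e_def M0 using mass by simp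
      finally have "norm ((\<integral>\<theta>. exp (\<i> * of_real t * (\<Sum>j=1..n. of_real (g (\<theta> j)))) \<partial>mirror_process n \<beta>) - M n t / 2)
          = norm ((of_real (well_amplitude \<beta> n) * M n t + e n t) / (of_real (well_amplitude \<beta> n) * 2 + e n 0) - M n t / 2)"
        by simp
      also have "\<dots> \<le> (norm (e n t) + norm (e n 0)) / well_amplitude \<beta> n"
      proof (rule ratio_error_le)
        show "norm (M n t) \<le> 2"
          unfolding M_def using \<beta>
          by (intro order_trans[OF norm_triangle_ineq]) (auto simp: norm_limit_term intro: order_trans[OF add_mono[of _ 1 _ 1]])
      qed (use amp a0 e0 elim in auto)
      also have "\<dots> \<le> (K * (1 + \<bar>t\<bar> + t\<^sup>2) * p n + K * (1 + \<bar>t\<bar> + t\<^sup>2) * p n) / a0"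
      proof (rule frac_le)
        have "K * 1 * p n \<le> K * (1 + \<bar>t\<bar> + t\<^sup>2) * p n"
          using K by (intro mult_right_mono mult_left_mono) (auto simp: p_def)
        then show "norm (e n t) + norm (e n 0) \<le> K * (1 + \<bar>t\<bar> + t\<^sup>2) * p n + K * (1 + \<bar>t\<bar> + t\<^sup>2) * p n"
          using elim(1) e0 by (intro add_mono) auto
      qed (use amp a0 K in \<open>auto simp: p_def\<close>)
      also have "\<dots> = (2 * K / a0) * (1 + \<bar>t\<bar> + t\<^sup>2) * n powr (- (q / 2))"
        by (simp add: p_def)
      finally show "norm ((\<integral>\<theta>. exp (\<i> * of_real t * (\<Sum>j=1..n. of_real (g (\<theta> j)))) \<partial>mirror_process n \<beta>) - M n t / 2)
          \<le> (2 * K / a0) * (1 + \<bar>t\<bar> + t\<^sup>2) * n powr (- (q / 2))" .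
    qed
  qed
  then show ?thesis
    unfolding M_def using K a0 by (intro exI[of _ "2 * K / a0"]) auto
qed

section \<open>From an additive error to an error in the exponent\<close>

theorem theorem1p5:
  fixes \<beta> q \<zeta> :: real and g :: "real \<Rightarrow> real"
  assumes "\<beta> > 0"
    and "g \<in> borel_measurable lebesgue"
    and "\<And>x. g (x + 2 * pi) = g x"
    and "bounded (range g)"
    and "0 < q" and "q \<le> 1"
    and "C2_Hoelder_near q g (pi / 2)"
    and "C2_Hoelder_near q g (- (pi / 2))"
    and "0 < \<zeta>" and "\<zeta> < min (1 / 4) (q / 2)"
  shows "(\<forall>n\<ge>1. \<forall>t::real.
            (\<integral>\<theta>. exp (\<i> * of_real t * (\<Sum>j=1..n. of_real (g (\<theta> j)))) \<partial>mirror_process n \<beta>) =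
            mirror_I n \<beta> (\<lambda>x. \<i> * of_real t * of_real (g x)) / mirror_I n \<beta> (\<lambda>_. 0)) \<and>
         (\<exists>R\<^sub>1 R\<^sub>2 :: nat \<Rightarrow> real \<Rightarrow> complex. \<forall>K. compact K \<longrightarrow>
            (\<exists>C. \<forall>\<^sub>F n in sequentially. \<forall>t\<in>K.
               norm (R\<^sub>1 n t) \<le> C * real n powr (- \<zeta>) \<and>
               norm (R\<^sub>2 n t) \<le> C * real n powr (- \<zeta>) \<and>
               (\<integral>\<theta>. exp (\<i> * of_real t * (\<Sum>j=1..n. of_real (g (\<theta> j)))) \<partial>mirror_process n \<beta>) =
                 exp (of_nat n * \<i> * of_real t * of_real (g (pi / 2))) / 2 *
                   exp (- of_real ((deriv g (pi / 2))\<^sup>2 / \<beta> * t\<^sup>2)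
                        + of_real (2 * deriv (deriv g) (pi / 2) / \<beta>) * \<i> * of_real t
                        + R\<^sub>1 n t)
               + exp (of_nat n * \<i> * of_real t * of_real (g (- (pi / 2)))) / 2 *
                   exp (- of_real ((deriv g (- (pi / 2)))\<^sup>2 / \<beta> * t\<^sup>2)
                        + of_real (2 * deriv (deriv g) (- (pi / 2)) / \<beta>) * \<i> * of_real t
                        + R\<^sub>2 n t)))"
proof (intro conjI allI impI)
  fix n :: nat and t :: real
  show "(\<integral>\<theta>. exp (\<i> * of_real t * (\<Sum>j=1..n. of_real (g (\<theta> j)))) \<partial>mirror_process n \<beta>) =
            mirror_I n \<beta> (\<lambda>x. \<i> * of_real t * of_real (g x)) / mirror_I n \<beta> (\<lambda>_. 0)"
    unfolding mirror_expectation_eq[OF assms(1,2)] mirror_I_eq mirror_I_zero ..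
next
  define E where "E n t = (\<integral>\<theta>. exp (\<i> * of_real t * (\<Sum>j=1..n. of_real (g (\<theta> j)))) \<partial>mirror_process n \<beta>)" for n and t :: real
  define M where "M s n t = limit_term \<beta> g s n t" for s n t
  \<comment> \<open>Solves \<open>E = M1 / 2 * (1 + w) + M2 / 2\<close>, where \<open>M1\<close> and
    \<open>M2\<close> are the two limiting terms. The first remainder is then
    \<open>Ln (1 + w)\<close>; it is fixed before the compact set, on which only the constant
    depends.\<close>
  define w where "w n t = 2 * (E n t - (M (pi / 2) n t + M (- (pi / 2)) n t) / 2) / M (pi / 2) n t" for n t
  obtain L where L: "0 \<le> L" and ev: "\<forall>\<^sub>F n in sequentially. \<forall>t.
      norm (E n t - (M (pi / 2) n t + M (- (pi / 2)) n t) / 2) \<le> L * (1 + \<bar>t\<bar> + t\<^sup>2) * n powr (- (q / 2))"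
    unfolding E_def M_def using mirror_expectation_asymptotics[OF assms(1,2,5-8)] by blast
  have main: "\<exists>C. \<forall>\<^sub>F n in sequentially. \<forall>t\<in>K.
       norm (Ln (1 + w n t)) \<le> C * real n powr (- \<zeta>) \<and> norm (0::complex) \<le> C * real n powr (- \<zeta>) \<and>
       E n t = M (pi / 2) n t / 2 * exp (Ln (1 + w n t)) + M (- (pi / 2)) n t / 2 * exp 0" if K: "compact K" for K
  proof -
    obtain B where B: "\<And>t. t \<in> K \<Longrightarrow> \<bar>t\<bar> \<le> B"
      using compact_imp_bounded[OF K] unfolding bounded_iff by auto
    \<comment> \<open>On \<open>K\<close> the modulus of the first limiting term is at least
      \<open>exp (- D)\<close> for every \<open>n\<close>, so dividing by it costs only a
      constant.\<close>
    define D where "D = (deriv g (pi / 2))\<^sup>2 / \<beta> * B\<^sup>2"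
    define C where "C = 2 * (L * (1 + \<bar>B\<bar> + B\<^sup>2)) / exp (- D)"
    have C0: "0 \<le> C" unfolding C_def using L by simp
    have lim: "(\<lambda>n. C * real n powr (- \<zeta>)) \<longlonglongrightarrow> 0"
      using assms(9) by real_asymp
    \<comment> \<open>The factor 2 comes from \<open>norm (Ln (1 + w)) <= 2 * norm w\<close> for
      \<open>norm w < 1/2\<close>, which holds for all large \<open>n\<close> because the bound on
      \<open>w\<close> tends to 0 uniformly on \<open>K\<close>.\<close>
    have "\<forall>\<^sub>F n in sequentially. \<forall>t\<in>K.
       norm (Ln (1 + w n t)) \<le> 2 * C * real n powr (- \<zeta>) \<and> norm (0::complex) \<le> 2 * C * real n powr (- \<zeta>) \<and>
       E n t = M (pi / 2) n t / 2 * exp (Ln (1 + w n t)) + M (- (pi / 2)) n t / 2 * exp 0"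
      using ev order_tendstoD(2)[OF lim, of "1 / 2", simplified] eventually_ge_at_top[of 1]
    proof eventually_elim
      case (elim n)
      show ?case
      proof
        fix t assume t: "t \<in> K"
        have tB: "\<bar>t\<bar> \<le> \<bar>B\<bar>" "t\<^sup>2 \<le> B\<^sup>2"
          using B[OF t] by (auto simp: abs_le_square_iff[symmetric])
        have Mlow: "exp (- D) \<le> norm (M (pi / 2) n t)"
          unfolding M_def norm_limit_term D_def using tB assms(1) by (auto intro!: divide_right_mono mult_left_mono)
        then have Mnz: "M (pi / 2) n t \<noteq> 0" by (metis exp_gt_zero norm_zero not_less)
        have pw: "real n powr (- (q / 2)) \<le> real n powr (- \<zeta>)"
          using elim assms(10) by (intro powr_mono) auto
        have "norm (w n t) \<le> (2 * (L * (1 + \<bar>B\<bar> + B\<^sup>2) * n powr (- \<zeta>))) / exp (- D)"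
          unfolding w_def norm_divide norm_mult
        proof (rule frac_le)
          have "norm (E n t - (M (pi / 2) n t + M (- (pi / 2)) n t) / 2) \<le> L * (1 + \<bar>t\<bar> + t\<^sup>2) * n powr (- (q / 2))"
            using elim(1) by blast
          also have "\<dots> \<le> L * (1 + \<bar>B\<bar> + B\<^sup>2) * n powr (- \<zeta>)"
            using L tB pw by (intro mult_mono add_mono) auto
          finally show "norm (2::complex) * norm (E n t - (M (pi / 2) n t + M (- (pi / 2)) n t) / 2) \<le> 2 * (L * (1 + \<bar>B\<bar> + B\<^sup>2) * n powr (- \<zeta>))"
            by simp
        qed (use L Mlow in auto)
        also have "\<dots> = C * n powr (- \<zeta>)" unfolding C_def by simp
        finally have wC: "norm (w n t) \<le> C * n powr (- \<zeta>)" .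
        then have w: "norm (w n t) < 1 / 2" using elim(2) by linarith
        have "norm (Ln (1 + w n t)) \<le> 2 * norm (w n t)" using w by (rule norm_Ln_le)
        also have "\<dots> \<le> 2 * C * n powr (- \<zeta>)" using wC by simp
        finally have Ln: "norm (Ln (1 + w n t)) \<le> 2 * C * n powr (- \<zeta>)" .
        have "1 + w n t \<noteq> 0"
        proof
          assume "1 + w n t = 0"
          then have "w n t = - 1" by (simp add: eq_neg_iff_add_eq_0 add.commute)
          then show False using w by simp
        qed
        then have exp_Ln_w: "exp (Ln (1 + w n t)) = 1 + w n t" by (rule exp_Ln)
        have "M (pi / 2) n t / 2 * exp (Ln (1 + w n t)) + M (- (pi / 2)) n t / 2 * exp 0 = E n t"
          unfolding exp_Ln_w unfolding w_def using Mnz by (simp add: field_simps)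
        then show "norm (Ln (1 + w n t)) \<le> 2 * C * real n powr (- \<zeta>) \<and> norm (0::complex) \<le> 2 * C * real n powr (- \<zeta>) \<and>
           E n t = M (pi / 2) n t / 2 * exp (Ln (1 + w n t)) + M (- (pi / 2)) n t / 2 * exp 0"
          using Ln C0 by simp
      qed
    qed
    then show ?thesis by blast
  qed
  \<comment> \<open>Pulls the remainder out of the exponent, so that the claim matches the form
    proved above; for the second well the remainder appears there as \<open>exp 0\<close>.\<close>
  have shape: "exp u / 2 * exp (v + r) = exp u * exp v / 2 * exp r" for u v r :: complex
    by (simp add: exp_add)
  show "\<exists>R\<^sub>1 R\<^sub>2 :: nat \<Rightarrow> real \<Rightarrow> complex. \<forall>K. compact K \<longrightarrow>
            (\<exists>C. \<forall>\<^sub>F n in sequentially. \<forall>t\<in>K.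
               norm (R\<^sub>1 n t) \<le> C * real n powr (- \<zeta>) \<and>
               norm (R\<^sub>2 n t) \<le> C * real n powr (- \<zeta>) \<and>
               (\<integral>\<theta>. exp (\<i> * of_real t * (\<Sum>j=1..n. of_real (g (\<theta> j)))) \<partial>mirror_process n \<beta>) =
                 exp (of_nat n * \<i> * of_real t * of_real (g (pi / 2))) / 2 *
                   exp (- of_real ((deriv g (pi / 2))\<^sup>2 / \<beta> * t\<^sup>2)
                        + of_real (2 * deriv (deriv g) (pi / 2) / \<beta>) * \<i> * of_real t
                        + R\<^sub>1 n t)
               + exp (of_nat n * \<i> * of_real t * of_real (g (- (pi / 2)))) / 2 *
                   exp (- of_real ((deriv g (- (pi / 2)))\<^sup>2 / \<beta> * t\<^sup>2)
                        + of_real (2 * deriv (deriv g) (- (pi / 2)) / \<beta>) * \<i> * of_real t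
                        + R\<^sub>2 n t))"
    by (intro exI[of _ "\<lambda>n t. Ln (1 + w n t)"] exI[of _ "\<lambda>n t. 0"] allI impI)
      (use main in \<open>simp only: shape E_def M_def limit_term_def\<close>)
qed

end
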